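(* Let $F_0$ be the solution of $F_0'' = -3Q(t)^2F_0$ for $t > 0$ with $F_0(0) = 0$, $F_0'(0) = -1$, and let $t_0 > 0$ be the first positive zero of $F_0$. Let $q$ solve $$q''(t) = -3Q(t+t_0)^2\,q(t), \quad t > 0, \qquad q(0) = 0,\ q'(0) = 1.$$ Then $q(t) > 0$ for all $0 < t < \infty$. Furthermore, there is a constant $c_0 > 0$ with $\min_{t \ge 1}\frac{q(t)}{t} \ge c_0$.
   Context: $Q(t)$, $t\ge 0$, denotes the radial profile of the positive radial ground state of $\Delta\phi - \phi + |\phi|^2\phi = 0$ on $\mathbb{R}^3$; it solves $-Q'' - \frac{2}{t}Q' + Q - Q^3 = 0$. The first positive zero $t_0$ of $F_0$ exists; this is the case $\epsilon = 0$ of the paper's sign-change lemma. *)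

theory Defs
  imports "HOL-Analysis.Analysis"
begin

text \<open>Radial profile of the positive radial ground state of
  Delta phi - phi + phi^3 = 0 on R^3: a positive, decaying C^2 solution on [0,inf) of
  -Q'' - (2/t) Q' + Q - Q^3 = 0 for t > 0, regular at the origin (Q'(0) = 0).
  Q' is given as dQ.\<close>
definition ground_state_profile :: "(real \<Rightarrow> real) \<Rightarrow> (real \<Rightarrow> real) \<Rightarrow> bool" where
  "ground_state_profile Q dQ \<longleftrightarrow>
     (\<forall>t\<ge>0. Q t > 0) \<and>
     continuous_on {0..} Q \<and> continuous_on {0..} dQ \<and>
     (\<forall>t\<ge>0. (Q has_real_derivative dQ t) (at t within {0..})) \<and>
     dQ 0 = 0 \<and>
     (\<forall>t>0. \<exists>d2. (dQ has_real_derivative d2) (at t) \<and>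
                 - d2 - (2 / t) * dQ t + Q t - Q t ^ 3 = 0) \<and>
     (Q \<longlongrightarrow> 0) at_top"

text \<open>f (with derivative df) solves f'' = -3 V(t)^2 f on t > 0, with f and f'
  continuous on [0,inf) so that the initial values f 0, df 0 are meaningful.\<close>
definition solves_lin_ode :: "(real \<Rightarrow> real) \<Rightarrow> (real \<Rightarrow> real) \<Rightarrow> (real \<Rightarrow> real) \<Rightarrow> bool" where
  "solves_lin_ode V f df \<longleftrightarrow>
     continuous_on {0..} f \<and> continuous_on {0..} df \<and>
     (\<forall>t>0. (f has_real_derivative df t) (at t)) \<and>
     (\<forall>t>0. (df has_real_derivative (-3 * V t ^ 2 * f t)) (at t))"

end

theory Submission
  imports Defs
begin

text \<open>
  Write u = tQ and S = Q^2. The solution q is linearly bounded below as soon as f'' = -3Sf has a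
  supersolution w on [t0, \<infinity>) with 0 < m \<le> w \<le> 1 (Sturm comparison). Such a w is 1 - rS with r a
  suitable quadratic, continued by its tangent line. Two quantitative facts about Q are needed.

  Near the origin, u^2 lies between two polynomials in t^2 and -tQ'/Q. This makes u times an explicit
  factor P a strict supersolution up to the first zero tp of P, so that tp \<le> t0.

  Near infinity, put z = 1 + u'/u and K = S - 2z(2 - z); K is positive because the energy decreases.
  A deviation of K from the barriers 2z/(gt + A - Bz) on the wrong side would grow exponentially, which
  a decaying Q excludes. Both estimates together confine tp to a short interval, on which the inequality
  satisfied by w reduces to polynomial inequalities in t and z.
\<close>

section \<open>Differential inequalities on the line\<close>

text \<open>Nothing explicit is known about Q, not even Q 0, and t0 comes from a second equation, so
  the estimates use variables from which Q drops out. Inside, a = \<open>rho t\<close>, b = u^2 and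
  c = t^2 obey the polynomial system t a' = a^2 - a + b - c, t b' = 2 b (1 - a), t c' = 2 c.
  Whatever Q 0 is, the profile starts at the rest point 0, so one barrier b = beta(a, c) serves all
  values. Outside, (z, K) obeys a closed system affine in K, and decay at infinity formally singles
  out K ~ 2 z / t; here information travels backwards in t. Both descriptions are valid at tp, and
  comparing the values of u^2 that they allow there locates tp. Of t0 only tp <= t0 is used: a
  supersolution on [tp, inf) serves every shift s >= tp. Since w turns out to be increasing, its
  lower bound reduces to r S < 1 at tp. This condition has little room; it forces precise knowledge
  of tp, and r is chosen separately for tp below and above 49/100.\<close>

lemma last_point_le:
  fixes f :: "real \<Rightarrow> real"
  assumes "x0 \<le> t" "continuous_on {x0..t} f" "f x0 \<le> m" "m < f t"
  obtains z where "x0 \<le> z" "z < t" "f z = m" "\<And>x. z < x \<Longrightarrow> x \<le> t \<Longrightarrow> m < f x"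
proof -
  define A where "A = {x \<in> {x0..t}. f x \<le> m}"
  have "closed A"
    unfolding A_def using continuous_closed_preimage[OF assms(2) closed_atLeastAtMost, of "{..m}"]
    by (simp add: vimage_def Int_def conj_commute)
  moreover have "bounded A" by (rule bounded_subset[of "{x0..t}"]) (auto simp: A_def)
  ultimately have "compact A" using compact_eq_bounded_closed by blast
  moreover have "x0 \<in> A" using assms by (auto simp: A_def)
  ultimately obtain z where z: "z \<in> A" "\<And>x. x \<in> A \<Longrightarrow> x \<le> z"
    using compact_attains_sup[of A] by blast
  have zt: "z < t" using z(1) assms(4) by (cases "z = t") (auto simp: A_def)
  have gt: "m < f x" if "z < x" "x \<le> t" for x
    using z that by (fastforce simp: A_def)
  have "continuous_on {z..t} f"
    by (rule continuous_on_subset[OF assms(2)]) (use z in \<open>auto simp: A_def\<close>)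
  then obtain x where x: "z \<le> x" "x \<le> t" "f x = m"
    using IVT'[of f z m t] z(1) assms(4) zt by (auto simp: A_def)
  have "x = z" using gt[of x] x by force
  then show thesis using that[of z] z(1) zt gt x by (auto simp: A_def)
qed

text \<open>Beyond the last point at level m the function lies above m, where it cannot
  increase.\<close>

lemma no_rise:
  fixes f f' :: "real \<Rightarrow> real"
  assumes "x0 \<le> t" "continuous_on {x0..t} f" "f x0 \<le> m"
    and "\<And>x. x0 < x \<Longrightarrow> x \<le> t \<Longrightarrow> (f has_real_derivative f' x) (at x)"
    and "\<And>x. x0 < x \<Longrightarrow> x \<le> t \<Longrightarrow> m < f x \<Longrightarrow> f' x \<le> 0"
  shows "f t \<le> m"
proof (rule ccontr)
  assume "\<not> f t \<le> m"
  then have "m < f t" by simp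
  then obtain z where z: "x0 \<le> z" "z < t" "f z = m" "\<And>x. z < x \<Longrightarrow> x \<le> t \<Longrightarrow> m < f x"
    using last_point_le[OF assms(1-3)] by metis
  have "f t \<le> f z"
  proof (rule DERIV_nonpos_imp_decreasing_open[of z t f])
    show "continuous_on {z..t} f"
      by (rule continuous_on_subset[OF assms(2)]) (use z in auto)
    show "\<exists>y. (f has_real_derivative y) (at x) \<and> y \<le> 0" if "z < x" "x < t" for x
      using assms(4)[of x] assms(5)[of x] z that by (intro exI[of _ "f' x"]) auto
  qed (use z in auto)
  then show False using z \<open>m < f t\<close> by simp
qed

text \<open>Complements \<open>no_rise\<close>: the sign of f' is known only at zeros of f, but
  strictly, so right after its last zero f would have to be negative.\<close>

lemma no_cross:
  fixes f f' :: "real \<Rightarrow> real"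
  assumes "x0 \<le> t" "f x0 \<le> 0"
    and "\<And>x. x0 \<le> x \<Longrightarrow> x \<le> t \<Longrightarrow> (f has_real_derivative f' x) (at x)"
    and "\<And>x. x0 \<le> x \<Longrightarrow> x \<le> t \<Longrightarrow> f x = 0 \<Longrightarrow> f' x < 0"
  shows "f t \<le> 0"
proof (rule ccontr)
  assume "\<not> f t \<le> 0"
  then have ft: "0 < f t" by simp
  have cont: "continuous_on {x0..t} f"
    by (rule DERIV_atLeastAtMost_imp_continuous_on) (use assms(3) in blast)
  obtain z where z: "x0 \<le> z" "z < t" "f z = 0" "\<And>x. z < x \<Longrightarrow> x \<le> t \<Longrightarrow> 0 < f x"
    using last_point_le[OF assms(1) cont assms(2) ft] by metis
  obtain d where d: "0 < d" "\<And>h. 0 < h \<Longrightarrow> h < d \<Longrightarrow> f (z + h) < f z"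
    using DERIV_neg_dec_right[OF assms(3)[of z] assms(4)[of z]] z by auto
  define h where "h = min (d / 2) (t - z)"
  have "0 < h" "h < d" "z + h \<le> t" using d z by (auto simp: h_def min_def)
  then show False using d(2)[of h] z(4)[of "z + h"] z(3) by force
qed

lemma first_zero:
  fixes f :: "real \<Rightarrow> real"
  assumes "x0 \<le> t" "continuous_on {x0..t} f" "0 < f x0" "f t \<le> 0"
  obtains z where "x0 < z" "z \<le> t" "f z = 0" "\<And>x. x0 \<le> x \<Longrightarrow> x < z \<Longrightarrow> 0 < f x"
proof -
  have ct: "continuous_on {-t..-x0} (\<lambda>x. f (- x))"
    by (rule continuous_on_compose2[OF assms(2)]) (auto intro!: continuous_intros)
  obtain z where "- t \<le> z" "z < - x0" "f (- z) = 0"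
      "\<And>x. z < x \<Longrightarrow> x \<le> - x0 \<Longrightarrow> 0 < f (- x)"
    using last_point_le[OF _ ct, of 0] assms by auto
  then show thesis using that[of "- z"]
    by (metis add.inverse_inverse le_minus_iff minus_le_iff minus_less_iff less_minus_iff)
qed

text \<open>The lower bound on psi keeps D positive, because D exp(M t) increases. Once psi >= 1, D
  grows at least linearly, which already contradicts the bound B. This turns behaviour at infinity
  into an estimate at the finite time t0.\<close>

lemma exponential_escape:
  fixes D D' psi :: "real \<Rightarrow> real"
  assumes D0: "0 < D t0"
    and der: "\<And>t. t0 \<le> t \<Longrightarrow> (D has_real_derivative D' t) (at t)"
    and ge: "\<And>t. t0 \<le> t \<Longrightarrow> 0 < D t \<Longrightarrow> psi t * D t \<le> D' t"
    and low: "\<And>t. t0 \<le> t \<Longrightarrow> - M \<le> psi t"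
    and ev: "\<And>t. T \<le> t \<Longrightarrow> 1 \<le> psi t"
    and bd: "\<And>t. t0 \<le> t \<Longrightarrow> D t \<le> B"
  shows False
proof -
  have pos: "0 < D t" if t0t: "t0 \<le> t" for t
  proof (rule ccontr)
    assume "\<not> 0 < D t"
    then have Dt: "D t \<le> 0" by simp
    have cont: "continuous_on {t0..t} D"
      by (rule DERIV_atLeastAtMost_imp_continuous_on) (use der in blast)
    obtain z where z: "t0 < z" "z \<le> t" "D z = 0" "\<And>x. t0 \<le> x \<Longrightarrow> x < z \<Longrightarrow> 0 < D x"
      using first_zero[OF t0t cont D0 Dt] by blast
    have "D t0 * exp (M * t0) \<le> D z * exp (M * z)"
    proof (rule DERIV_nonneg_imp_increasing_open[of t0 z "\<lambda>x. D x * exp (M * x)"])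
      fix x assume x: "t0 < x" "x < z"
      have "((\<lambda>x. D x * exp (M * x)) has_real_derivative (D' x + M * D x) * exp (M * x)) (at x)"
        by (rule derivative_eq_intros der refl | use x in \<open>simp add: algebra_simps\<close>)+
      moreover have "- M * D x \<le> psi x * D x"
        using low[of x] z(4)[of x] x by (intro mult_right_mono) auto
      then have "0 \<le> (D' x + M * D x) * exp (M * x)"
        using ge[of x] z(4)[of x] x by (intro mult_nonneg_nonneg) auto
      ultimately show "\<exists>y. ((\<lambda>x. D x * exp (M * x)) has_real_derivative y) (at x) \<and> 0 \<le> y" by blast
    next
      show "continuous_on {t0..z} (\<lambda>x. D x * exp (M * x))"
        by (intro continuous_intros DERIV_atLeastAtMost_imp_continuous_on) (use der in blast)
    qed (use z in auto)
    moreover have "0 < D t0 * exp (M * t0)" using D0 by simp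
    ultimately show False using z(3) by simp
  qed
  define T' where "T' = max T t0"
  have T': "t0 \<le> T'" "T \<le> T'" by (auto simp: T'_def)
  have lin: "D T' + D T' * (t - T') \<le> D t" if t: "T' \<le> t" for t
  proof -
    have inc: "D T' \<le> D x" if x: "T' \<le> x" for x
    proof (rule DERIV_nonneg_imp_nondecreasing[OF x])
      fix s assume s: "T' \<le> s" "s \<le> x"
      have "1 * D s \<le> psi s * D s" using ev[of s] pos[of s] s T' by (intro mult_right_mono) auto
      moreover have "psi s * D s \<le> D' s" "0 < D s" using ge[of s] pos[of s] s T' by auto
      ultimately have "0 \<le> D' s" by linarith
      then show "\<exists>y. (D has_real_derivative y) (at s) \<and> 0 \<le> y" using der[of s] s T' by auto
    qed
    have "D T' - D T' * (T' - T') \<le> D t - D T' * (t - T')"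
    proof (rule DERIV_nonneg_imp_nondecreasing[OF t, of "\<lambda>x. D x - D T' * (x - T')"])
      fix s assume s: "T' \<le> s" "s \<le> t"
      have "1 * D s \<le> psi s * D s" using ev[of s] pos[of s] s T' by (intro mult_right_mono) auto
      moreover have "psi s * D s \<le> D' s" "D T' \<le> D s" using ge[of s] pos[of s] s T' inc[of s] by auto
      ultimately have "D T' \<le> D' s" by linarith
      moreover have "((\<lambda>x. D x - D T' * (x - T')) has_real_derivative (D' s - D T')) (at s)"
        using s T' by (auto intro!: derivative_eq_intros der)
      ultimately show "\<exists>y. ((\<lambda>x. D x - D T' * (x - T')) has_real_derivative y) (at s) \<and> 0 \<le> y"
        by (intro exI[of _ "D' s - D T'"]) auto
    qed
    then show ?thesis by simp
  qed
  have DT: "0 < D T'" using pos[of T'] T' by simp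
  define t where "t = T' + \<bar>B\<bar> / D T'"
  have "T' \<le> t" using DT by (simp add: t_def)
  moreover have "D T' * (t - T') = \<bar>B\<bar>" using DT by (simp add: t_def)
  ultimately show False using lin[of t] bd[of t] T' DT by linarith
qed

section \<open>The ground state\<close>

locale ground_state =
  fixes Q dQ :: "real \<Rightarrow> real"
  assumes profile: "ground_state_profile Q dQ"
begin

lemma Q_pos: "0 \<le> t \<Longrightarrow> 0 < Q t"
  using profile by (auto simp: ground_state_profile_def)

lemma Q_deriv: assumes "0 < t" shows "(Q has_real_derivative dQ t) (at t)"
proof -
  have "(Q has_real_derivative dQ t) (at t within {0..})"
    using profile assms by (simp add: ground_state_profile_def)
  moreover have "at t within {0..} = at t"
    using assms by (intro at_within_interior) simp
  ultimately show ?thesis by simp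
qed

lemma dQ_deriv: "0 < t \<Longrightarrow> (dQ has_real_derivative Q t - Q t ^ 3 - 2 * dQ t / t) (at t)"
proof -
  assume "0 < t"
  then obtain d where d: "(dQ has_real_derivative d) (at t)"
      "- d - (2 / t) * dQ t + Q t - Q t ^ 3 = 0"
    using profile by (auto simp: ground_state_profile_def)
  then have "d = Q t - Q t ^ 3 - 2 * dQ t / t" by (simp add: field_simps)
  then show ?thesis using d by simp
qed

lemma Q_cont: "continuous_on {0..} Q" and dQ_cont: "continuous_on {0..} dQ" and dQ_0: "dQ 0 = 0"
  and Q_lim: "(Q \<longlongrightarrow> 0) at_top"
  using profile by (auto simp: ground_state_profile_def)

lemma Q_eventually_less:
  assumes "0 < e" obtains T where "0 < T" "\<And>t. T \<le> t \<Longrightarrow> Q t < e"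
proof -
  have "eventually (\<lambda>t. Q t < e) at_top" using order_tendstoD(2)[OF Q_lim assms] .
  then obtain T where "\<And>t. T \<le> t \<Longrightarrow> Q t < e" by (auto simp: eventually_at_top_linorder)
  then show thesis using that[of "max T 1"] by auto
qed

definition u where "u t = t * Q t"
definition du where "du t = Q t + t * dQ t"

lemma u_pos: "0 < t \<Longrightarrow> 0 < u t"
  by (simp add: u_def Q_pos)

lemma u_deriv: "0 < t \<Longrightarrow> (u has_real_derivative du t) (at t)"
  unfolding u_def[abs_def] du_def by (auto intro!: derivative_eq_intros Q_deriv)

lemma du_deriv: assumes "0 < t" shows "(du has_real_derivative u t * (1 - (Q t)\<^sup>2)) (at t)"
proof -
  have "(du has_real_derivative dQ t + (dQ t + t * (Q t - Q t ^ 3 - 2 * dQ t / t))) (at t)"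
    unfolding du_def[abs_def] using assms
    by (auto intro!: derivative_eq_intros Q_deriv dQ_deriv)
  moreover have "dQ t + (dQ t + t * (Q t - Q t ^ 3 - 2 * dQ t / t)) = u t * (1 - (Q t)\<^sup>2)"
    using assms by (simp add: u_def field_simps power2_eq_square power3_eq_cube)
  ultimately show ?thesis by simp
qed

lemma du_cont: "continuous_on {0..} du"
  unfolding du_def[abs_def] by (intro continuous_intros Q_cont dQ_cont)

text \<open>The friction term 2 Q'/t makes this energy decrease, at rate 8 Q'^2 / t. A negative
  value would therefore persist, whereas the only negative term, -2 Q^2, tends to 0.\<close>

lemma energy_nonneg:
  assumes "0 \<le> t" shows "0 \<le> 2 * (dQ t)\<^sup>2 - 2 * (Q t)\<^sup>2 + Q t ^ 4"
proof (rule ccontr)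
  let ?E = "\<lambda>t. 2 * (dQ t)\<^sup>2 - 2 * (Q t)\<^sup>2 + Q t ^ 4"
  assume neg: "\<not> 0 \<le> ?E t"
  define e where "e = - ?E t"
  have e: "0 < e" using neg by (simp add: e_def)
  have dec: "?E s \<le> ?E t" if s: "t \<le> s" for s
  proof (rule DERIV_nonpos_imp_decreasing_open[OF s])
    fix x assume x: "t < x" "x < s"
    then have "0 < x" using assms by simp
    have "(?E has_real_derivative - 8 * (dQ x)\<^sup>2 / x) (at x)"
      using \<open>0 < x\<close>
      by (auto intro!: derivative_eq_intros Q_deriv dQ_deriv
          simp: field_simps power2_eq_square power3_eq_cube)
    moreover have "- 8 * (dQ x)\<^sup>2 / x \<le> 0" using \<open>0 < x\<close> by (simp add: divide_nonpos_pos)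
    ultimately show "\<exists>y. (?E has_real_derivative y) (at x) \<and> y \<le> 0" by blast
  next
    show "continuous_on {t..s} ?E"
      using assms by (intro continuous_intros continuous_on_subset[OF Q_cont] continuous_on_subset[OF dQ_cont]) auto
  qed
  define d where "d = sqrt (e / 2)"
  have d: "0 < d" "d\<^sup>2 = e / 2" using e by (auto simp: d_def)
  obtain T where T: "0 < T" "\<And>t. T \<le> t \<Longrightarrow> Q t < d"
    using Q_eventually_less[OF d(1)] by metis
  define s where "s = max T t"
  have "T \<le> s" "t \<le> s" by (auto simp: s_def)
  then have s: "Q s < d" "?E s \<le> - e" "0 < Q s"
    using T dec[of s] Q_pos[of s] assms by (auto simp: e_def)
  then have "(Q s)\<^sup>2 < d\<^sup>2" by (intro power_strict_mono) auto
  moreover have "0 \<le> (dQ s)\<^sup>2" "0 \<le> Q s ^ 4" by simp_all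
  ultimately show False using s(2) d(2) by linarith
qed

lemma Q0_ge: "2 \<le> (Q 0)\<^sup>2"
proof -
  have "0 \<le> (Q 0)\<^sup>2 * ((Q 0)\<^sup>2 - 2)"
    using energy_nonneg[of 0] by (simp add: dQ_0 power4_eq_xxxx power2_eq_square algebra_simps)
  then show ?thesis using Q_pos[of 0] by (simp add: zero_le_mult_iff)
qed

text \<open>Two stages: t^2 Q' decreases while Q > 1. After Q has passed 1, a first zero of Q' would
  have Q < 1, and there the energy reduces to Q^2 (Q^2 - 2) < 0.\<close>

lemma dQ_neg: assumes "0 < t" shows "dQ t < 0"
proof -
  have Qgt1: "1 < Q 0"
    using Q0_ge Q_pos[of 0] by (intro power2_less_imp_less[of 1 "Q 0"]) auto
  obtain T where T: "0 < T" "\<And>t. T \<le> t \<Longrightarrow> Q t < 1" using Q_eventually_less[of 1] by auto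
  have "continuous_on {0..T} (\<lambda>t. Q t - 1)"
    by (intro continuous_intros continuous_on_subset[OF Q_cont]) auto
  then obtain tau where tau: "0 < tau" "Q tau - 1 = 0" "\<And>x. 0 \<le> x \<Longrightarrow> x < tau \<Longrightarrow> 0 < Q x - 1"
    using first_zero[of 0 T "\<lambda>t. Q t - 1"] T(1) T(2)[of T] Qgt1 by (auto simp: less_imp_le)
  have early: "dQ t < 0" if t: "0 < t" "t \<le> tau" for t
  proof -
    have "t\<^sup>2 * dQ t < 0\<^sup>2 * dQ 0"
    proof (rule DERIV_neg_imp_decreasing_open[OF t(1), of "\<lambda>t. t\<^sup>2 * dQ t"])
      fix x assume x: "0 < x" "x < t"
      have "((\<lambda>t. t\<^sup>2 * dQ t) has_real_derivative x\<^sup>2 * (Q x * (1 - (Q x)\<^sup>2))) (at x)"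
        using x by (auto intro!: derivative_eq_intros dQ_deriv
            simp: field_simps power2_eq_square power3_eq_cube)
      moreover have "1 < (Q x)\<^sup>2" using tau(3)[of x] x t by (simp add: one_less_power)
      then have "x\<^sup>2 * (Q x * (1 - (Q x)\<^sup>2)) < 0"
        using x Q_pos[of x] by (intro mult_pos_neg mult_pos_neg) auto
      ultimately show "\<exists>y. ((\<lambda>t. t\<^sup>2 * dQ t) has_real_derivative y) (at x) \<and> y < 0" by blast
    next
      show "continuous_on {0..t} (\<lambda>t. t\<^sup>2 * dQ t)"
        by (intro continuous_intros continuous_on_subset[OF dQ_cont]) auto
    qed
    then show ?thesis using t by (simp add: mult_less_0_iff)
  qed
  show ?thesis
  proof (rule ccontr)
    assume neg: "\<not> dQ t < 0"
    then have "tau < t" using early[OF assms] by force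
    then have "continuous_on {tau..t} (\<lambda>t. - dQ t)"
      using tau(1) by (intro continuous_intros continuous_on_subset[OF dQ_cont]) auto
    then obtain s where s: "tau < s" "- dQ s = 0" "\<And>x. tau \<le> x \<Longrightarrow> x < s \<Longrightarrow> 0 < - dQ x"
      using first_zero[of tau t "\<lambda>t. - dQ t"] early[of tau] neg tau(1) \<open>tau < t\<close>
      by (auto simp: less_imp_le)
    have "Q s < Q tau"
    proof (rule DERIV_neg_imp_decreasing_open[OF s(1)])
      show "\<exists>y. (Q has_real_derivative y) (at x) \<and> y < 0" if "tau < x" "x < s" for x
        using Q_deriv[of x] s(3)[of x] that tau(1) by auto
      show "continuous_on {tau..s} Q" using tau(1) by (intro continuous_on_subset[OF Q_cont]) auto
    qed
    then have "Q s < 1" "0 < Q s" using tau Q_pos[of s] s by auto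
    then have "(Q s)\<^sup>2 < 1" by (simp add: power_less_one_iff)
    moreover have "0 \<le> (Q s)\<^sup>2 * ((Q s)\<^sup>2 - 2)"
      using energy_nonneg[of s] s tau(1) by (simp add: power4_eq_xxxx power2_eq_square algebra_simps)
    ultimately show False using \<open>0 < Q s\<close> by (simp add: zero_le_mult_iff)
  qed
qed

lemma Q_strict_dec: assumes "0 \<le> s" "s < t" shows "Q t < Q s"
proof (rule DERIV_neg_imp_decreasing_open[OF assms(2)])
  show "\<exists>y. (Q has_real_derivative y) (at x) \<and> y < 0" if "s < x" "x < t" for x
    using Q_deriv[of x] dQ_neg[of x] that assms by auto
  show "continuous_on {s..t} Q" using assms by (intro continuous_on_subset[OF Q_cont]) auto
qed

text \<open>Where Q^2 < 1 the positive function u is convex. A late point with u' >= 0 would thus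
  make u grow linearly, against Q = u/t -> 0.\<close>

lemma du_eventually_neg:
  obtains T where "0 < T" "\<And>t. T \<le> t \<Longrightarrow> du t < 0" "\<And>t. T \<le> t \<Longrightarrow> (Q t)\<^sup>2 < 1 / 2"
proof -
  obtain T where T: "0 < T" "\<And>t. T \<le> t \<Longrightarrow> Q t < 1 / 2"
    using Q_eventually_less[of "1/2"] by auto
  have Q2: "(Q t)\<^sup>2 < 1 / 2" if "T \<le> t" for t
  proof -
    have "(Q t)\<^sup>2 \<le> (1/2)\<^sup>2" using T(2)[OF that] Q_pos[of t] T(1) that by (intro power_mono) auto
    then show ?thesis by (simp add: power2_eq_square)
  qed
  have "du t < 0" if t: "T \<le> t" for t
  proof (rule ccontr)
    assume "\<not> du t < 0"
    have inc: "du r < du s" if rs: "t \<le> r" "r < s" for r s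
    proof (rule DERIV_pos_imp_increasing[OF rs(2)])
      fix x assume "r \<le> x" "x \<le> s"
      then have "0 < x" "T \<le> x" using T t rs by auto
      then show "\<exists>y. (du has_real_derivative y) (at x) \<and> 0 < y"
        using du_deriv[of x] Q2[of x] u_pos[of x]
        by (intro exI[of _ "u x * (1 - (Q x)\<^sup>2)"]) (auto intro!: mult_pos_pos)
    qed
    define d where "d = du (t + 1)"
    have d: "0 < d" using inc[of t "t + 1"] \<open>\<not> du t < 0\<close> by (simp add: d_def)
    have lin: "d * (s - (t + 1)) \<le> u s" if s: "t + 1 \<le> s" for s
    proof -
      have "u (t + 1) - d * ((t + 1) - (t + 1)) \<le> u s - d * (s - (t + 1))"
      proof (rule DERIV_nonneg_imp_nondecreasing[OF s, of "\<lambda>x. u x - d * (x - (t + 1))"])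
        fix x assume x: "t + 1 \<le> x" "x \<le> s"
        have "((\<lambda>x. u x - d * (x - (t + 1))) has_real_derivative du x - d) (at x)"
          using x t T by (auto intro!: derivative_eq_intros u_deriv)
        moreover have "d \<le> du x" using inc[of "t + 1" x] x by (cases "x = t + 1") (auto simp: d_def)
        ultimately show "\<exists>y. ((\<lambda>x. u x - d * (x - (t + 1))) has_real_derivative y) (at x) \<and> 0 \<le> y"
          by (intro exI[of _ "du x - d"]) auto
      qed
      then show ?thesis using u_pos[of "t + 1"] t T by simp
    qed
    obtain T2 where T2: "0 < T2" "\<And>t. T2 \<le> t \<Longrightarrow> Q t < d / 2" using Q_eventually_less[of "d/2"] d by auto
    define s where "s = max T2 (2 * (t + 1))"
    have s: "T2 \<le> s" "2 * (t + 1) \<le> s" "0 < s" using T2 by (auto simp: s_def)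
    have "u s < s * (d / 2)" using T2(2)[OF s(1)] s by (simp add: u_def)
    moreover have "d * (s / 2) \<le> d * (s - (t + 1))" using d s by (intro mult_left_mono) auto
    moreover have "d * (s - (t + 1)) \<le> u s" using lin[of s] s t T by simp
    ultimately show False by (simp add: field_simps)
  qed
  then show thesis using that T(1) Q2 by blast
qed

text \<open>The energy of u for the autonomous equation obtained by freezing the coefficient \<open>1 / t^2\<close> of u cubed
  in the equation of u; it decreases since that coefficient does.\<close>

lemma K_energy_pos:
  assumes "0 < t" shows "0 < 2 * (du t)\<^sup>2 - 2 * (u t)\<^sup>2 + (u t)\<^sup>2 * (Q t)\<^sup>2"
proof (rule ccontr)
  let ?h = "\<lambda>t. 2 * (du t)\<^sup>2 - 2 * (u t)\<^sup>2 + (u t)\<^sup>2 * (Q t)\<^sup>2"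
  assume neg: "\<not> 0 < ?h t"
  have dec: "?h s < ?h r" if rs: "t \<le> r" "r < s" for r s
  proof (rule DERIV_neg_imp_decreasing[OF rs(2)])
    fix x assume x: "r \<le> x" "x \<le> s"
    then have "0 < x" using rs assms by simp
    have eq: "dQ x = (du x - Q x) / x" using \<open>0 < x\<close> by (simp add: du_def)
    have "(?h has_real_derivative - 2 * (u x)\<^sup>2 * (Q x)\<^sup>2 / x) (at x)"
      using \<open>0 < x\<close>
      by (auto intro!: derivative_eq_intros Q_deriv u_deriv du_deriv
          simp: eq u_def field_simps power2_eq_square)
    moreover have "- 2 * (u x)\<^sup>2 * (Q x)\<^sup>2 / x < 0"
      using \<open>0 < x\<close> u_pos[of x] Q_pos[of x] by (simp add: divide_neg_pos)
    ultimately show "\<exists>y. (?h has_real_derivative y) (at x) \<and> y < 0" by blast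
  qed
  define e where "e = - ?h (t + 1)"
  have e: "0 < e" using dec[of t "t + 1"] neg by (simp add: e_def)
  obtain T where T: "0 < T" "\<And>t. T \<le> t \<Longrightarrow> du t < 0" "\<And>t. T \<le> t \<Longrightarrow> (Q t)\<^sup>2 < 1 / 2"
    using du_eventually_neg by metis
  define R where "R = max T (t + 1)"
  have R: "T \<le> R" "t + 1 \<le> R" by (auto simp: R_def)
  define d where "d = sqrt (e / 2)"
  have d: "0 < d" "d\<^sup>2 = e / 2" using e by (auto simp: d_def)
  \<comment> \<open>A value h <= -e can only come from the term -2 u^2, so u stays above d. Then u''
    >= d/2 drives u' to positive values, which contradicts \<open>du_eventually_neg\<close>.\<close>
  have ud: "d \<le> u s" if s: "R \<le> s" for s
  proof -
    have "?h s \<le> - e" using dec[of "t + 1" s] R s by (cases "s = t + 1") (auto simp: e_def)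
    moreover have "0 \<le> (du s)\<^sup>2" "0 \<le> (u s)\<^sup>2 * (Q s)\<^sup>2" by simp_all
    ultimately have "d\<^sup>2 \<le> (u s)\<^sup>2" using d by linarith
    then show ?thesis using u_pos[of s] s R assms by (intro power2_le_imp_le[of d "u s"]) auto
  qed
  have lin: "du R + d / 2 * (s - R) \<le> du s" if s: "R \<le> s" for s
  proof -
    have "du R - d / 2 * (R - R) \<le> du s - d / 2 * (s - R)"
    proof (rule DERIV_nonneg_imp_nondecreasing[OF s, of "\<lambda>x. du x - d / 2 * (x - R)"])
      fix x assume x: "R \<le> x" "x \<le> s"
      have x0: "0 < x" "T \<le> x" using x R T by auto
      have "((\<lambda>x. du x - d / 2 * (x - R)) has_real_derivative u x * (1 - (Q x)\<^sup>2) - d / 2) (at x)"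
        using x0 by (auto intro!: derivative_eq_intros du_deriv)
      moreover have "d * (1 / 2) \<le> u x * (1 - (Q x)\<^sup>2)"
        using ud[OF x(1)] T(3)[OF x0(2)] d by (intro mult_mono) auto
      ultimately show "\<exists>y. ((\<lambda>x. du x - d / 2 * (x - R)) has_real_derivative y) (at x) \<and> 0 \<le> y"
        by (intro exI[of _ "u x * (1 - (Q x)\<^sup>2) - d / 2"]) auto
    qed
    then show ?thesis by simp
  qed
  define s where "s = R + 2 * \<bar>du R\<bar> / d"
  have "R \<le> s" using d by (simp add: s_def)
  then have "du R + d / 2 * (s - R) \<le> du s" by (rule lin)
  moreover have "d / 2 * (s - R) = \<bar>du R\<bar>" using d by (simp add: s_def)
  ultimately show False using T(2)[of s] \<open>R \<le> s\<close> R by linarith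
qed

text \<open>The derivative of (u + u') exp(-t) is (u'' - u) exp(-t) = - u Q^2 exp(-t) < 0. Had this
  function ever been nonpositive, u' would later stay below a negative constant and u would become
  negative.\<close>

lemma u_plus_du_pos: assumes "0 < t" shows "0 < u t + du t"
proof (rule ccontr)
  assume neg: "\<not> 0 < u t + du t"
  let ?m = "\<lambda>t. (u t + du t) * exp (- t)"
  have dec: "?m s < ?m r" if rs: "t \<le> r" "r < s" for r s
  proof (rule DERIV_neg_imp_decreasing[OF rs(2)])
    fix x assume x: "r \<le> x" "x \<le> s"
    then have "0 < x" using rs assms by simp
    have "(?m has_real_derivative - (u x * (Q x)\<^sup>2) * exp (- x)) (at x)"
      using \<open>0 < x\<close> by (auto intro!: derivative_eq_intros u_deriv du_deriv simp: algebra_simps)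
    moreover have "- (u x * (Q x)\<^sup>2) * exp (- x) < 0"
      using \<open>0 < x\<close> u_pos[of x] Q_pos[of x] by simp
    ultimately show "\<exists>y. (?m has_real_derivative y) (at x) \<and> y < 0" by blast
  qed
  define e where "e = - ?m (t + 1)"
  have e: "0 < e"
  proof -
    have "?m t \<le> 0" using neg by (intro mult_nonpos_nonneg) auto
    then show ?thesis using dec[of t "t + 1"] by (simp add: e_def)
  qed
  have du: "du s \<le> - e" if s: "t + 1 \<le> s" for s
  proof -
    have "?m s \<le> - e" using dec[of "t + 1" s] s by (cases "s = t + 1") (auto simp: e_def)
    then have "u s + du s \<le> - e * exp s" by (simp add: exp_minus field_simps)
    moreover have "1 \<le> exp s" using s assms by simp
    then have "e * 1 \<le> e * exp s" using e by (intro mult_left_mono) auto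
    ultimately show ?thesis using u_pos[of s] s assms by simp
  qed
  have lin: "u s \<le> u (t + 1) - e * (s - (t + 1))" if s: "t + 1 \<le> s" for s
  proof -
    have "u s + e * (s - (t + 1)) \<le> u (t + 1) + e * ((t + 1) - (t + 1))"
    proof (rule DERIV_nonpos_imp_nonincreasing[OF s, of "\<lambda>x. u x + e * (x - (t + 1))"])
      fix x assume x: "t + 1 \<le> x" "x \<le> s"
      have "((\<lambda>x. u x + e * (x - (t + 1))) has_real_derivative du x + e) (at x)"
        using x assms by (auto intro!: derivative_eq_intros u_deriv)
      then show "\<exists>y. ((\<lambda>x. u x + e * (x - (t + 1))) has_real_derivative y) (at x) \<and> y \<le> 0"
        using du[OF x(1)] by (intro exI[of _ "du x + e"]) auto
    qed
    then show ?thesis by simp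
  qed
  define s where "s = t + 1 + u (t + 1) / e"
  have "t + 1 \<le> s" using u_pos[of "t + 1"] assms e by (simp add: s_def)
  moreover have "e * (s - (t + 1)) = u (t + 1)" using e by (simp add: s_def)
  ultimately show False using lin[of s] u_pos[of s] assms by linarith
qed

end

section \<open>Barriers near the origin\<close>

text \<open>The rate g/t is singular at 0, so two regimes are needed: near 0 the negative sign of g
  excludes D > 0, and from there on D / t^4 cannot rise where D > 0. The exponent is the upper bound
  4 of g.\<close>

lemma inner_barrier:
  fixes D D' g :: "real \<Rightarrow> real"
  assumes cont: "continuous_on {0..T} D" and D0: "D 0 \<le> 0"
    and der: "\<And>t. 0 < t \<Longrightarrow> t \<le> T \<Longrightarrow> (D has_real_derivative D' t) (at t)"
    and le: "\<And>t. 0 < t \<Longrightarrow> t \<le> T \<Longrightarrow> 0 < D t \<Longrightarrow> t * D' t \<le> g t * D t"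
    and g4: "\<And>t. 0 < t \<Longrightarrow> t \<le> T \<Longrightarrow> g t \<le> 4"
    and gcont: "continuous_on {0..T} g" and g0: "g 0 < 0"
    and t: "0 \<le> t" "t \<le> T"
  shows "D t \<le> 0"
proof (cases "t = 0")
  case False
  then have t0: "0 < t" using t by simp
  have "(g \<longlongrightarrow> g 0) (at 0 within {0..T})"
    using gcont t t0 by (auto simp: continuous_on_def)
  then have "eventually (\<lambda>x. g x < 0) (at 0 within {0..T})"
    using g0 by (rule order_tendstoD(2))
  then obtain d where d: "0 < d" "\<And>x. x \<in> {0..T} \<Longrightarrow> x \<noteq> 0 \<Longrightarrow> dist x 0 < d \<Longrightarrow> g x < 0"
    by (auto simp: eventually_at)
  define e where "e = min (d / 2) t"
  have e: "0 < e" "e \<le> t" "e < d" using d t0 by (auto simp: e_def min_def)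
  have De: "D e \<le> 0"
  proof (rule no_rise[of 0 e D 0 D'])
    show "continuous_on {0..e} D" by (rule continuous_on_subset[OF cont]) (use e t in auto)
    fix x assume x: "0 < x" "x \<le> e"
    show "(D has_real_derivative D' x) (at x)" using der[of x] x e t by auto
    assume Dx: "0 < D x"
    have "g x < 0" using d(2)[of x] x e t by auto
    then have "g x * D x < 0" using Dx by (rule mult_neg_pos)
    then have "x * D' x < 0" using le[of x] x e t Dx by auto
    then show "D' x \<le> 0" using x by (simp add: mult_less_0_iff)
  qed (use e D0 in auto)
  have "D t / t ^ 4 \<le> 0"
  proof (rule no_rise[of e t "\<lambda>x. D x / x ^ 4" 0 "\<lambda>x. (x * D' x - 4 * D x) / x ^ 5"])
    show "continuous_on {e..t} (\<lambda>x. D x / x ^ 4)"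
      using e t by (intro continuous_intros continuous_on_subset[OF cont]) auto
    show "D e / e ^ 4 \<le> 0" using De e by (simp add: divide_nonpos_pos)
    fix x assume x: "e < x" "x \<le> t"
    then show "((\<lambda>x. D x / x ^ 4) has_real_derivative (x * D' x - 4 * D x) / x ^ 5) (at x)"
      using e t by (auto intro!: derivative_eq_intros der simp: field_simps power_numeral_reduce)
    assume "0 < D x / x ^ 4"
    then have Dx: "0 < D x" using x e by (simp add: zero_less_divide_iff)
    have "g x * D x \<le> 4 * D x" using g4[of x] x e t Dx by (intro mult_right_mono) auto
    moreover have "x * D' x \<le> g x * D x" using le[of x] x e t Dx by auto
    ultimately have "x * D' x \<le> 4 * D x" by linarith
    then show "(x * D' x - 4 * D x) / x ^ 5 \<le> 0" using x e by (simp add: divide_nonpos_pos)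
  qed (use e in auto)
  then show ?thesis using t0 by (simp add: divide_le_0_iff)
qed (use D0 in simp)

text \<open>With \<open>a = rho t\<close> and \<open>c = t^2\<close>, the terms of low order are those of the Taylor expansion of
  \<open>(u t)^2\<close> at the origin; the others are fitted numerically.\<close>

definition beta_up :: "real \<Rightarrow> real \<Rightarrow> real" where
  "beta_up a c = c + 3 * a - 9/5 * a\<^sup>2 - 2/5 * a * c + 16/125 * a ^ 3 - 9/50 * a\<^sup>2 * c + 1/20 * a ^ 5"

definition beta_low :: "real \<Rightarrow> real \<Rightarrow> real" where
  "beta_low a c = c + 3 * a - 9/5 * a\<^sup>2 - 7/10 * a * c + 1/10 * a ^ 3"

lemma beta_up_deriv:
  assumes "(f has_real_derivative f') (at t)"
  shows "((\<lambda>t. beta_up (f t) (t\<^sup>2)) has_real_derivative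
    (3 - 18/5 * f t - 2/5 * t\<^sup>2 + 48/125 * (f t)\<^sup>2 - 9/25 * f t * t\<^sup>2 + 1/4 * f t ^ 4) * f'
    + (1 - 2/5 * f t - 9/50 * (f t)\<^sup>2) * (2 * t)) (at t)"
  unfolding beta_up_def by (rule DERIV_cong, (rule derivative_intros assms)+) (simp, algebra)

lemma beta_low_deriv:
  assumes "(f has_real_derivative f') (at t)"
  shows "((\<lambda>t. beta_low (f t) (t\<^sup>2)) has_real_derivative
    (3 - 18/5 * f t - 7/10 * t\<^sup>2 + 3/10 * (f t)\<^sup>2) * f' + (1 - 7/10 * f t) * (2 * t)) (at t)"
  unfolding beta_low_def by (rule DERIV_cong, (rule derivative_intros assms)+) (simp, algebra)

text \<open>On the graph b = beta_up the left side is t b' and the right side is the derivative t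
  d/dt of beta_up along t a' = a^2 - a + b - c, t c' = 2 c, so b cannot overtake. The difference is
  a times a quadratic form in (c, a), plus a^9 / 80. The form is nonnegative because 4 A2 A0 - A1^2
  has nonnegative Bernstein coefficients on [0, 1].\<close>

lemma beta_up_flow:
  fixes a c :: real
  assumes "0 \<le> a" "a \<le> 1"
  shows "beta_up a c * (2 - 2 * a) \<le>
    (3 - 18/5 * a - 2/5 * c + 48/125 * a\<^sup>2 - 9/25 * a * c + 1/4 * a ^ 4) * (a\<^sup>2 - a + beta_up a c - c)
    + 2 * c * (1 - 2/5 * a - 9/50 * a\<^sup>2)"
proof -
  define A2 where "A2 = 4/25 + 27/125 * a + 81/1250 * a\<^sup>2"
  define A1 where "A1 = - 3/10 + 232/625 * a - 72/625 * a\<^sup>2 - 3/25 * a ^ 3 - 63/1000 * a ^ 4"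
  define A0 where "A0 = 22/125 - 64/125 * a + 37447/62500 * a\<^sup>2 - 7/25 * a ^ 3 + 32/625 * a ^ 4"
  have "4 * A2 * A0 - A1\<^sup>2 = 283 / 12500 * (1 - a) ^ 8 + 3566 / 15625 * a * (1 - a) ^ 7 + 290409 / 390625 * a ^ 2 * (1 - a) ^ 6 + 2256054 / 1953125 * a ^ 3 * (1 - a) ^ 5 + 78984203 / 78125000 * a ^ 4 * (1 - a) ^ 4 + 12357803 / 19531250 * a ^ 5 * (1 - a) ^ 3 + 14632909 / 39062500 * a ^ 6 * (1 - a) ^ 2 + 5806781 / 39062500 * a ^ 7 * (1 - a) + 5650279 / 625000000 * a ^ 8"
    unfolding A2_def A1_def A0_def by algebra
  also have "\<dots> \<ge> 0" using assms by (intro add_nonneg_nonneg mult_nonneg_nonneg zero_le_power) auto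
  finally have disc: "0 \<le> 4 * A2 * A0 - A1\<^sup>2" .
  have A2: "0 < A2" using assms unfolding A2_def by (intro add_pos_nonneg mult_nonneg_nonneg) auto
  have "4 * A2 * (A2 * c\<^sup>2 + A1 * a * c + A0 * a\<^sup>2) = (2 * A2 * c + A1 * a)\<^sup>2 + (4 * A2 * A0 - A1\<^sup>2) * a\<^sup>2"
    by algebra
  also have "\<dots> \<ge> 0" using disc by simp
  finally have "0 \<le> A2 * c\<^sup>2 + A1 * a * c + A0 * a\<^sup>2" using A2 by (simp add: zero_le_mult_iff)
  with assms(1) have "0 \<le> a * (A2 * c\<^sup>2 + A1 * a * c + A0 * a\<^sup>2)" by (rule mult_nonneg_nonneg)
  then have "0 \<le> a * (A2 * c\<^sup>2 + A1 * a * c + A0 * a\<^sup>2) + 1/80 * a ^ 9"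
    using assms(1) by simp
  also have "a * (A2 * c\<^sup>2 + A1 * a * c + A0 * a\<^sup>2) + 1/80 * a ^ 9 =
    (3 - 18/5 * a - 2/5 * c + 48/125 * a\<^sup>2 - 9/25 * a * c + 1/4 * a ^ 4) * (a\<^sup>2 - a + beta_up a c - c)
    + 2 * c * (1 - 2/5 * a - 9/50 * a\<^sup>2) - beta_up a c * (2 - 2 * a)"
    unfolding beta_up_def A2_def A1_def A0_def by algebra
  finally show ?thesis by simp
qed

text \<open>The reverse comparison on the graph b = beta_low. Near a = 1 it relies on c <= 3 (1 -
  a), which fails as a reaches 1 with c > 0; this confines the lower barrier to times up to tp,
  where P >= 0.\<close>

lemma beta_low_flow:
  fixes a c :: real
  assumes "0 \<le> a" "a \<le> 1" "0 \<le> c" "c \<le> 7/8" "c \<le> 3 * (1 - a)"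
  shows "(3 - 18/5 * a - 7/10 * c + 3/10 * a\<^sup>2) * (a\<^sup>2 - a + beta_low a c - c)
    + 2 * c * (1 - 7/10 * a) \<le> beta_low a c * (2 - 2 * a)"
proof -
  have "- 3/2 + 49/100 * c + 42/25 * a - 7/25 * a\<^sup>2 \<le> 0"
  proof (cases "a \<le> 7/10")
    case True
    have "0 \<le> (a - 7/10)\<^sup>2" by simp
    then show ?thesis using True assms by (simp add: power2_eq_square algebra_simps)
  next
    case False
    then have "7/10 * a \<le> a * a" using assms by (intro mult_right_mono) auto
    then show ?thesis using assms by (simp add: power2_eq_square)
  qed
  then have 1: "c * (- 3/2 + 49/100 * c + 42/25 * a - 7/25 * a\<^sup>2) \<le> 0"
    using assms by (simp add: mult_nonneg_nonpos)
  have "a\<^sup>2 \<le> a * 1" using assms unfolding power2_eq_square by (intro mult_left_mono) auto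
  then have 2: "a\<^sup>2 * (- 1/50 - 2/5 * a + 3/100 * a\<^sup>2) \<le> 0"
    using assms by (intro mult_nonneg_nonpos) simp_all
  have "a * (c * (- 3/2 + 49/100 * c + 42/25 * a - 7/25 * a\<^sup>2) + a\<^sup>2 * (- 1/50 - 2/5 * a + 3/100 * a\<^sup>2)) \<le> 0"
    by (rule mult_nonneg_nonpos[OF assms(1) add_nonpos_nonpos[OF 1 2]])
  also have "a * (c * (- 3/2 + 49/100 * c + 42/25 * a - 7/25 * a\<^sup>2) + a\<^sup>2 * (- 1/50 - 2/5 * a + 3/100 * a\<^sup>2))
    = (3 - 18/5 * a - 7/10 * c + 3/10 * a\<^sup>2) * (a\<^sup>2 - a + beta_low a c - c)
    + 2 * c * (1 - 7/10 * a) - beta_low a c * (2 - 2 * a)"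
    unfolding beta_low_def by algebra
  finally show ?thesis by simp
qed

section \<open>The system for rho, u^2 and t^2 up to the first maximum of u\<close>

context ground_state begin

text \<open>Normalised so that u' = u (1 - rho) / t: the value 1 marks the critical points of
  u.\<close>

definition rho where "rho t = - (t * dQ t / Q t)"

lemma rho_0: "rho 0 = 0" and u_0: "u 0 = 0" and du_0: "du 0 = Q 0"
  by (simp_all add: rho_def u_def du_def)

lemma rho_cont: "continuous_on {0..} rho"
  unfolding rho_def[abs_def] using Q_pos by (intro continuous_intros Q_cont dQ_cont) force

lemma u_cont: "continuous_on {0..} u"
  unfolding u_def[abs_def] by (intro continuous_intros Q_cont)

lemma rho_pos: "0 < t \<Longrightarrow> 0 < rho t"
  using dQ_neg[of t] Q_pos[of t] by (simp add: rho_def mult_pos_neg divide_neg_pos)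

lemma du_eq: "0 < t \<Longrightarrow> du t = u t * (1 - rho t) / t"
  using Q_pos[of t] by (simp add: du_def u_def rho_def field_simps)

lemma rho_deriv:
  assumes "0 < t"
  shows "(rho has_real_derivative ((rho t)\<^sup>2 - rho t + (u t)\<^sup>2 - t\<^sup>2) / t) (at t)"
proof -
  have "(rho has_real_derivative
      - (((1 * dQ t + t * (Q t - Q t ^ 3 - 2 * dQ t / t)) * Q t - t * dQ t * dQ t) / (Q t * Q t))) (at t)"
    unfolding rho_def[abs_def] using assms Q_pos[of t]
    by (auto intro!: derivative_eq_intros Q_deriv dQ_deriv)
  moreover have "- (((1 * dQ t + t * (Q t - Q t ^ 3 - 2 * dQ t / t)) * Q t - t * dQ t * dQ t) / (Q t * Q t))
      = ((rho t)\<^sup>2 - rho t + (u t)\<^sup>2 - t\<^sup>2) / t"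
    using assms Q_pos[of t]
    by (simp add: rho_def u_def field_simps power2_eq_square power3_eq_cube)
  ultimately show ?thesis by simp
qed

lemma u2_deriv:
  assumes "0 < t"
  shows "((\<lambda>t. (u t)\<^sup>2) has_real_derivative 2 * (u t)\<^sup>2 * (1 - rho t) / t) (at t)"
  using assms by (auto intro!: derivative_eq_intros u_deriv simp: du_eq power2_eq_square)

lemma first_max:
  obtains t1 where "0 < t1" "du t1 = 0" "\<And>t. 0 \<le> t \<Longrightarrow> t < t1 \<Longrightarrow> 0 < du t"
proof -
  obtain T where T: "0 < T" "\<And>t. T \<le> t \<Longrightarrow> du t < 0" using du_eventually_neg by metis
  have "continuous_on {0..T} du" by (rule continuous_on_subset[OF du_cont]) auto
  then obtain z where "0 < z" "z \<le> T" "du z = 0" "\<And>x. 0 \<le> x \<Longrightarrow> x < z \<Longrightarrow> 0 < du x"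
    using first_zero[of 0 T du] T(1) T(2)[of T] Q_pos[of 0] du_0 by (auto simp: less_imp_le)
  then show thesis using that by blast
qed

definition tmax where
  "tmax = (SOME s. 0 < s \<and> du s = 0 \<and> (\<forall>t. 0 \<le> t \<and> t < s \<longrightarrow> 0 < du t))"

lemma tmax: "0 < tmax" "du tmax = 0" "\<And>t. 0 \<le> t \<Longrightarrow> t < tmax \<Longrightarrow> 0 < du t"
proof -
  have "\<exists>s. 0 < s \<and> du s = 0 \<and> (\<forall>t. 0 \<le> t \<and> t < s \<longrightarrow> 0 < du t)"
    using first_max by metis
  from someI_ex[OF this]
  show "0 < tmax" "du tmax = 0" "\<And>t. 0 \<le> t \<Longrightarrow> t < tmax \<Longrightarrow> 0 < du t"
    by (auto simp: tmax_def)
qed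

text \<open>At \<open>tmax\<close> the term u'^2 in \<open>K_energy_pos\<close> vanishes, which
  leaves Q^2 > 2; earlier values of Q are larger.\<close>

lemma Q2_gt: assumes "0 < t" "t \<le> tmax" shows "2 < (Q t)\<^sup>2"
proof -
  have "0 < (u tmax)\<^sup>2 * ((Q tmax)\<^sup>2 - 2)" using K_energy_pos[of tmax] tmax by (simp add: algebra_simps)
  then have "2 < (Q tmax)\<^sup>2" by (simp add: zero_less_mult_iff)
  also have "(Q tmax)\<^sup>2 \<le> (Q t)\<^sup>2"
    using Q_strict_dec[of t tmax] Q_pos[of tmax] assms tmax by (cases "t = tmax") (auto intro!: power_mono)
  finally show ?thesis .
qed

lemma b_gt: assumes "0 < t" "t \<le> tmax" shows "2 * t\<^sup>2 < (u t)\<^sup>2"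
proof -
  have "t\<^sup>2 * 2 < t\<^sup>2 * (Q t)\<^sup>2" using Q2_gt[OF assms] assms by (intro mult_strict_left_mono) auto
  then show ?thesis by (simp add: u_def power_mult_distrib)
qed

lemma rho_tmax: "rho tmax = 1"
  using du_eq[of tmax] tmax u_pos[of tmax] by simp

lemma rho_le_1: assumes "0 < t" "t \<le> tmax" shows "rho t \<le> 1"
proof (cases "t = tmax")
  case False
  then have "0 < u t * (1 - rho t) / t" using tmax(3)[of t] assms du_eq[of t] by simp
  then show ?thesis using u_pos[of t] assms by (simp add: zero_less_divide_iff zero_less_mult_iff)
qed (simp add: rho_tmax)

text \<open>The function t^2 / 3 solves t a' = c - a, and b > 2 c makes t rho' exceed c -
  rho.\<close>

lemma c_le_rho: assumes "0 < t" "t \<le> tmax" shows "t\<^sup>2 \<le> 3 * rho t"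
proof -
  have "t\<^sup>2 / 3 - rho t \<le> 0"
  proof (rule no_rise[of 0 t "\<lambda>t. t\<^sup>2 / 3 - rho t" 0 "\<lambda>t. 2 * t / 3 - ((rho t)\<^sup>2 - rho t + (u t)\<^sup>2 - t\<^sup>2) / t"])
    show "continuous_on {0..t} (\<lambda>t. t\<^sup>2 / 3 - rho t)"
      by (intro continuous_intros continuous_on_subset[OF rho_cont]) auto
    fix x assume x: "0 < x" "x \<le> t"
    then show "((\<lambda>t. t\<^sup>2 / 3 - rho t) has_real_derivative
        2 * x / 3 - ((rho x)\<^sup>2 - rho x + (u x)\<^sup>2 - x\<^sup>2) / x) (at x)"
      by (auto intro!: derivative_eq_intros rho_deriv)
    assume "0 < x\<^sup>2 / 3 - rho x"
    moreover have "2 * x\<^sup>2 < (u x)\<^sup>2" using b_gt[of x] x assms by simp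
    moreover have "0 \<le> (rho x)\<^sup>2" by simp
    ultimately have "2 * x\<^sup>2 / 3 \<le> (rho x)\<^sup>2 - rho x + (u x)\<^sup>2 - x\<^sup>2" by linarith
    then show "2 * x / 3 - ((rho x)\<^sup>2 - rho x + (u x)\<^sup>2 - x\<^sup>2) / x \<le> 0"
      using x by (simp add: field_simps power2_eq_square)
  qed (use assms in \<open>auto simp: rho_0\<close>)
  then show ?thesis by simp
qed

lemma c_le_3: assumes "0 < t" "t \<le> tmax" shows "t\<^sup>2 \<le> 3"
  using c_le_rho[OF assms] rho_le_1[OF assms] by simp

lemma b_le_beta_up: assumes "0 < t" "t \<le> tmax" shows "(u t)\<^sup>2 \<le> beta_up (rho t) (t\<^sup>2)"
proof -
  let ?a = rho and ?b = "\<lambda>t. (u t)\<^sup>2" and ?c = "\<lambda>t::real. t\<^sup>2"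
  let ?D = "\<lambda>t. ?b t - beta_up (?a t) (?c t)"
  let ?\<beta>a = "\<lambda>t. 3 - 18/5 * ?a t - 2/5 * ?c t + 48/125 * (?a t)\<^sup>2 - 9/25 * ?a t * ?c t + 1/4 * ?a t ^ 4"
  let ?\<beta>c = "\<lambda>t. 1 - 2/5 * ?a t - 9/50 * (?a t)\<^sup>2"
  let ?D' = "\<lambda>t. 2 * ?b t * (1 - ?a t) / t - (?\<beta>a t * (((?a t)\<^sup>2 - ?a t + ?b t - ?c t) / t) + ?\<beta>c t * (2 * t))"
  let ?g = "\<lambda>t. 2 - 2 * ?a t - ?\<beta>a t"
  have cont: "continuous_on {0..tmax} rho" "continuous_on {0..tmax} u"
    by (auto intro!: continuous_on_subset[OF rho_cont] continuous_on_subset[OF u_cont])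
  have "?D t \<le> 0"
  proof (rule inner_barrier[of tmax ?D ?D' ?g t])
    show "continuous_on {0..tmax} ?D" unfolding beta_up_def by (intro continuous_intros cont)
    show "continuous_on {0..tmax} ?g" by (intro continuous_intros cont)
    show "?D 0 \<le> 0" by (simp add: beta_up_def rho_0 u_0)
    show "?g 0 < 0" by (simp add: rho_0)
    fix x assume x: "0 < x" "x \<le> tmax"
    show "(?D has_real_derivative ?D' x) (at x)"
      using x by (intro DERIV_diff u2_deriv beta_up_deriv rho_deriv)
    have a: "0 \<le> rho x" "rho x \<le> 1" and c: "?c x \<le> 3"
      using rho_pos[of x] rho_le_1[of x] c_le_3[of x] x by auto
    have "rho x * ?c x \<le> 1 * 3" using a c by (intro mult_mono) auto
    then have "9/25 * rho x * ?c x \<le> 27/25" by simp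
    moreover have "0 \<le> (rho x)\<^sup>2" "0 \<le> rho x ^ 4" by simp_all
    ultimately show "?g x \<le> 4" using a c by linarith
    have "x * ?D' x = ?g x * ?D x - (?\<beta>a x * ((?a x)\<^sup>2 - ?a x + beta_up (?a x) (?c x) - ?c x)
        + 2 * ?c x * ?\<beta>c x - beta_up (?a x) (?c x) * (2 - 2 * ?a x))"
      using x by (simp add: field_simps power2_eq_square)
    then show "x * ?D' x \<le> ?g x * ?D x" using beta_up_flow[OF a, of "?c x"] by linarith
  qed (use assms in auto)
  then show ?thesis by simp
qed

text \<open>At rho = 1 the upper barrier reads b <= 689/500 + 21/50 c, which is compared with b > 2
  c.\<close>

lemma c_tmax: "tmax\<^sup>2 < 7/8"
proof -
  have "(u tmax)\<^sup>2 \<le> 689/500 + 21/50 * tmax\<^sup>2"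
    using b_le_beta_up[of tmax] tmax by (simp add: rho_tmax beta_up_def)
  then show ?thesis using b_gt[of tmax] tmax by simp
qed

lemma c_lt: assumes "0 < t" "t \<le> tmax" shows "t\<^sup>2 < 7/8"
proof -
  have "t\<^sup>2 \<le> tmax\<^sup>2" using assms by (intro power_mono) auto
  then show ?thesis using c_tmax by simp
qed

end

section \<open>A supersolution near the origin\<close>

context ground_state begin

text \<open>The product \<^term>\<open>u t * P t\<close> is a strict supersolution of the linear equation as long as it is
  positive. In the scaling limit of large \<^term>\<open>Q 0\<close> the linear equation is solved by
  \<^term>\<open>t * du t = u t * (1 - rho t)\<close>; the other terms of P account for the mass term.\<close>

definition P where "P t = 1 - rho t - t\<^sup>2 / 2 + 3/100 * t\<^sup>2 * (u t)\<^sup>2 + t ^ 4 / 30"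

lemma P_0: "P 0 = 1"
  by (simp add: P_def rho_0)

lemma P_cont: "continuous_on {0..} P"
  unfolding P_def[abs_def] by (intro continuous_intros rho_cont u_cont) auto

lemma P_tmax: "P tmax < 0"
proof -
  have "(u tmax)\<^sup>2 < 2"
    using b_le_beta_up[of tmax] c_tmax tmax by (simp add: rho_tmax beta_up_def)
  moreover have "t ^ 4 = t\<^sup>2 * t\<^sup>2" for t :: real by algebra
  then have "P tmax = tmax\<^sup>2 * (- 1/2 + 3/100 * (u tmax)\<^sup>2 + tmax\<^sup>2 / 30)"
    by (simp add: P_def rho_tmax algebra_simps)
  moreover have "0 < tmax\<^sup>2" using tmax by simp
  ultimately show ?thesis using c_tmax by (simp add: mult_pos_neg)
qed

definition tp where
  "tp = (SOME s. 0 < s \<and> s < tmax \<and> P s = 0 \<and> (\<forall>t. 0 \<le> t \<and> t < s \<longrightarrow> 0 < P t))"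

lemma tp: "0 < tp" "tp < tmax" "P tp = 0" "\<And>t. 0 \<le> t \<Longrightarrow> t < tp \<Longrightarrow> 0 < P t"
proof -
  have c: "continuous_on {0..tmax} P" by (rule continuous_on_subset[OF P_cont]) auto
  have "\<exists>s. 0 < s \<and> s < tmax \<and> P s = 0 \<and> (\<forall>t. 0 \<le> t \<and> t < s \<longrightarrow> 0 < P t)"
  proof (rule first_zero[OF _ c])
    fix z assume z: "0 < z" "z \<le> tmax" "P z = 0" "\<And>x. 0 \<le> x \<Longrightarrow> x < z \<Longrightarrow> 0 < P x"
    then have "z \<noteq> tmax" using P_tmax by auto
    then show ?thesis using z by (intro exI[of _ z]) auto
  qed (use tmax P_0 P_tmax in auto)
  from someI_ex[OF this]
  show "0 < tp" "tp < tmax" "P tp = 0" "\<And>t. 0 \<le> t \<Longrightarrow> t < tp \<Longrightarrow> 0 < P t"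
    by (auto simp: tp_def)
qed

lemma P_nonneg: "0 \<le> t \<Longrightarrow> t \<le> tp \<Longrightarrow> 0 \<le> P t"
  using tp(3,4) by (cases "t = tp") (auto simp: less_imp_le)

lemma b_ge_beta_low: assumes "0 < t" "t \<le> tp" shows "beta_low (rho t) (t\<^sup>2) \<le> (u t)\<^sup>2"
proof -
  let ?a = rho and ?b = "\<lambda>t. (u t)\<^sup>2" and ?c = "\<lambda>t::real. t\<^sup>2"
  let ?D = "\<lambda>t. beta_low (?a t) (?c t) - ?b t"
  let ?\<beta>a = "\<lambda>t. 3 - 18/5 * ?a t - 7/10 * ?c t + 3/10 * (?a t)\<^sup>2"
  let ?\<beta>c = "\<lambda>t. 1 - 7/10 * ?a t"
  let ?D' = "\<lambda>t. (?\<beta>a t * (((?a t)\<^sup>2 - ?a t + ?b t - ?c t) / t) + ?\<beta>c t * (2 * t)) - 2 * ?b t * (1 - ?a t) / t"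
  let ?g = "\<lambda>t. 2 - 2 * ?a t - ?\<beta>a t"
  have cont: "continuous_on {0..tp} rho" "continuous_on {0..tp} u"
    by (auto intro!: continuous_on_subset[OF rho_cont] continuous_on_subset[OF u_cont])
  have "?D t \<le> 0"
  proof (rule inner_barrier[of tp ?D ?D' ?g t])
    show "continuous_on {0..tp} ?D" unfolding beta_low_def by (intro continuous_intros cont)
    show "continuous_on {0..tp} ?g" by (intro continuous_intros cont)
    show "?D 0 \<le> 0" by (simp add: beta_low_def rho_0 u_0)
    show "?g 0 < 0" by (simp add: rho_0)
    fix x assume x: "0 < x" "x \<le> tp"
    then have xm: "x \<le> tmax" using tp by simp
    show "(?D has_real_derivative ?D' x) (at x)"
      using x by (intro DERIV_diff u2_deriv beta_low_deriv rho_deriv)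
    have a: "0 \<le> rho x" "rho x \<le> 1" and c: "?c x \<le> 7/8" "0 \<le> ?c x"
      using rho_pos[of x] rho_le_1[of x] c_lt[of x] x xm by auto
    have a2: "0 \<le> (rho x)\<^sup>2" "(rho x)\<^sup>2 \<le> rho x" using a by (auto simp: power2_eq_square mult_left_le)
    then show "?g x \<le> 4" using a c by linarith
    assume D: "0 < ?D x"
    have "beta_low (?a x) (?c x) \<le> 3"
    proof -
      have "0 \<le> rho x * ?c x" using a c by simp
      moreover have "rho x ^ 3 \<le> 1" using a by (simp add: power_le_one)
      moreover have "0 \<le> (rho x - 5/6)\<^sup>2" by simp
      then have "3 * rho x - 9/5 * (rho x)\<^sup>2 \<le> 5/4" by (simp add: power2_eq_square algebra_simps)
      ultimately show ?thesis unfolding beta_low_def using c by linarith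
    qed
    \<comment> \<open>The supposed violation of the barrier itself bounds b from above. With P >= 0
      this supplies the hypothesis c <= 3 (1 - a) of \<open>beta_low_flow\<close>.\<close>
    then have b: "?b x < 3" using D by simp
    have "?c x * (1/3) \<le> ?c x * (1/2 - 3/100 * ?b x - ?c x / 30)" using b c by (intro mult_left_mono) auto
    also have "\<dots> = 1 - rho x - P x" by (simp add: P_def algebra_simps power2_eq_square power4_eq_xxxx)
    also have "\<dots> \<le> 1 - rho x" using P_nonneg[of x] x by simp
    finally have "?c x \<le> 3 * (1 - rho x)" by simp
    note flow = beta_low_flow[OF a c(2) c(1) this]
    have "x * ?D' x = ?g x * ?D x + (?\<beta>a x * ((?a x)\<^sup>2 - ?a x + beta_low (?a x) (?c x) - ?c x)
        + 2 * ?c x * ?\<beta>c x - beta_low (?a x) (?c x) * (2 - 2 * ?a x))"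
      using x by (simp add: field_simps power2_eq_square)
    then show "x * ?D' x \<le> ?g x * ?D x" using flow by linarith
  qed (use assms in auto)
  then show ?thesis by simp
qed

text \<open>The left side is the defect M in (u P)'' = - 3 Q^2 u P + u M. It is affine in b with
  slope -f < 0, so inserting the lower barrier for b leaves a polynomial in a and c.\<close>

lemma P_margin:
  assumes "0 < t" "t \<le> tp"
  defines "a \<equiv> rho t" and "b \<equiv> (u t)\<^sup>2" and "c \<equiv> t\<^sup>2"
  shows "a - c / 2 - b + 3/100 * b * (20 - 24 * a + 6 * a\<^sup>2 + 3 * c) + c / 30 * (20 - 8 * a + c + 2 * b) < 0"
proof -
  have tm: "t \<le> tmax" using assms tp by simp
  have a: "0 < a" "a \<le> 1" and c: "0 < c" "c \<le> 7/8"
    using rho_pos[of t] rho_le_1[of t] c_lt[of t] assms tm by (auto simp: a_def c_def)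
  have b: "beta_low a c \<le> b" using b_ge_beta_low[of t] assms by (simp add: a_def b_def c_def)
  define f where "f = 2/5 + 18/25 * a - 9/50 * a\<^sup>2 - 47/300 * c"
  have a2: "0 \<le> a\<^sup>2" "a\<^sup>2 \<le> a" "a ^ 3 \<le> a\<^sup>2" "0 \<le> a ^ 3" "a ^ 4 \<le> a ^ 3" "0 \<le> a ^ 4" "a ^ 4 \<le> 1"
    using a by (auto simp: power_numeral_reduce mult_left_le mult_le_one)
  have f: "0 < f" using a c a2 unfolding f_def by linarith
  have "f * beta_low a c \<le> f * b" using b f by (intro mult_left_mono) auto
  moreover have "a - c / 2 - b + 3/100 * b * (20 - 24 * a + 6 * a\<^sup>2 + 3 * c) + c / 30 * (20 - 8 * a + c + 2 * b)
    = - (f * b) + c * (1/6 - 4/15 * a + c / 30) + a"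
    unfolding f_def by algebra
  moreover have "f * beta_low a c - c * (1/6 - 4/15 * a + c / 30) - a
    = a * (1/5 + 36/25 * a - 449/250 * a\<^sup>2 + 99/250 * a ^ 3 - 9/500 * a ^ 4)
      + c * ((7/30 + 71/300 * a - 201/500 * a\<^sup>2 + 331/3000 * a ^ 3) - c * (19/100 - 329/3000 * a))"
    unfolding f_def beta_low_def by algebra
  moreover have "0 < a * (1/5 + 36/25 * a - 449/250 * a\<^sup>2 + 99/250 * a ^ 3 - 9/500 * a ^ 4)"
  proof (rule mult_pos_pos[OF a(1)])
    have "1/5 + 36/25 * a - 449/250 * a\<^sup>2 + 99/250 * a ^ 3
      = 1/5 * (1 - a) ^ 3 + 51/25 * a * (1 - a)\<^sup>2 + 421/250 * a\<^sup>2 * (1 - a) + 6/25 * a ^ 3" by algebra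
    moreover have "0 \<le> 51/25 * a * (1 - a)\<^sup>2" "0 \<le> 421/250 * a\<^sup>2 * (1 - a)" using a by auto
    moreover have "9/500 < 1/5 * (1 - a) ^ 3 + 6/25 * a ^ 3"
    proof (cases "a \<le> 1/2")
      case True
      have "(1/2) ^ 3 \<le> (1 - a) ^ 3" using True by (intro power_mono) auto
      then show ?thesis using a2 by (simp add: power3_eq_cube)
    next
      case False
      have "(1/2) ^ 3 \<le> a ^ 3" using False by (intro power_mono) auto
      moreover have "0 \<le> (1 - a) ^ 3" using a by simp
      ultimately show ?thesis by (simp add: power3_eq_cube)
    qed
    ultimately show "0 < 1/5 + 36/25 * a - 449/250 * a\<^sup>2 + 99/250 * a ^ 3 - 9/500 * a ^ 4" using a2 by linarith
  qed
  moreover have "0 \<le> c * ((7/30 + 71/300 * a - 201/500 * a\<^sup>2 + 331/3000 * a ^ 3) - c * (19/100 - 329/3000 * a))"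
  proof (rule mult_nonneg_nonneg)
    have "c * (19/100 - 329/3000 * a) \<le> 7/8 * (19/100 - 329/3000 * a)" using c a by (intro mult_right_mono) auto
    also have "\<dots> \<le> 7/30 + 71/300 * a - 201/500 * a\<^sup>2 + 331/3000 * a ^ 3"
    proof -
      have "0 \<le> a * (a - 1)\<^sup>2" using a by simp
      then have "2 * a\<^sup>2 - a \<le> a ^ 3" by (simp add: power2_eq_square power3_eq_cube algebra_simps)
      moreover have "a\<^sup>2 \<le> a" by (rule a2)
      ultimately show ?thesis using a by (simp add: field_simps)
    qed
    finally show "0 \<le> (7/30 + 71/300 * a - 201/500 * a\<^sup>2 + 331/3000 * a ^ 3) - c * (19/100 - 329/3000 * a)" by simp
  qed (use c in simp)
  ultimately show ?thesis by linarith
qed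

section \<open>Sturm comparison on (0, tp)\<close>

text \<open>The product u P cleared of \<open>rho\<close>, so that the equations for u and du
  suffice to differentiate it. Its leading term t u' generates the dilations, a symmetry of u'' = -
  u^3 / t^2. The mass term spoils it: (t u')'' = - 3 Q^2 t u' + 2 u + t u', a defect of the wrong
  sign which the other terms overturn.\<close>

definition p where "p t = t * du t - 1/2 * t\<^sup>2 * u t + 3/100 * t\<^sup>2 * u t ^ 3 + 1/30 * t ^ 4 * u t"

lemma p_eq: "0 < t \<Longrightarrow> p t = u t * P t"
  by (simp add: p_def P_def du_eq field_simps power3_eq_cube power2_eq_square)

definition dp where "dp t = du t + t * (u t * (1 - (Q t)\<^sup>2)) - t * u t - 1/2 * t\<^sup>2 * du t
  + 3/50 * t * u t ^ 3 + 9/100 * t\<^sup>2 * (u t)\<^sup>2 * du t + 2/15 * t ^ 3 * u t + 1/30 * t ^ 4 * du t"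

lemma p_deriv: assumes "0 < t" shows "(p has_real_derivative dp t) (at t)"
  unfolding p_def[abs_def] dp_def
  by (rule DERIV_cong, (rule derivative_intros u_deriv[OF assms] du_deriv[OF assms])+) (simp_all, algebra)

lemma dp_deriv:
  assumes "0 < t"
  shows "(dp has_real_derivative
    u t * (P t * (- 3 * (Q t)\<^sup>2)) + u t * (rho t - t\<^sup>2 / 2 - (u t)\<^sup>2
      + 3/100 * (u t)\<^sup>2 * (20 - 24 * rho t + 6 * (rho t)\<^sup>2 + 3 * t\<^sup>2)
      + t\<^sup>2 / 30 * (20 - 8 * rho t + t\<^sup>2 + 2 * (u t)\<^sup>2))) (at t)"
proof -
  have "(dp has_real_derivative
     u t * (1 - (Q t)\<^sup>2) + (u t * (1 - (Q t)\<^sup>2) + t * (du t * (1 - (Q t)\<^sup>2) - u t * (2 * Q t * dQ t)))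
     - (u t + t * du t) - (t * du t + t\<^sup>2 * (u t * (1 - (Q t)\<^sup>2)) / 2)
     + 3/50 * (u t ^ 3 + 3 * t * (u t)\<^sup>2 * du t)
     + 9/100 * (2 * t * (u t)\<^sup>2 * du t + 2 * t\<^sup>2 * u t * (du t)\<^sup>2 + t\<^sup>2 * (u t)\<^sup>2 * (u t * (1 - (Q t)\<^sup>2)))
     + 2/15 * (3 * t\<^sup>2 * u t + t ^ 3 * du t) + (4 * t ^ 3 * du t + t ^ 4 * (u t * (1 - (Q t)\<^sup>2))) / 30) (at t)"
    unfolding dp_def[abs_def]
    by (rule DERIV_cong, (rule derivative_intros u_deriv[OF assms] du_deriv[OF assms] Q_deriv[OF assms])+) (simp_all, algebra)
  moreover have "u t = t * Q t" "du t = Q t * (1 - rho t)" "t * dQ t = - (Q t * rho t)"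
    using assms Q_pos[of t] by (auto simp: u_def du_def rho_def field_simps)
  then have "u t * (1 - (Q t)\<^sup>2) + (u t * (1 - (Q t)\<^sup>2) + t * (du t * (1 - (Q t)\<^sup>2) - u t * (2 * Q t * dQ t)))
     - (u t + t * du t) - (t * du t + t\<^sup>2 * (u t * (1 - (Q t)\<^sup>2)) / 2)
     + 3/50 * (u t ^ 3 + 3 * t * (u t)\<^sup>2 * du t)
     + 9/100 * (2 * t * (u t)\<^sup>2 * du t + 2 * t\<^sup>2 * u t * (du t)\<^sup>2 + t\<^sup>2 * (u t)\<^sup>2 * (u t * (1 - (Q t)\<^sup>2)))
     + 2/15 * (3 * t\<^sup>2 * u t + t ^ 3 * du t) + (4 * t ^ 3 * du t + t ^ 4 * (u t * (1 - (Q t)\<^sup>2))) / 30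
   = u t * (P t * (- 3 * (Q t)\<^sup>2)) + u t * (rho t - t\<^sup>2 / 2 - (u t)\<^sup>2
      + 3/100 * (u t)\<^sup>2 * (20 - 24 * rho t + 6 * (rho t)\<^sup>2 + 3 * t\<^sup>2)
      + t\<^sup>2 / 30 * (20 - 8 * rho t + t\<^sup>2 + 2 * (u t)\<^sup>2))"
    unfolding P_def by algebra
  ultimately show ?thesis by simp
qed

lemma p_cont: "continuous_on {0..} p" and dp_cont: "continuous_on {0..} dp"
  unfolding p_def[abs_def] dp_def[abs_def] by (intro continuous_intros u_cont du_cont Q_cont)+

text \<open>The Wronskian F' p - F p' starts at 0 and has derivative - F u M < 0 where F < 0. If s <
  tp, its value F'(s) p(s) at s gives F'(s) < 0, although F reaches 0 from below.\<close>

lemma tp_le_first_zero: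
  assumes ode: "solves_lin_ode Q F dF" and F0: "F 0 = 0" "dF 0 = - 1"
    and s: "0 < s" "F s = 0" "\<And>t. 0 < t \<Longrightarrow> t < s \<Longrightarrow> F t \<noteq> 0"
  shows "tp \<le> s"
proof (rule ccontr)
  assume "\<not> tp \<le> s"
  then have stp: "s < tp" by simp
  have cF: "continuous_on {0..} F" "continuous_on {0..} dF"
    and dF: "\<And>t. 0 < t \<Longrightarrow> (F has_real_derivative dF t) (at t)"
    and ddF: "\<And>t. 0 < t \<Longrightarrow> (dF has_real_derivative - 3 * (Q t)\<^sup>2 * F t) (at t)"
    using ode by (auto simp: solves_lin_ode_def)
  have "(dF \<longlongrightarrow> dF 0) (at 0 within {0..})" using cF(2) by (auto simp: continuous_on_def)
  then have "eventually (\<lambda>x. dF x < 0) (at 0 within {0..})" using F0(2) by (intro order_tendstoD(2)) auto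
  then obtain d where d: "0 < d" "\<And>x. 0 \<le> x \<Longrightarrow> x \<noteq> 0 \<Longrightarrow> dist x 0 < d \<Longrightarrow> dF x < 0"
    by (auto simp: eventually_at)
  have near: "F x < 0" if x: "0 < x" "x < d" for x
  proof -
    have "F x < F 0"
    proof (rule DERIV_neg_imp_decreasing_open[OF x(1)])
      show "\<exists>y. (F has_real_derivative y) (at r) \<and> y < 0" if "0 < r" "r < x" for r
        using dF[of r] d(2)[of r] that x by auto
      show "continuous_on {0..x} F" by (rule continuous_on_subset[OF cF(1)]) auto
    qed
    then show ?thesis using F0 by simp
  qed
  have neg: "F x < 0" if x: "0 < x" "x < s" for x
  proof (rule ccontr)
    assume "\<not> F x < 0"
    then have Fx: "0 < F x" using s(3)[OF x] by simp
    define e where "e = min (d / 2) x"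
    have e: "0 < e" "e \<le> x" "e < d" using d(1) x by (auto simp: e_def min_def)
    have "continuous_on {e..x} F" by (rule continuous_on_subset[OF cF(1)]) (use e in auto)
    then obtain r where "e \<le> r" "r \<le> x" "F r = 0"
      using IVT'[of F e 0 x] near[of e] e Fx by auto
    then show False using s(3)[of r] e x by auto
  qed
  let ?W = "\<lambda>t. dF t * p t - F t * dp t"
  have "?W s < ?W 0"
  proof (rule DERIV_neg_imp_decreasing_open[OF s(1)])
    fix x assume x: "0 < x" "x < s"
    define M where "M = rho x - x\<^sup>2 / 2 - (u x)\<^sup>2
      + 3/100 * (u x)\<^sup>2 * (20 - 24 * rho x + 6 * (rho x)\<^sup>2 + 3 * x\<^sup>2)
      + x\<^sup>2 / 30 * (20 - 8 * rho x + x\<^sup>2 + 2 * (u x)\<^sup>2)"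
    note pu = p_eq[OF x(1)]
    have "(?W has_real_derivative - (F x * (u x * M))) (at x)"
      by (rule DERIV_cong, (rule derivative_intros dF[OF x(1)] ddF[OF x(1)] p_deriv[OF x(1)] dp_deriv[OF x(1)])+)
        (simp add: M_def pu algebra_simps)
    moreover have "M < 0" using P_margin[of x] x stp by (simp add: M_def)
    then have "0 < F x * (u x * M)" using neg[OF x] u_pos[of x] x by (intro mult_neg_neg mult_pos_neg)
    ultimately show "\<exists>y. (?W has_real_derivative y) (at x) \<and> y < 0" by force
  next
    show "continuous_on {0..s} ?W"
      by (intro continuous_intros continuous_on_subset[OF cF(1)] continuous_on_subset[OF cF(2)]
          continuous_on_subset[OF p_cont] continuous_on_subset[OF dp_cont]) auto
  qed
  then have "dF s * p s < 0" using F0 s by (simp add: p_def)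
  moreover have "0 < p s" using s tp(4)[of s] stp u_pos[of s] by (simp add: p_eq)
  ultimately have "dF s < 0" by (simp add: mult_less_0_iff)
  then obtain e where e: "0 < e" "\<And>h. 0 < h \<Longrightarrow> h < e \<Longrightarrow> F s < F (s - h)"
    using DERIV_neg_dec_left[OF dF[OF s(1)]] by blast
  define h where "h = min (e / 2) (s / 2)"
  have "0 < h" "h < e" "h < s" using e s by (auto simp: h_def min_def)
  then show False using e(2)[of h] neg[of "s - h"] s by auto
qed

end

section \<open>Barriers near infinity\<close>

text \<open>Up to a positive factor, the defect of \<open>K = 2 * z / (g * t + A - B * z)\<close> as a solution of the
  differential equation that K satisfies along z.\<close>

definition gam :: "real \<Rightarrow> real \<Rightarrow> real \<Rightarrow> real \<Rightarrow> real \<Rightarrow> real" where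
  "gam g A B t z = - g * t * (g * t + A - B * z)
     - t * ((2 - z) * (g * t + A - B * z) + 2) * (g * t + A)
     - 2 * (1 - z) * t * (g * t + A - B * z)\<^sup>2 + 2 * (2 - z) * (g * t + A - B * z) ^ 3
     + 2 * (g * t + A - B * z)\<^sup>2"

context ground_state begin

text \<open>\<open>z\<close> measures how far u'/u is from its value -1 for exp(-t).
  \<open>K\<close> below is the energy of \<open>K_energy_pos\<close> divided by u^2, whence its
  sign.\<close>

definition z where "z t = 1 + du t / u t"
definition K where "K t = (Q t)\<^sup>2 - 2 * z t * (2 - z t)"

lemma z_pos: assumes "0 < t" shows "0 < z t"
proof -
  have "z t = (u t + du t) / u t" using u_pos[OF assms] by (simp add: z_def add_divide_distrib)
  then show ?thesis using u_pos[OF assms] u_plus_du_pos[OF assms] by simp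
qed

lemma K_pos: assumes "0 < t" shows "0 < K t"
proof -
  have "K t = (2 * (du t)\<^sup>2 - 2 * (u t)\<^sup>2 + (u t)\<^sup>2 * (Q t)\<^sup>2) / (u t)\<^sup>2"
    using u_pos[OF assms] by (simp add: K_def z_def field_simps power2_eq_square)
  then show ?thesis using K_energy_pos[OF assms] u_pos[OF assms] by simp
qed

lemma rho_z: assumes "0 < t" shows "rho t = 1 + t * (1 - z t)"
  using du_eq[OF assms] u_pos[OF assms] assms by (simp add: z_def field_simps)

lemma dQ_z: assumes "0 < t" shows "dQ t = Q t * (z t - 1 - 1 / t)"
  using Q_pos[of t] assms by (simp add: z_def du_def u_def field_simps)

lemma z_deriv: assumes "0 < t" shows "(z has_real_derivative - (z t * (2 - z t) + K t)) (at t)"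
proof -
  have "(z has_real_derivative (u t * (1 - (Q t)\<^sup>2) * u t - du t * du t) / (u t * u t)) (at t)"
    unfolding z_def[abs_def] using u_pos[OF assms] u_deriv[OF assms] du_deriv[OF assms]
    by (auto intro!: derivative_eq_intros)
  moreover have "(u t * (1 - (Q t)\<^sup>2) * u t - du t * du t) / (u t * u t) = - (z t * (2 - z t) + K t)"
    using u_pos[OF assms] by (simp add: K_def z_def field_simps power2_eq_square)
  ultimately show ?thesis by simp
qed

lemma S_deriv:
  assumes "0 < t" shows "((\<lambda>t. (Q t)\<^sup>2) has_real_derivative 2 * (Q t)\<^sup>2 * (z t - 1 - 1 / t)) (at t)"
  using Q_deriv[OF assms] dQ_z[OF assms]
  by (auto intro!: derivative_eq_intros simp: power2_eq_square)

text \<open>With \<open>z_deriv\<close> this is a closed system for (z, K), affine in K. For small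
  z, the ansatz K = k(t) z in it gives k ~ 2/t to leading order; the barriers 2 z / (g t + A - B z)
  are deformations of this relation.\<close>

lemma K_deriv:
  assumes "0 < t"
  shows "(K has_real_derivative 2 * (1 - z t) * K t - 2 * (2 * z t * (2 - z t) + K t) / t) (at t)"
proof -
  have "(K has_real_derivative 2 * (Q t)\<^sup>2 * (z t - 1 - 1 / t)
      - (2 * (- (z t * (2 - z t) + K t)) * (2 - z t) + 2 * z t * (z t * (2 - z t) + K t))) (at t)"
    unfolding K_def[abs_def]
    by (rule DERIV_cong, (rule derivative_intros S_deriv[OF assms] z_deriv[OF assms])+) (simp add: K_def)
  moreover have S: "(Q t)\<^sup>2 = 2 * z t * (2 - z t) + K t" by (simp add: K_def)
  ultimately show ?thesis unfolding S using assms
    by (rule_tac DERIV_cong) (assumption, simp add: field_simps power2_eq_square)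
qed

lemma z_tp: "z tp = 1 + tp * (1/2 - 3/100 * (u tp)\<^sup>2 - tp\<^sup>2 / 30)"
proof -
  have "tp * (z tp - 1) = tp * (tp * (1/2 - 3/100 * (u tp)\<^sup>2 - tp\<^sup>2 / 30))"
    using tp(3) rho_z[OF tp(1)] by (simp add: P_def algebra_simps power2_eq_square power4_eq_xxxx)
  then show ?thesis using tp(1) by simp
qed

lemma u_tp_lt: "(u tp)\<^sup>2 < 2"
proof -
  have "(u tp)\<^sup>2 < (u tmax)\<^sup>2"
  proof (rule power_strict_mono)
    show "u tp < u tmax"
    proof (rule DERIV_pos_imp_increasing_open[OF tp(2)])
      show "\<exists>y. (u has_real_derivative y) (at x) \<and> 0 < y" if "tp < x" "x < tmax" for x
        using u_deriv[of x] tmax(3)[of x] that tp(1) by auto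
      show "continuous_on {tp..tmax} u" by (rule continuous_on_subset[OF u_cont]) (use tp in auto)
    qed
  qed (use u_pos[OF tp(1)] in auto)
  also have "(u tmax)\<^sup>2 < 2"
    using b_le_beta_up[of tmax] c_tmax tmax by (simp add: rho_tmax beta_up_def)
  finally show ?thesis .
qed

lemma tp_bounds: "tp\<^sup>2 < 7/8" "tp < 1" "z tp < 1 + tp / 2" "1 < z tp"
proof -
  show c: "tp\<^sup>2 < 7/8" using c_lt[of tp] tp by simp
  then show t1: "tp < 1" using tp(1) by (intro power2_less_imp_less[of tp 1]) auto
  have "0 < (u tp)\<^sup>2" using u_pos[OF tp(1)] by simp
  then show "z tp < 1 + tp / 2" using tp(1) unfolding z_tp
    by (simp add: less_le_trans[of _ 0])
  show "1 < z tp" using tp(1) c u_tp_lt unfolding z_tp by simp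
qed

text \<open>z decreases while 0 < z < 2, but the upper bound must be propagated as well; the level z
  tp < 3/2 cannot be crossed upwards.\<close>

lemma z_le_tp: assumes "tp \<le> t" shows "z t \<le> z tp"
proof -
  have "z t - z tp \<le> 0"
  proof (rule no_cross[OF assms, of "\<lambda>t. z t - z tp" "\<lambda>t. - (z t * (2 - z t) + K t)"])
    fix x assume x: "tp \<le> x" "x \<le> t"
    then have x0: "0 < x" using tp(1) by simp
    show "((\<lambda>t. z t - z tp) has_real_derivative - (z x * (2 - z x) + K x)) (at x)"
      using z_deriv[OF x0] by (auto intro!: derivative_eq_intros)
    assume "z x - z tp = 0"
    then have "0 < z x * (2 - z x)" using tp_bounds by (intro mult_pos_pos) auto
    then show "- (z x * (2 - z x) + K x) < 0" using K_pos[OF x0] by simp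
  qed simp
  then show ?thesis by simp
qed

lemma z_less_2: "tp \<le> t \<Longrightarrow> z t < 2"
  using z_le_tp[of t] tp_bounds by simp

lemma z_mono: assumes "tp \<le> r" "r \<le> t" shows "z t \<le> z r"
proof (rule DERIV_nonpos_imp_nonincreasing[OF assms(2)])
  fix x assume x: "r \<le> x" "x \<le> t"
  then have x0: "0 < x" "tp \<le> x" using tp(1) assms by auto
  have "0 \<le> z x * (2 - z x)" using z_pos[OF x0(1)] z_less_2[OF x0(2)] by simp
  then have "- (z x * (2 - z x) + K x) \<le> 0" using K_pos[OF x0(1)] by simp
  then show "\<exists>y. (z has_real_derivative y) (at x) \<and> y \<le> 0" using z_deriv[OF x0(1)] by blast
qed

text \<open>K > 0 means 2 z (2 - z) < S -> 0, and z < 3/2 rules out values close to the other root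
  2.\<close>

lemma z_eventually_small: obtains T where "0 < T" "\<And>t. T \<le> t \<Longrightarrow> z t \<le> 1/8"
proof -
  obtain T where T: "0 < T" "\<And>t. T \<le> t \<Longrightarrow> Q t < 1/4" using Q_eventually_less[of "1/4"] by auto
  have "z t \<le> 1/8" if t: "max T 1 \<le> t" for t
  proof -
    have t0: "0 < t" "tp \<le> t" using t tp_bounds by auto
    have "(Q t)\<^sup>2 \<le> (1/4)\<^sup>2" using T(2)[of t] Q_pos[of t] t t0 by (intro power_mono) auto
    then have "(Q t)\<^sup>2 \<le> 1/16" by (simp add: power2_eq_square)
    moreover have "z t * (1/2) \<le> z t * (2 - z t)"
      using z_pos[OF t0(1)] z_le_tp[OF t0(2)] tp_bounds by (intro mult_left_mono) auto
    ultimately show ?thesis using K_pos[OF t0(1)] by (simp add: K_def)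
  qed
  then show thesis using that[of "max T 1"] T(1) by auto
qed

text \<open>Because the system is affine in K, the deviation from the barrier satisfies a linear
  equation with no quadratic remainder. Its source has the sign opposite to \<open>gam\<close>, and
  its rate eventually exceeds 1.\<close>

lemma K_minus_barrier_deriv:
  fixes g A B :: real
  assumes "0 < t" and s: "g * t + A - B * z t \<noteq> 0"
  defines "s \<equiv> g * t + A - B * z t"
  shows "((\<lambda>t. K t - 2 * z t / (g * t + A - B * z t)) has_real_derivative
    - (2 * z t / (t * s ^ 3)) * gam g A B t (z t)
    + (2 * (1 - z t) - 2 / t + 2 * (g * t + A) / s\<^sup>2) * (K t - 2 * z t / s)) (at t)"
proof -
  define s1 where "s1 = g * t + A"
  have s0: "s \<noteq> 0" and s1: "s1 = s + B * z t" using s by (auto simp: s_def s1_def)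
  let ?z' = "- (z t * (2 - z t) + K t)"
  have "((\<lambda>t. K t - 2 * z t / (g * t + A - B * z t)) has_real_derivative
      2 * (1 - z t) * K t - 2 * (2 * z t * (2 - z t) + K t) / t
      - (2 * ?z' * s - 2 * z t * (g - B * ?z')) / (s * s)) (at t)"
    unfolding s_def
    by (rule DERIV_cong, (rule derivative_intros K_deriv[OF assms(1)] z_deriv[OF assms(1)] s)+) (simp add: mult.commute)
  moreover have "2 * (1 - z t) * K t - 2 * (2 * z t * (2 - z t) + K t) / t
      - (2 * ?z' * s - 2 * z t * (g - B * ?z')) / (s * s)
    = - (2 * z t / (t * s ^ 3)) * (- g * t * s - t * ((2 - z t) * s + 2) * s1
     - 2 * (1 - z t) * t * s\<^sup>2 + 2 * (2 - z t) * s ^ 3 + 2 * s\<^sup>2)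
    + (2 * (1 - z t) - 2 / t + 2 * s1 / s\<^sup>2) * (K t - 2 * z t / s)"
    unfolding s1 using s0 assms(1)
    by (simp add: field_simps power2_eq_square power3_eq_cube)
  ultimately show ?thesis by (simp add: gam_def s1_def s_def)
qed

lemma K_barrier_rate:
  fixes g A B :: real
  assumes "tp \<le> t" "0 \<le> g * t + A"
  shows "- (2 + 2 / tp) \<le> 2 * (1 - z t) - 2 / t + 2 * (g * t + A) / (g * t + A - B * z t)\<^sup>2"
proof -
  have "2 / t \<le> 2 / tp" using assms tp(1) by (intro divide_left_mono) auto
  moreover have "0 \<le> 2 * (g * t + A) / (g * t + A - B * z t)\<^sup>2" using assms by simp
  moreover have "- (2 + y) \<le> 2 * (1 - z t) - x + e" if "0 \<le> e" "x \<le> y" for e x y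
    using z_less_2[OF assms(1)] that by simp
  ultimately show ?thesis by blast
qed

lemma K_barrier_rate_eventually:
  fixes g A B :: real
  assumes "0 \<le> g" "0 \<le> A"
  obtains T where "\<And>t. T \<le> t \<Longrightarrow> 1 \<le> 2 * (1 - z t) - 2 / t + 2 * (g * t + A) / (g * t + A - B * z t)\<^sup>2"
proof -
  obtain T where T: "0 < T" "\<And>t. T \<le> t \<Longrightarrow> z t \<le> 1/8" using z_eventually_small by metis
  have "1 \<le> 2 * (1 - z t) - 2 / t + 2 * (g * t + A) / (g * t + A - B * z t)\<^sup>2" if t: "max T 8 \<le> t" for t
  proof -
    have "2 / t \<le> 2 / 8" using t by (intro divide_left_mono) auto
    moreover have "0 \<le> 2 * (g * t + A) / (g * t + A - B * z t)\<^sup>2" using assms t by simp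
    moreover have "1 \<le> 2 * (1 - z t) - x + e" if "0 \<le> e" "x \<le> 2 / 8" for e x
      using T(2)[of t] t that by simp
    ultimately show ?thesis by blast
  qed
  then show thesis using that by blast
qed

text \<open>With gam <= 0 a positive deviation would escape to infinity, whereas K <= S <= Q(0)^2.
  No initial comparison is made at t0: the bound there comes from all later times.\<close>

lemma K_upper_barrier:
  fixes g A B :: real
  assumes t0: "tp \<le> t0" and gA: "0 \<le> g" "0 \<le> A"
    and s: "\<And>t. t0 \<le> t \<Longrightarrow> 0 < g * t + A - B * z t"
    and gam: "\<And>t. t0 \<le> t \<Longrightarrow> gam g A B t (z t) \<le> 0"
  shows "K t0 \<le> 2 * z t0 / (g * t0 + A - B * z t0)"
proof (rule ccontr)
  assume neg: "\<not> ?thesis"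
  let ?s = "\<lambda>t. g * t + A - B * z t"
  let ?psi = "\<lambda>t. 2 * (1 - z t) - 2 / t + 2 * (g * t + A) / (?s t)\<^sup>2"
  obtain T where T: "\<And>t. T \<le> t \<Longrightarrow> 1 \<le> ?psi t" using K_barrier_rate_eventually[OF gA] by metis
  show False
  proof (rule exponential_escape[of "\<lambda>t. K t - 2 * z t / ?s t" t0
        "\<lambda>t. - (2 * z t / (t * ?s t ^ 3)) * gam g A B t (z t) + ?psi t * (K t - 2 * z t / ?s t)"
        ?psi "2 + 2 / tp" T "(Q 0)\<^sup>2"])
    show "0 < K t0 - 2 * z t0 / ?s t0" using neg by simp
    fix t assume t: "t0 \<le> t"
    then have tt: "0 < t" "tp \<le> t" using t0 tp(1) by auto
    show "((\<lambda>t. K t - 2 * z t / ?s t) has_real_derivative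
        - (2 * z t / (t * ?s t ^ 3)) * gam g A B t (z t) + ?psi t * (K t - 2 * z t / ?s t)) (at t)"
      using K_minus_barrier_deriv[OF tt(1), of g A B] s[OF t] by simp
    have "0 \<le> 2 * z t / (t * ?s t ^ 3)" using z_pos[OF tt(1)] tt s[OF t] by simp
    then have "(2 * z t / (t * ?s t ^ 3)) * gam g A B t (z t) \<le> 0"
      using gam[OF t] by (rule mult_nonneg_nonpos)
    then show "?psi t * (K t - 2 * z t / ?s t)
        \<le> - (2 * z t / (t * ?s t ^ 3)) * gam g A B t (z t) + ?psi t * (K t - 2 * z t / ?s t)"
      unfolding mult_minus_left by (simp only: le_add_same_cancel2 neg_0_le_iff_le)
    show "- (2 + 2 / tp) \<le> ?psi t" using K_barrier_rate[OF tt(2), of g A B] gA tt by simp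
    have "0 \<le> 2 * z t / ?s t" using z_pos[OF tt(1)] s[OF t] by simp
    moreover have "0 \<le> 2 * z t * (2 - z t)" using z_pos[OF tt(1)] z_less_2[OF tt(2)] by simp
    moreover have "(Q t)\<^sup>2 \<le> (Q 0)\<^sup>2"
      using Q_strict_dec[of 0 t] Q_pos[of t] tt by (intro power_mono) auto
    ultimately show "K t - 2 * z t / ?s t \<le> (Q 0)\<^sup>2" unfolding K_def by linarith
  qed (rule T)
qed

text \<open>The same escape for the negative of the deviation, which stays below 4/d since K > 0 and
  z < 2.\<close>

lemma K_lower_barrier:
  fixes g A B :: real
  assumes t0: "tp \<le> t0" and gA: "0 \<le> g" "0 \<le> A" and d: "0 < d"
    and s: "\<And>t. t0 \<le> t \<Longrightarrow> d \<le> g * t + A - B * z t"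
    and gam: "\<And>t. t0 \<le> t \<Longrightarrow> 0 \<le> gam g A B t (z t)"
  shows "2 * z t0 / (g * t0 + A - B * z t0) \<le> K t0"
proof (rule ccontr)
  assume neg: "\<not> ?thesis"
  let ?s = "\<lambda>t. g * t + A - B * z t"
  let ?psi = "\<lambda>t. 2 * (1 - z t) - 2 / t + 2 * (g * t + A) / (?s t)\<^sup>2"
  obtain T where T: "\<And>t. T \<le> t \<Longrightarrow> 1 \<le> ?psi t" using K_barrier_rate_eventually[OF gA] by metis
  show False
  proof (rule exponential_escape[of "\<lambda>t. - (K t - 2 * z t / ?s t)" t0
        "\<lambda>t. - (- (2 * z t / (t * ?s t ^ 3)) * gam g A B t (z t) + ?psi t * (K t - 2 * z t / ?s t))"
        ?psi "2 + 2 / tp" T "4 / d"])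
    show "0 < - (K t0 - 2 * z t0 / ?s t0)" using neg by simp
    fix t assume t: "t0 \<le> t"
    then have tt: "0 < t" "tp \<le> t" using t0 tp(1) by auto
    have st: "0 < ?s t" using s[OF t] d by simp
    show "((\<lambda>t. - (K t - 2 * z t / ?s t)) has_real_derivative
        - (- (2 * z t / (t * ?s t ^ 3)) * gam g A B t (z t) + ?psi t * (K t - 2 * z t / ?s t))) (at t)"
      using K_minus_barrier_deriv[OF tt(1), of g A B] st by (intro DERIV_minus) simp
    have "0 \<le> 2 * z t / (t * ?s t ^ 3)" using z_pos[OF tt(1)] tt st by simp
    then have "0 \<le> (2 * z t / (t * ?s t ^ 3)) * gam g A B t (z t)"
      using gam[OF t] by (rule mult_nonneg_nonneg)
    then show "?psi t * - (K t - 2 * z t / ?s t)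
        \<le> - (- (2 * z t / (t * ?s t ^ 3)) * gam g A B t (z t) + ?psi t * (K t - 2 * z t / ?s t))"
      unfolding mult_minus_right mult_minus_left minus_add_distrib minus_minus
      by (simp only: le_add_same_cancel2)
    show "- (2 + 2 / tp) \<le> ?psi t" using K_barrier_rate[OF tt(2), of g A B] gA tt by simp
    have "2 * z t / ?s t \<le> 4 / d"
      using z_less_2[OF tt(2)] z_pos[OF tt(1)] s[OF t] d by (intro frac_le) auto
    then show "- (K t - 2 * z t / ?s t) \<le> 4 / d" using K_pos[OF tt(1)] by simp
  qed (rule T)
qed

end

section \<open>Polynomial inequalities\<close>

lemma gam_low_nonneg:
  fixes t z :: real
  assumes t: "41/100 \<le> t" and z: "0 \<le> z" "z \<le> 1 + 461/1000 * t"
  shows "0 \<le> gam (51/50) (31/200) (1/20) t z"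
proof -
  define A0 where "A0 = 125891 / 2000000 + 181133 / 500000 * t - 41157 / 125000 * t ^ 2 + 2601 / 31250 * t ^ 3"
  define A1 where "A1 = - 211451 / 4000000 - 185589 / 500000 * t - 84303 / 250000 * t ^ 2 + 15606 / 15625 * t ^ 3"
  define A2 where "A2 = 5613 / 400000 + 2804307 / 40000000 * t + 523717 / 10000000 * t ^ 2"
  define A3 where "A3 = 113 / 40000 + 103 / 10000 * t"
  have pos: "0 < A3" "0 < A2" unfolding A3_def A2_def using t by (auto intro!: add_pos_nonneg)
  have "gam (51/50) (31/200) (1/20) t z = A0 + A1 * z + A2 * z\<^sup>2 + A3 * z\<^sup>2 * (1 + 461/1000 * t - z) + 1/4000 * z ^ 4"
    unfolding gam_def A0_def A1_def A2_def A3_def by algebra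
  moreover have "0 \<le> A3 * z\<^sup>2 * (1 + 461/1000 * t - z)" using pos z by simp
  moreover have "0 \<le> 1/4000 * z ^ 4" by simp
  moreover have "0 \<le> A0 + A1 * z + A2 * z\<^sup>2"
  proof (cases "t \<le> 4/5")
    case True
    \<comment> \<open>The convex quadratic lies above its tangent at z = 59/50. That tangent C0 + C1
      z is affine, so it is checked only at the ends z = 0 and z = Z.\<close>
    define C0 where "C0 = A0 - (59/50)\<^sup>2 * A2"
    define C1 where "C1 = A1 + 2 * (59/50) * A2"
    define Z where "Z = 1 + 461/1000 * t"
    have "C0 = 2813831507761 / 1853718750000 * (4/5 - t) ^ 3
      + 21757812954431 / 4943250000000 * (t - 41/100) * (4/5 - t) ^ 2
      + 3440994176827 / 988650000000 * (t - 41/100) ^ 2 * (4/5 - t)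
      + 3152011126 / 4634296875 * (t - 41/100) ^ 3"
      unfolding C0_def A0_def A2_def by algebra
    also have "\<dots> \<ge> 0" using t True by (intro add_nonneg_nonneg mult_nonneg_nonneg zero_le_power) auto
    finally have C0: "0 \<le> C0" .
    have "C0 + C1 * Z = 169610841092941 / 722950312500000 * (4/5 - t) ^ 4
      + 14206245082995413 / 5783602500000000 * (t - 41/100) * (4/5 - t) ^ 3
      + 4741020148369763 / 385573500000000 * (t - 41/100) ^ 2 * (4/5 - t) ^ 2
      + 163529140978657 / 7229503125000 * (t - 41/100) ^ 3 * (4/5 - t)
      + 4701272969711 / 361475156250 * (t - 41/100) ^ 4"
      unfolding C0_def C1_def A0_def A1_def A2_def Z_def by algebra
    also have "\<dots> \<ge> 0" using t True by (intro add_nonneg_nonneg mult_nonneg_nonneg zero_le_power) auto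
    finally have CZ: "0 \<le> C0 + C1 * Z" .
    have Z: "0 < Z" "z \<le> Z" using t z by (auto simp: Z_def)
    have "Z * (C0 + C1 * z) = (Z - z) * C0 + z * (C0 + C1 * Z)" by algebra
    also have "\<dots> \<ge> 0" using C0 CZ Z z by simp
    finally have "0 \<le> C0 + C1 * z" using Z by (simp add: zero_le_mult_iff)
    moreover have "A0 + A1 * z + A2 * z\<^sup>2 = C0 + C1 * z + A2 * (z - 59/50)\<^sup>2"
      unfolding C0_def C1_def by algebra
    ultimately show ?thesis using pos by simp
  next
    case False
    define r where "r = t - 4/5"
    have r: "0 < r" using False by (simp add: r_def)
    have t': "t = 4/5 + r" by (simp add: r_def)
    have "A1 = - (27121711 / 500000000) + r * (12586851 / 12500000 + 2574837 / 1250000 * r + 15606 / 15625 * r ^ 2)" unfolding A1_def t' by algebra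
    moreover have "0 \<le> r * (12586851 / 12500000 + 2574837 / 1250000 * r + 15606 / 15625 * r ^ 2)" using r by simp
    ultimately have "- (27121711 / 500000000) * z \<le> A1 * z" using z by (intro mult_right_mono) auto
    moreover have "0 \<le> A0 - 27121711 / 500000000 * (1 + 461/1000 * t)"
    proof -
      have "A0 - 27121711 / 500000000 * (1 + 461/1000 * t) = 2601 / 31250 * r * (r - 1)\<^sup>2 + 23103 / 625000 * (r - 153/100)\<^sup>2
        + 67955229 / 500000000000 * r + 14918717279 / 625000000000"
        unfolding A0_def t' by algebra
      also have "\<dots> \<ge> 0" using r by (intro add_nonneg_nonneg mult_nonneg_nonneg) auto
      finally show ?thesis .
    qed
    moreover have "27121711 / 500000000 * z \<le> 27121711 / 500000000 * (1 + 461/1000 * t)" using z by (intro mult_left_mono) auto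
    moreover have "0 \<le> A2 * z\<^sup>2" using pos by simp
    ultimately show ?thesis by linarith
  qed
  ultimately show ?thesis by linarith
qed

text \<open>A quadratic in z with U0 <= 0 and U2 > 0 is nonpositive on [0, Z] once it is so at Z,
  hence only the largest possible z matters. The bound on z t^2 is what \<open>path1\<close> yields
  later.\<close>

lemma gam_up_nonpos:
  fixes t z :: real
  assumes t: "41/100 \<le> t" and z: "0 \<le> z"
    and zt: "t \<le> 49/100 \<and> z \<le> 1 + 461/1000 * t \<or> 49/100 \<le> t \<and> z * t\<^sup>2 \<le> 59/200"
  shows "gam 1 (47/500) (1/50) t z \<le> 0"
proof -
  define U0 where "U0 = 656073 / 31250000 + 10293 / 62500 * t - 78 / 125 * t ^ 2"
  define U1 where "U1 = - 706363 / 62500000 - 30087 / 250000 * t - 3 / 25 * t ^ 2 + t ^ 3"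
  define U2 where "U2 = 14447 / 6250000 + 429 / 25000 * t + 1 / 50 * t ^ 2"
  define U3 where "U3 = 161 / 625000 + 1 / 625 * t"
  have eq: "gam 1 (47/500) (1/50) t z = U0 + U1 * z + U2 * z\<^sup>2 - z ^ 3 * (U3 - 1 / 62500 * z)"
    unfolding gam_def U0_def U1_def U2_def U3_def by algebra
  have U2: "0 < U2" unfolding U2_def using t by (auto intro!: add_pos_nonneg)
  define r where "r = t - 41/100"
  have r: "0 \<le> r" "t = 41/100 + r" using t by (auto simp: r_def)
  have "U0 = - (127953 / 7812500 + 21687 / 62500 * r + 78 / 125 * r ^ 2)" unfolding U0_def r(2) by algebra
  moreover have "0 \<le> 127953 / 7812500 + 21687 / 62500 * r + 78 / 125 * r ^ 2" using r by simp
  ultimately have U0: "U0 \<le> 0" by simp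
  have convex: "U0 + U1 * z + U2 * z\<^sup>2 \<le> 0"
    if Z: "0 < Z" "z \<le> Z" "U0 + U1 * Z + U2 * Z\<^sup>2 \<le> 0" for Z
  proof -
    have "Z * (U0 + U1 * z + U2 * z\<^sup>2) = (Z - z) * U0 + z * (U0 + U1 * Z + U2 * Z\<^sup>2) - U2 * z * (Z - z) * Z"
      by algebra
    moreover have "(Z - z) * U0 \<le> 0" "z * (U0 + U1 * Z + U2 * Z\<^sup>2) \<le> 0" "0 \<le> U2 * z * (Z - z) * Z"
      using Z U0 U2 z by (simp_all add: mult_nonneg_nonpos)
    ultimately have "Z * (U0 + U1 * z + U2 * z\<^sup>2) \<le> 0" by linarith
    then show ?thesis using Z by (simp add: mult_le_0_iff)
  qed
  have "z \<le> 2 \<and> U0 + U1 * z + U2 * z\<^sup>2 \<le> 0"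
  proof (cases "t \<le> 49/100 \<and> z \<le> 1 + 461/1000 * t")
    case True
    have "- (U0 + U1 * (1 + 461/1000 * t) + U2 * (1 + 461/1000 * t)\<^sup>2) = 98081141618871 / 320000000000 * (49/100 - t) ^ 4
      + 144823269084393 / 128000000000 * (t - 41/100) * (49/100 - t) ^ 3
      + 905854621799771 / 640000000000 * (t - 41/100) ^ 2 * (49/100 - t) ^ 2
      + 82034223978267 / 128000000000 * (t - 41/100) ^ 3 * (49/100 - t)
      + 31972800006987 / 640000000000 * (t - 41/100) ^ 4"
      unfolding U0_def U1_def U2_def by algebra
    also have "\<dots> \<ge> 0" using t True by (intro add_nonneg_nonneg mult_nonneg_nonneg zero_le_power) auto
    finally show ?thesis using convex[of "1 + 461/1000 * t"] True t by simp
  next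
    case False
    then have t': "49/100 \<le> t" and zt': "z * t\<^sup>2 \<le> 59/200" using zt by auto
    define x where "x = t - 49/100"
    have x: "0 \<le> x" "t = 49/100 + x" using t' by (auto simp: x_def)
    have t0: "0 < t" using t by simp
    define Z where "Z = 59/200 / t\<^sup>2"
    have Z: "0 < Z" "z \<le> Z" using t0 zt' by (auto simp: Z_def field_simps)
    have Zt: "Z * t\<^sup>2 = 59/200" using t0 by (simp add: Z_def)
    have "t ^ 4 * (U0 + U1 * Z + U2 * Z\<^sup>2) = t ^ 4 * U0 + U1 * (Z * t\<^sup>2) * t\<^sup>2 + U2 * (Z * t\<^sup>2)\<^sup>2"
      by algebra
    also have "\<dots> = - (10637853281 / 97656250000000 + 177449020867 / 31250000000000 * x + 45813925999 / 625000000000 * x ^ 2 + 2676789959 / 6250000000 * x ^ 3 + 70969129 / 62500000 * x ^ 4 + 171859 / 125000 * x ^ 5 + 78 / 125 * x ^ 6)"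
      unfolding Zt unfolding U0_def U1_def U2_def x(2) by algebra
    also have "\<dots> \<le> 0"
      unfolding neg_le_0_iff_le using x(1) by (intro add_nonneg_nonneg mult_nonneg_nonneg zero_le_power) simp_all
    finally have "U0 + U1 * Z + U2 * Z\<^sup>2 \<le> 0" using t0 by (simp add: mult_le_0_iff)
    moreover have "(49/100)\<^sup>2 \<le> t\<^sup>2" using t' by (intro power_mono) auto
    then have "z * (49/100)\<^sup>2 \<le> z * t\<^sup>2" using z by (intro mult_left_mono) auto
    then have "z \<le> 2" using zt' by (simp add: power2_eq_square)
    ultimately show ?thesis using convex[OF Z] by simp
  qed
  moreover from this have "0 \<le> z ^ 3 * (U3 - 1 / 62500 * z)"
    unfolding U3_def using z t by (intro mult_nonneg_nonneg) auto
  ultimately show ?thesis unfolding eq by linarith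
qed

text \<open>The coarse barrier K <= 2 z / t, used to get tp >= 41/100, from where on the sharper
  upper barrier applies.\<close>

lemma gam_crude: "gam 1 0 0 t z = t\<^sup>2 * (z * t - 1)"
  unfolding gam_def by algebra

text \<open>For use at tp, where d = 1 - rho tp = kap tp^2.\<close>

lemma beta_up_near_1:
  fixes c d :: real
  assumes "0 \<le> d" "d \<le> 1" "0 \<le> c"
  shows "beta_up (1 - d) c \<le> 689/500 + 21/50 * c + d * (- 17/500 + 19/25 * c - 229/250 * d)"
proof -
  have "beta_up (1 - d) c = 689/500 + 21/50 * c + d * (- 17/500 + 19/25 * c - 229/250 * d)
      - (9/50 * c * d\<^sup>2 + d ^ 3 * (157/250 - 1/4 * d + 1/20 * d\<^sup>2))"
    unfolding beta_up_def by algebra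
  moreover have "0 \<le> 9/50 * c * d\<^sup>2 + d ^ 3 * (157/250 - 1/4 * d + 1/20 * d\<^sup>2)"
    using assms by (intro add_nonneg_nonneg mult_nonneg_nonneg) auto
  ultimately show ?thesis by linarith
qed

lemma beta_low_near_1:
  fixes c d :: real
  assumes "0 \<le> d" "d \<le> 1" "2 * d \<le> c"
  shows "13/10 + 3/10 * c \<le> beta_low (1 - d) c"
proof -
  have "beta_low (1 - d) c = 13/10 + 3/10 * c + 7/10 * d * (c - 2 * d) + d * (3/10 - 1/10 * d - 1/10 * d\<^sup>2)"
    unfolding beta_low_def by algebra
  moreover have "d\<^sup>2 \<le> 1" using assms by (simp add: power_le_one)
  then have "0 \<le> d * (3/10 - 1/10 * d - 1/10 * d\<^sup>2)" using assms by (intro mult_nonneg_nonneg) auto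
  moreover have "0 \<le> 7/10 * d * (c - 2 * d)" using assms by simp
  ultimately show ?thesis by linarith
qed

text \<open>Up to positive factors, \<^term>\<open>supersol\<close> bounds the defect of \<^term>\<open>1 - q * S\<close>, with
  \<^term>\<open>q = A + B * t + C * t\<^sup>2\<close> and S the square of the ground state, as a supersolution from below
  when K is replaced by its lower barrier.\<close>

definition supersol :: "real \<Rightarrow> real \<Rightarrow> real \<Rightarrow> real \<Rightarrow> real \<Rightarrow> real" where
  "supersol A B C t z =
    (6 * A + (8 * A + 2 * B) * t + (4 * A + 4 * B - 3) * t\<^sup>2 + 4 * B * t ^ 3 + 4 * C * t ^ 4
      - (8 * A * t + 4 * B * t\<^sup>2) * z) * (51/50 * t + 31/200 - 1/20 * z)
    + 2 * t\<^sup>2 * (A + B * t + C * t\<^sup>2) * z"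

text \<open>The loss caused by -e z outweighs the gain 2 t^2 q z, so \<open>supersol\<close>
  decreases in z and it suffices to insert an upper bound Z for z.\<close>

lemma supersol_antimono:
  fixes t z Z :: real
  assumes ABC: "0 \<le> A" "0 \<le> B" "C \<le> 0" and t: "0 < t" and z: "0 \<le> z" "z \<le> Z" "0 < Z" "Z \<le> 5/4"
    and H: "0 \<le> supersol A B C t Z"
  shows "0 \<le> supersol A B C t z"
proof -
  define F where "F = 6 * A + (8 * A + 2 * B) * t + (4 * A + 4 * B - 3) * t\<^sup>2 + 4 * B * t ^ 3 + 4 * C * t ^ 4"
  define e where "e = 8 * A * t + 4 * B * t\<^sup>2"
  define s where "s = 51/50 * t + 31/200"
  define q where "q = A + B * t + C * t\<^sup>2"
  have H': "supersol A B C t x = (F - e * x) * (s - 1/20 * x) + 2 * t\<^sup>2 * q * x" for x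
    unfolding supersol_def F_def e_def s_def q_def by simp
  have s: "51/50 * t \<le> s - 1/20 * x" if "x \<le> 5/2" for x using that by (simp add: s_def)
  have e: "0 \<le> e" unfolding e_def using ABC t by simp
  have key: "2 * t\<^sup>2 * q \<le> e * (s - 1/20 * x)" if "x \<le> 5/2" for x
  proof -
    have "2 * t\<^sup>2 * q \<le> 2 * t\<^sup>2 * (A + B * t)"
      unfolding q_def using ABC t by (intro mult_left_mono) (auto simp: mult_nonpos_nonneg)
    also have "\<dots> \<le> e * (51/50 * t)"
    proof -
      have "e * (51/50 * t) - 2 * t\<^sup>2 * (A + B * t) = t\<^sup>2 * (154/25 * A + 52/25 * B * t)"
        unfolding e_def by algebra
      also have "0 \<le> \<dots>" using ABC t by simp
      finally show ?thesis by simp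
    qed
    also have "\<dots> \<le> e * (s - 1/20 * x)" using e s[OF that] by (intro mult_left_mono)
    finally show ?thesis .
  qed
  \<comment> \<open>The sign of F is extracted from the hypothesis at Z itself.\<close>
  have F: "0 \<le> F"
  proof -
    have "(F - e * Z) * (s - 1/20 * Z) + 2 * t\<^sup>2 * q * Z
        = F * (s - 1/20 * Z) - Z * (e * (s - 1/20 * Z) - 2 * t\<^sup>2 * q)" by algebra
    moreover have "0 \<le> Z * (e * (s - 1/20 * Z) - 2 * t\<^sup>2 * q)" using key[of Z] z by simp
    ultimately have "0 \<le> F * (s - 1/20 * Z)" using H unfolding H' by linarith
    moreover have "0 < s - 1/20 * Z" using s[of Z] z t by simp
    ultimately show ?thesis by (simp add: zero_le_mult_iff)
  qed
  have "supersol A B C t z - supersol A B C t Z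
      = (Z - z) * (1/20 * F + (e * (s - 1/20 * (z + Z)) - 2 * t\<^sup>2 * q))" unfolding H' by algebra
  moreover have "0 \<le> (Z - z) * (1/20 * F + (e * (s - 1/20 * (z + Z)) - 2 * t\<^sup>2 * q))"
    using key[of "z + Z"] F z by (intro mult_nonneg_nonneg) auto
  ultimately show ?thesis using H by linarith
qed

text \<open>\<open>path1\<close> and \<open>path2\<close> are upper bounds for z in disguise: they are lower bounds for \<open>1 / z\<close>, in
  the variable \<open>r = t - 49/100\<close> or \<open>r = t - 251/500\<close>. Here and below, positivity of a polynomial on an
  interval is read off its Bernstein coefficients.\<close>

definition path1 :: "real \<Rightarrow> real" where
  "path1 r = 409 / 500 + 169 / 50 * r + 61 / 10 * r ^ 2 + 39 / 5 * r ^ 3 + 22 / 5 * r ^ 4"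

lemma path1_pos: "0 \<le> r \<Longrightarrow> 0 < path1 r"
  unfolding path1_def by (intro add_pos_nonneg) auto

lemma path1_deriv: "(path1 has_real_derivative 169 / 50 + 61 / 5 * r + 117 / 5 * r ^ 2 + 88 / 5 * r ^ 3) (at r)"
  unfolding path1_def[abs_def] by (rule DERIV_cong, (rule derivative_intros)+) simp

text \<open>X = 1/z satisfies X' = 2 X - 1 + X^2 K. With K at its lower barrier, this inequality
  says that path1 grows strictly slower than X at a contact.\<close>

lemma path1_flow:
  fixes r :: real
  assumes "0 \<le> r"
  shows "(169 / 50 + 61 / 5 * r + 117 / 5 * r ^ 2 + 88 / 5 * r ^ 3 + 1 - 2 * path1 r)
      * ((51/50 * (49 / 100 + r) + 31/200) * path1 r - 1/20) < 2 * (path1 r)\<^sup>2"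
proof -
  have "2 * (path1 r)\<^sup>2 - (169 / 50 + 61 / 5 * r + 117 / 5 * r ^ 2 + 88 / 5 * r ^ 3 + 1 - 2 * path1 r)
      * ((51/50 * (49 / 100 + r) + 31/200) * path1 r - 1/20)
    = 888931 / 156250000 + 214773 / 3906250 * r + 1155027 / 3125000 * r ^ 2 + 4117487 / 3125000 * r ^ 3 + 27707621 / 1562500 * r ^ 4 + 19870077 / 312500 * r ^ 5 + 157599 / 1250 * r ^ 6 + 2578738 / 15625 * r ^ 7 + 1954854 / 15625 * r ^ 8 + 24684 / 625 * r ^ 9"
    unfolding path1_def by algebra
  also have "\<dots> > 0" using assms by (intro add_pos_nonneg mult_nonneg_nonneg) auto
  finally show ?thesis by simp
qed

text \<open>The extreme case z = 1 / path1 for 49/100 <= t <= 3/2; multiplying by the square of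
  path1 makes it a polynomial inequality.\<close>

lemma supersol1_path:
  fixes r :: real
  assumes "0 \<le> r" "r \<le> 101 / 100"
  shows "0 \<le> supersol (21 / 500) (129 / 500) (- 19 / 500) (49 / 100 + r) (1 / path1 r)"
proof -
  have x: "0 < path1 r" using path1_pos assms by simp
  define t where "t = 49 / 100 + r"
  have "supersol (21 / 500) (129 / 500) (- 19 / 500) t (1 / path1 r) * (path1 r)\<^sup>2 =
     ((6 * A + (8 * A + 2 * B) * t + (4 * A + 4 * B - 3) * t\<^sup>2 + 4 * B * t ^ 3 + 4 * C * t ^ 4) * path1 r
      - (8 * A * t + 4 * B * t\<^sup>2)) * ((51/50 * t + 31/200) * path1 r - 1/20)
     + 2 * t\<^sup>2 * (A + B * t + C * t\<^sup>2) * path1 r" if "A = 21 / 500" "B = 129 / 500" "C = (- 19 / 500)" for A B C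
    unfolding supersol_def that(1)[symmetric] that(2)[symmetric] that(3)[symmetric]
    using x by (simp add: divide_simps) algebra
  from this[OF refl refl refl] have "supersol (21 / 500) (129 / 500) (- 19 / 500) t (1 / path1 r) * (path1 r)\<^sup>2
    = 130400782259825369600000 / 113809328043328941786781301 * (101 / 100 - r) ^ 13
      + 5822215098023869771520000 / 113809328043328941786781301 * r * (101 / 100 - r) ^ 12
      + 98732646065426458976000000 / 113809328043328941786781301 * r ^ 2 * (101 / 100 - r) ^ 11
      + 896412111796001928890398720 / 113809328043328941786781301 * r ^ 3 * (101 / 100 - r) ^ 10
      + 25121443549738611230198366528 / 569046640216644708933906505 * r ^ 4 * (101 / 100 - r) ^ 9
      + 464847734982840563126718903264 / 2845233201083223544669532525 * r ^ 5 * (101 / 100 - r) ^ 8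
      + 5841135155352049513580007979536 / 14226166005416117723347662625 * r ^ 6 * (101 / 100 - r) ^ 7
      + 249566510030588741542286646713608 / 355654150135402943083691565625 * r ^ 7 * (101 / 100 - r) ^ 6
      + 7117002460482836626123514074731948 / 8891353753385073577092289140625 * r ^ 8 * (101 / 100 - r) ^ 5
      + 215831718825247394418378888140994 / 355654150135402943083691565625 * r ^ 9 * (101 / 100 - r) ^ 4
      + 5418330499070246161200806127432 / 14226166005416117723347662625 * r ^ 10 * (101 / 100 - r) ^ 3
      + 189483462262669757216448242112 / 569046640216644708933906505 * r ^ 11 * (101 / 100 - r) ^ 2
      + 30290096432276834514656817120 / 113809328043328941786781301 * r ^ 12 * (101 / 100 - r)
      + 9924728340485695740789996000 / 113809328043328941786781301 * r ^ 13"
    unfolding t_def path1_def by algebra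
  also have "\<dots> \<ge> 0" using assms by (intro add_nonneg_nonneg mult_nonneg_nonneg zero_le_power) auto
  finally show ?thesis unfolding t_def using x by (simp add: zero_le_mult_iff)
qed

lemma supersol1_near:
  fixes t :: real
  assumes "41 / 100 \<le> t" "t \<le> 49 / 100"
  shows "0 \<le> supersol (21 / 500) (129 / 500) (- 19 / 500) t (1 + 227 / 500 * t)"
proof -
  have "supersol (21 / 500) (129 / 500) (- 19 / 500) t (1 + 227 / 500 * t)
    = 832113690521 / 50000000 * (49 / 100 - t) ^ 5
      + 1827393914050179 / 25600000000 * (t - 41 / 100) * (49 / 100 - t) ^ 4
      + 736795459742651 / 6400000000 * (t - 41 / 100) ^ 2 * (49 / 100 - t) ^ 3
      + 1065760002185497 / 12800000000 * (t - 41 / 100) ^ 3 * (49 / 100 - t) ^ 2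
      + 150240596093931 / 6400000000 * (t - 41 / 100) ^ 4 * (49 / 100 - t)
      + 15267750475747 / 25600000000 * (t - 41 / 100) ^ 5"
    unfolding supersol_def by algebra
  also have "\<dots> \<ge> 0" using assms by (intro add_nonneg_nonneg mult_nonneg_nonneg zero_le_power) auto
  finally show ?thesis .
qed

definition path2 :: "real \<Rightarrow> real" where
  "path2 r = 163 / 200 + 33 / 10 * r + 59 / 10 * r ^ 2 + 15 / 2 * r ^ 3 + 43 / 10 * r ^ 4"

lemma path2_pos: "0 \<le> r \<Longrightarrow> 0 < path2 r"
  unfolding path2_def by (intro add_pos_nonneg) auto

lemma path2_deriv: "(path2 has_real_derivative 33 / 10 + 59 / 5 * r + 45 / 2 * r ^ 2 + 86 / 5 * r ^ 3) (at r)"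
  unfolding path2_def[abs_def] by (rule DERIV_cong, (rule derivative_intros)+) simp

lemma path2_flow:
  fixes r :: real
  assumes "0 \<le> r"
  shows "(33 / 10 + 59 / 5 * r + 45 / 2 * r ^ 2 + 86 / 5 * r ^ 3 + 1 - 2 * path2 r)
      * ((51/50 * (251 / 500 + r) + 31/200) * path2 r - 1/20) < 2 * (path2 r)\<^sup>2"
proof -
  have "2 * (path2 r)\<^sup>2 - (33 / 10 + 59 / 5 * r + 45 / 2 * r ^ 2 + 86 / 5 * r ^ 3 + 1 - 2 * path2 r)
      * ((51/50 * (251 / 500 + r) + 31/200) * path2 r - 1/20)
    = 1304701 / 125000000 + 2355601 / 25000000 * r + 5847627 / 12500000 * r ^ 2 + 17529771 / 12500000 * r ^ 3 + 52166661 / 3125000 * r ^ 4 + 18577563 / 312500 * r ^ 5 + 18308553 / 156250 * r ^ 6 + 96067801 / 625000 * r ^ 7 + 36808731 / 312500 * r ^ 8 + 94299 / 2500 * r ^ 9"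
    unfolding path2_def by algebra
  also have "\<dots> > 0" using assms by (intro add_pos_nonneg mult_nonneg_nonneg) auto
  finally show ?thesis by simp
qed

lemma supersol2_path:
  fixes r :: real
  assumes "0 \<le> r" "r \<le> 499 / 500"
  shows "0 \<le> supersol (47 / 1000) (1 / 4) (- 17 / 500) (251 / 500 + r) (1 / path2 r)"
proof -
  have x: "0 < path2 r" using path2_pos assms by simp
  define t where "t = 251 / 500 + r"
  have "supersol (47 / 1000) (1 / 4) (- 17 / 500) t (1 / path2 r) * (path2 r)\<^sup>2 =
     ((6 * A + (8 * A + 2 * B) * t + (4 * A + 4 * B - 3) * t\<^sup>2 + 4 * B * t ^ 3 + 4 * C * t ^ 4) * path2 r
      - (8 * A * t + 4 * B * t\<^sup>2)) * ((51/50 * t + 31/200) * path2 r - 1/20)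
     + 2 * t\<^sup>2 * (A + B * t + C * t\<^sup>2) * path2 r" if "A = 47 / 1000" "B = 1 / 4" "C = (- 17 / 500)" for A B C
    unfolding supersol_def that(1)[symmetric] that(2)[symmetric] that(3)[symmetric]
    using x by (simp add: divide_simps) algebra
  from this[OF refl refl refl] have "supersol (47 / 1000) (1 / 4) (- 17 / 500) t (1 / path2 r) * (path2 r)\<^sup>2
    = 469537276174452391437500000000000 / 118934292407095410727674098230506499 * (499 / 500 - r) ^ 13
      + 15754926724084799356069375000000000 / 118934292407095410727674098230506499 * r * (499 / 500 - r) ^ 12
      + 227087624964089381460887640000000000 / 118934292407095410727674098230506499 * r ^ 2 * (499 / 500 - r) ^ 11
      + 1870378085992501358309679418400000000 / 118934292407095410727674098230506499 * r ^ 3 * (499 / 500 - r) ^ 10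
      + 9893532806148207059745566308795520000 / 118934292407095410727674098230506499 * r ^ 4 * (499 / 500 - r) ^ 9
      + 35600765023584639329204654304845429200 / 118934292407095410727674098230506499 * r ^ 5 * (499 / 500 - r) ^ 8
      + 447610446591222643227408282705666058184 / 594671462035477053638370491152532495 * r ^ 6 * (499 / 500 - r) ^ 7
      + 3961422059931927539333302272937912963558 / 2973357310177385268191852455762662475 * r ^ 7 * (499 / 500 - r) ^ 6
      + 30686296182535564088781011754508515513255573 / 18583483188608657926199077848516640468750 * r ^ 8 * (499 / 500 - r) ^ 5
      + 852817404893817595999314560470149004983587 / 594671462035477053638370491152532495000 * r ^ 9 * (499 / 500 - r) ^ 4
      + 1118613279005927324670606165344924887723 / 1189342924070954107276740982305064990 * r ^ 10 * (499 / 500 - r) ^ 3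
      + 69060096177502270080792368078968310375 / 118934292407095410727674098230506499 * r ^ 11 * (499 / 500 - r) ^ 2
      + 39436021984853850101092677755904781250 / 118934292407095410727674098230506499 * r ^ 12 * (499 / 500 - r)
      + 11460408682823325962868660158158593750 / 118934292407095410727674098230506499 * r ^ 13"
    unfolding t_def path2_def by algebra
  also have "\<dots> \<ge> 0" using assms by (intro add_nonneg_nonneg mult_nonneg_nonneg zero_le_power) auto
  finally show ?thesis unfolding t_def using x by (simp add: zero_le_mult_iff)
qed

lemma supersol2_near:
  fixes t :: real
  assumes "49 / 100 \<le> t" "t \<le> 251 / 500"
  shows "0 \<le> supersol (47 / 1000) (1 / 4) (- 17 / 500) t (1 + 451 / 1000 * t)"
proof -
  have "supersol (47 / 1000) (1 / 4) (- 17 / 500) t (1 + 451 / 1000 * t)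
    = 807208585500191 / 12441600 * (251 / 500 - t) ^ 5
      + 3541078510013383 / 12441600 * (t - 49 / 100) * (251 / 500 - t) ^ 4
      + 15187181403284459 / 31104000 * (t - 49 / 100) ^ 2 * (251 / 500 - t) ^ 3
      + 63126373180791883 / 155520000 * (t - 49 / 100) ^ 3 * (251 / 500 - t) ^ 2
      + 250484178912211991 / 1555200000 * (t - 49 / 100) ^ 4 * (251 / 500 - t)
      + 921144411142609519 / 38880000000 * (t - 49 / 100) ^ 5"
    unfolding supersol_def by algebra
  also have "\<dots> \<ge> 0" using assms by (intro add_nonneg_nonneg mult_nonneg_nonneg zero_le_power) auto
  finally show ?thesis .
qed

section \<open>The first zero of the inner supersolution\<close>

text \<open>Lower bound on u(tp)^2 from infinity minus upper bound from the origin, times the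
  barrier denominator. The range is split at 11/20 because the margin is small here and tighter
  limits for kap are used than in \<open>exclusion_far\<close>.\<close>

lemma exclusion_near:
  fixes t :: real
  assumes "251/500 \<le> t" "t \<le> 11/20"
  shows "0 < (797837/500000 * t\<^sup>2 - 7287/12500 * t ^ 4 - 689/500) * (4989/5000 * t + 21/200) + 2 * t\<^sup>2 + 111/125 * t ^ 3"
proof -
  have "(797837/500000 * t\<^sup>2 - 7287/12500 * t ^ 4 - 689/500) * (4989/5000 * t + 21/200) + 2 * t\<^sup>2 + 111/125 * t ^ 3 = 2367 / 1000000 + (514666312233772657 / 497664000000000 * (11/20 - t) ^ 5
      + 1866041676650916577 / 3981312000000 * (t - 251/500) * (11/20 - t) ^ 4
      + 30422667458158493 / 15925248000 * (t - 251/500) ^ 2 * (11/20 - t) ^ 3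
      + 9330771344655361 / 3185049600 * (t - 251/500) ^ 3 * (11/20 - t) ^ 2
      + 509016425341105 / 254803968 * (t - 251/500) ^ 4 * (11/20 - t)
      + 130154090731685 / 254803968 * (t - 251/500) ^ 5)" by algebra
  also have "\<dots> > 0"
    using assms by (intro add_pos_nonneg add_nonneg_nonneg mult_nonneg_nonneg zero_le_power) auto
  finally show ?thesis .
qed

lemma exclusion_far:
  fixes t :: real
  assumes "11/20 \<le> t" "t \<le> 47/50"
  shows "0 < (797837/500000 * t\<^sup>2 - 60323/100000 * t ^ 4 - 689/500) * (1999/2000 * t + 21/200) + 2 * t\<^sup>2 + 41/50 * t ^ 3"
proof -
  have "(797837/500000 * t\<^sup>2 - 60323/100000 * t ^ 4 - 689/500) * (1999/2000 * t + 21/200) + 2 * t\<^sup>2 + 41/50 * t ^ 3 = 21439 / 200000 + (2541055020371 / 1924782912000 * (47/50 - t) ^ 5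
      + 126180550761563 / 962391456000 * (t - 11/20) * (47/50 - t) ^ 4
      + 143422171602469 / 240597864000 * (t - 11/20) ^ 2 * (47/50 - t) ^ 3
      + 3061080996905357 / 3007473300000 * (t - 11/20) ^ 3 * (47/50 - t) ^ 2
      + 11439804932575031 / 15037366500000 * (t - 11/20) ^ 4 * (47/50 - t)
      + 39218751310016087 / 187967081250000 * (t - 11/20) ^ 5)" by algebra
  also have "\<dots> > 0"
    using assms by (intro add_pos_nonneg add_nonneg_nonneg mult_nonneg_nonneg zero_le_power) auto
  finally show ?thesis .
qed

text \<open>The condition r S < 1 at tp, times the barrier denominator, with S bounded from
  infinity. At the left end of this range the bound from the origin used in
  \<open>start_inner1\<close> would be too weak.\<close>

lemma start_outer:
  fixes t :: real
  assumes "41/100 \<le> t" "t \<le> 97/200"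
  shows "0 < 99092/100000 * t + 37/500 - (21/500 + 129/500 * t - 19/500 * t\<^sup>2) * ((2 - 999/2500 * t\<^sup>2) * (99092/100000 * t + 37/500) + 2 + 227/250 * t)"
proof -
  have "99092/100000 * t + 37/500 - (21/500 + 129/500 * t - 19/500 * t\<^sup>2) * ((2 - 999/2500 * t\<^sup>2) * (99092/100000 * t + 37/500) + 2 + 227/250 * t) = 1197 / 1000000 + (430727179995246043 / 82397460937500 * (97/200 - t) ^ 5
      + 2163363246955107493 / 98876953125000 * (t - 41/100) * (97/200 - t) ^ 4
      + 3389508130681110481 / 98876953125000 * (t - 41/100) ^ 2 * (97/200 - t) ^ 3
      + 524865761423540653 / 21972656250000 * (t - 41/100) ^ 3 * (97/200 - t) ^ 2
      + 4995599242699485809 / 791015625000000 * (t - 41/100) ^ 4 * (97/200 - t)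
      + 445599268639854053 / 7910156250000000 * (t - 41/100) ^ 5)" by algebra
  also have "\<dots> > 0"
    using assms by (intro add_pos_nonneg add_nonneg_nonneg mult_nonneg_nonneg zero_le_power) auto
  finally show ?thesis .
qed

lemma start_inner1:
  fixes t :: real
  assumes "97/200 \<le> t" "t \<le> 49/100"
  shows "0 < t\<^sup>2 - (21/500 + 129/500 * t - 19/500 * t\<^sup>2) * (689/500 + 101141/250000 * t\<^sup>2 + 159149/1000000 * t ^ 4)"
proof -
  have "t\<^sup>2 - (21/500 + 129/500 * t - 19/500 * t\<^sup>2) * (689/500 + 101141/250000 * t\<^sup>2 + 159149/1000000 * t ^ 4) = 711 / 1000000 + (2531533297128983599 / 500000000 * (49/100 - t) ^ 6
      + 26545697682651236999 / 125000000 * (t - 97/200) * (49/100 - t) ^ 5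
      + 24681205405064243633 / 25000000 * (t - 97/200) ^ 2 * (49/100 - t) ^ 4
      + 6020615686358070937 / 3125000 * (t - 97/200) ^ 3 * (49/100 - t) ^ 3
      + 11900072341279999637 / 6250000 * (t - 97/200) ^ 4 * (49/100 - t) ^ 2
      + 7388870682585443279 / 7812500 * (t - 97/200) ^ 5 * (49/100 - t)
      + 1471993680196154131 / 7812500 * (t - 97/200) ^ 6)" by algebra
  also have "\<dots> > 0"
    using assms by (intro add_pos_nonneg add_nonneg_nonneg mult_nonneg_nonneg zero_le_power) auto
  finally show ?thesis .
qed

lemma start_inner2:
  fixes t :: real
  assumes "49/100 \<le> t" "t \<le> 251/500"
  shows "0 < t\<^sup>2 - (47/1000 + 1/4 * t - 17/500 * t\<^sup>2) * (689/500 + 202333/500000 * t\<^sup>2 + 3963/25000 * t ^ 4)"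
proof -
  have "t\<^sup>2 - (47/1000 + 1/4 * t - 17/500 * t\<^sup>2) * (689/500 + 202333/500000 * t\<^sup>2 + 3963/25000 * t ^ 4) = 113 / 200000 + (263747231618857 / 12441600 * (251/500 - t) ^ 6
      + 25583942291348543 / 10368000 * (t - 49/100) * (251/500 - t) ^ 5
      + 250091983930894457 / 20736000 * (t - 49/100) ^ 2 * (251/500 - t) ^ 4
      + 1865544783813792143 / 77760000 * (t - 49/100) ^ 3 * (251/500 - t) ^ 3
      + 12424226955606451657 / 518400000 * (t - 49/100) ^ 4 * (251/500 - t) ^ 2
      + 77708848275832514143 / 6480000000 * (t - 49/100) ^ 5 * (251/500 - t)
      + 467007817574689170457 / 194400000000 * (t - 49/100) ^ 6)" by algebra
  also have "\<dots> > 0"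
    using assms by (intro add_pos_nonneg add_nonneg_nonneg mult_nonneg_nonneg zero_le_power) auto
  finally show ?thesis .
qed

text \<open>Beyond 3/2 the quadratic is replaced by its tangent line, with slope B + 3 C and
  intercept A - 9/4 C. The fractions with denominator 21 come from z <= 1/21.\<close>

lemma tail1:
  fixes t :: real
  assumes "3/2 \<le> t"
  shows "0 \<le> (129/500 + 3 * (- 19/500)) * (4 * t ^ 3 + 80/21 * t\<^sup>2 + 2 * t)
    + (21/500 - 9/4 * (- 19/500)) * (4 * t\<^sup>2 + 160/21 * t + 6) - 3 * t\<^sup>2"
proof -
  have "3/2 * t \<le> t\<^sup>2" unfolding power2_eq_square using assms by (intro mult_right_mono) auto
  then have "0 \<le> 297/17500 * t\<^sup>2 + 1216/21875 * t - 8343/125000" using assms by (simp add: field_simps)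
  moreover have "0 \<le> 72/125 * (t + 2/5) * (t - 19/10)\<^sup>2" using assms by simp
  ultimately have "0 \<le> 72/125 * (t + 2/5) * (t - 19/10)\<^sup>2 + (297/17500 * t\<^sup>2 + 1216/21875 * t - 8343/125000)" by (intro add_nonneg_nonneg)
  also have "\<dots> = (129/500 + 3 * (- 19/500)) * (4 * t ^ 3 + 80/21 * t\<^sup>2 + 2 * t)
    + (21/500 - 9/4 * (- 19/500)) * (4 * t\<^sup>2 + 160/21 * t + 6) - 3 * t\<^sup>2" by algebra
  finally show ?thesis .
qed

lemma tail2:
  fixes t :: real
  assumes "3/2 \<le> t"
  shows "0 \<le> (1/4 + 3 * (- 17/500)) * (4 * t ^ 3 + 80/21 * t\<^sup>2 + 2 * t)
    + (47/1000 - 9/4 * (- 17/500)) * (4 * t\<^sup>2 + 160/21 * t + 6) - 3 * t\<^sup>2"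
proof -
  have "3/2 * t \<le> t\<^sup>2" unfolding power2_eq_square using assms by (intro mult_right_mono) auto
  then have "0 \<le> 3707/52500 * t\<^sup>2 - 43/131250 * t - 14231/125000" using assms by (simp add: field_simps)
  moreover have "0 \<le> 74/125 * (t + 2/5) * (t - 19/10)\<^sup>2" using assms by simp
  ultimately have "0 \<le> 74/125 * (t + 2/5) * (t - 19/10)\<^sup>2 + (3707/52500 * t\<^sup>2 - 43/131250 * t - 14231/125000)" by (intro add_nonneg_nonneg)
  also have "\<dots> = (1/4 + 3 * (- 17/500)) * (4 * t ^ 3 + 80/21 * t\<^sup>2 + 2 * t)
    + (47/1000 - 9/4 * (- 17/500)) * (4 * t\<^sup>2 + 160/21 * t + 6) - 3 * t\<^sup>2" by algebra
  finally show ?thesis .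
qed

section \<open>Estimates at tp and its localisation\<close>

context ground_state begin

text \<open>By P tp = 0 this is (z tp - 1) / tp, and 1 - rho tp = kap tp^2. It is a decreasing
  function of u(tp)^2, so bounds on the two quantities feed each other.\<close>

definition kap where "kap = 1/2 - 3/100 * (u tp)\<^sup>2 - tp\<^sup>2 / 30"

lemma z_tp_kap: "z tp = 1 + kap * tp"
  using z_tp by (simp add: kap_def mult.commute)

lemma rho_tp_kap: "rho tp = 1 - kap * tp\<^sup>2"
  using rho_z[OF tp(1)] z_tp_kap by (simp add: power2_eq_square algebra_simps)

lemma kap_pos: "0 < kap"
  using tp_bounds(4) z_tp_kap tp(1) by (simp add: zero_less_mult_iff)

lemma kap_lt_half: "kap < 1/2"
  using tp_bounds(3) z_tp_kap tp(1) by simp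

lemma kap_c: "0 < kap * tp\<^sup>2" "kap * tp\<^sup>2 \<le> 1" "2 * (kap * tp\<^sup>2) \<le> tp\<^sup>2"
proof -
  have c: "0 < tp\<^sup>2" using tp(1) by simp
  show "0 < kap * tp\<^sup>2" using kap_pos c by simp
  have "kap * tp\<^sup>2 \<le> 1/2 * tp\<^sup>2" using kap_lt_half c by (intro mult_right_mono) auto
  then show "2 * (kap * tp\<^sup>2) \<le> tp\<^sup>2" "kap * tp\<^sup>2 \<le> 1" using tp_bounds(1) by auto
qed

lemma b_tp_ge: "13/10 + 3/10 * tp\<^sup>2 \<le> (u tp)\<^sup>2"
  using beta_low_near_1[of "kap * tp\<^sup>2" "tp\<^sup>2"] kap_c b_ge_beta_low[of tp] tp(1) rho_tp_kap by simp

lemma b_tp_le: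
  "(u tp)\<^sup>2 \<le> 689/500 + 21/50 * tp\<^sup>2 + kap * tp\<^sup>2 * (- 17/500 + 19/25 * tp\<^sup>2 - 229/250 * (kap * tp\<^sup>2))"
  using beta_up_near_1[of "kap * tp\<^sup>2" "tp\<^sup>2"] kap_c b_le_beta_up[of tp] tp rho_tp_kap by simp

lemma kap_le: "kap \<le> 461/1000 - 127/3000 * tp\<^sup>2"
  using b_tp_ge by (simp add: kap_def)

lemma kap_le': "kap \<le> 461/1000"
proof -
  have "0 \<le> tp\<^sup>2" by simp
  then show ?thesis using kap_le by linarith
qed

text \<open>Bootstrap step: an upper bound on u(tp)^2 gives a lower bound k1 on kap, which improves
  the upper bound on u(tp)^2 here.\<close>

lemma b_tp_le_window:
  assumes k: "k1 \<le> kap" "kap \<le> k2" and pos: "17/500 \<le> (19/25 - 229/250 * k1) * tp\<^sup>2"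
  shows "(u tp)\<^sup>2 \<le> 689/500 + 21/50 * tp\<^sup>2 + k2 * tp\<^sup>2 * (- 17/500 + (19/25 - 229/250 * k1) * tp\<^sup>2)"
proof -
  have c: "0 \<le> tp\<^sup>2" by simp
  have "k1 * tp\<^sup>2 \<le> kap * tp\<^sup>2" using k c by (intro mult_right_mono)
  then have "- 17/500 + 19/25 * tp\<^sup>2 - 229/250 * (kap * tp\<^sup>2) \<le> - 17/500 + (19/25 - 229/250 * k1) * tp\<^sup>2"
    by (simp add: algebra_simps)
  then have "kap * tp\<^sup>2 * (- 17/500 + 19/25 * tp\<^sup>2 - 229/250 * (kap * tp\<^sup>2))
      \<le> kap * tp\<^sup>2 * (- 17/500 + (19/25 - 229/250 * k1) * tp\<^sup>2)"
    using kap_c by (intro mult_left_mono) auto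
  also have "\<dots> \<le> k2 * tp\<^sup>2 * (- 17/500 + (19/25 - 229/250 * k1) * tp\<^sup>2)"
    using k pos c by (intro mult_right_mono) auto
  finally show ?thesis using b_tp_le by linarith
qed

lemma z_le: assumes "tp \<le> t" "kap \<le> k" shows "z t \<le> 1 + k * tp" "z t \<le> 1 + k * t"
proof -
  have "kap * tp \<le> k * tp" using assms tp(1) by (intro mult_right_mono) auto
  moreover have "k * tp \<le> k * t" using assms kap_pos by (intro mult_left_mono) auto
  ultimately show "z t \<le> 1 + k * tp" "z t \<le> 1 + k * t"
    using z_le_tp[OF assms(1)] z_tp_kap by auto
qed

lemma K_low:
  assumes "tp \<le> t" "41/100 \<le> t"
  shows "2 * z t / (51/50 * t + 31/200 - 1/20 * z t) \<le> K t"
proof (rule K_lower_barrier[of t "51/50" "31/200" "1/4" "1/20"])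
  fix s assume s: "t \<le> s"
  then have "tp \<le> s" "0 < s" using assms tp(1) by auto
  then show "1/4 \<le> 51/50 * s + 31/200 - 1/20 * z s" using z_less_2[of s] s assms by simp
  show "0 \<le> gam (51/50) (31/200) (1/20) s (z s)"
    using gam_low_nonneg[of s "z s"] z_pos[OF \<open>0 < s\<close>] z_le(2)[OF \<open>tp \<le> s\<close> kap_le'] s assms by simp
qed (use assms in auto)

lemma b_tp_eq: "(u tp)\<^sup>2 = tp\<^sup>2 * (2 - 2 * kap\<^sup>2 * tp\<^sup>2 + K tp)"
proof -
  have "(Q tp)\<^sup>2 = 2 - 2 * kap\<^sup>2 * tp\<^sup>2 + K tp"
    unfolding K_def z_tp_kap by (simp add: power2_eq_square algebra_simps)
  then show ?thesis by (simp add: u_def power_mult_distrib)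
qed

text \<open>The lower barrier for K at tp, with its denominator cleared; each kap is replaced by the
  end of [k1, k2] that weakens the bound.\<close>

lemma b_tp_lower:
  assumes t: "41/100 \<le> tp" and k: "0 \<le> k1" "k1 \<le> kap" "kap \<le> k2" "k1 \<le> 1/2"
  shows "tp\<^sup>2 * (2 - 2 * k2\<^sup>2 * tp\<^sup>2) * ((51/50 - k1 / 20) * tp + 21/200) + 2 * tp\<^sup>2 * (1 + k1 * tp)
    \<le> (u tp)\<^sup>2 * ((51/50 - k1 / 20) * tp + 21/200)"
proof -
  define s where "s = 51/50 * tp + 31/200 - 1/20 * z tp"
  define s' where "s' = (51/50 - k1 / 20) * tp + 21/200"
  have kt: "k1 * tp \<le> kap * tp" using k tp(1) by (intro mult_right_mono) auto
  have "z tp \<le> 3/2" using kap_lt_half tp_bounds(2) tp(1) z_tp_kap mult_mono[of kap "1/2" tp 1] by simp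
  then have s: "0 < s" using t by (simp add: s_def)
  have "s \<le> s'" unfolding s_def s'_def z_tp_kap using kt by (simp add: algebra_simps)
  have "K tp \<ge> 2 * z tp / s" using K_low[of tp] t by (simp add: s_def)
  also have "2 * z tp / s \<ge> 2 * (1 + k1 * tp) / s'"
    using s \<open>s \<le> s'\<close> kt k tp(1) z_tp_kap by (intro frac_le) auto
  finally have "2 * (1 + k1 * tp) \<le> K tp * s'" using s \<open>s \<le> s'\<close> by (simp add: pos_divide_le_eq)
  then have "tp\<^sup>2 * (2 * (1 + k1 * tp)) \<le> tp\<^sup>2 * (K tp * s')" by (intro mult_left_mono) auto
  moreover have "kap\<^sup>2 \<le> k2\<^sup>2" using kap_pos k by (intro power_mono) auto
  then have "kap\<^sup>2 * tp\<^sup>2 \<le> k2\<^sup>2 * tp\<^sup>2" by (intro mult_right_mono) auto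
  then have "tp\<^sup>2 * (2 - 2 * k2\<^sup>2 * tp\<^sup>2) * s' \<le> tp\<^sup>2 * (2 - 2 * kap\<^sup>2 * tp\<^sup>2) * s'"
    using s \<open>s \<le> s'\<close> by (intro mult_right_mono mult_left_mono) auto
  moreover have "(u tp)\<^sup>2 * s' = tp\<^sup>2 * (2 - 2 * kap\<^sup>2 * tp\<^sup>2) * s' + tp\<^sup>2 * (K tp * s')"
    unfolding b_tp_eq by algebra
  ultimately show ?thesis unfolding s'_def[symmetric] by linarith
qed

text \<open>For larger tp the lower bound on u(tp)^2 from infinity would exceed the upper bound from
  the origin.\<close>

lemma tp_lt: "tp < 251/500"
proof (rule ccontr)
  assume "\<not> tp < 251/500"
  then have t: "251/500 \<le> tp" by simp
  have "(251/500)\<^sup>2 \<le> tp\<^sup>2" using t by (intro power_mono) auto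
  then have c: "252/1000 \<le> tp\<^sup>2" "tp\<^sup>2 \<le> 7/8" using tp_bounds by (auto simp: power2_eq_square)
  have "(u tp)\<^sup>2 \<le> 2" using u_tp_lt by simp
  then have k1: "41/100 \<le> kap" using c by (simp add: kap_def)
  have b: "(u tp)\<^sup>2 \<le> 689/500 + 404326/1000000 * tp\<^sup>2 + 17723/100000 * tp ^ 4"
  proof -
    have "(u tp)\<^sup>2 \<le> 689/500 + 21/50 * tp\<^sup>2 + 461/1000 * tp\<^sup>2 * (- 17/500 + (19/25 - 229/250 * (41/100)) * tp\<^sup>2)"
      using k1 kap_le' c by (intro b_tp_le_window) auto
    moreover have "461/1000 * tp\<^sup>2 * (- 17/500 + (19/25 - 229/250 * (41/100)) * tp\<^sup>2)
       = - 15674/1000000 * tp\<^sup>2 + 4430671/25000000 * tp ^ 4" by algebra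
    moreover have "0 \<le> tp ^ 4" by simp
    ultimately show ?thesis by linarith
  qed
  show False
  proof (cases "tp \<le> 11/20")
    case True
    have "tp\<^sup>2 \<le> (11/20)\<^sup>2" using True tp(1) by (intro power_mono) auto
    then have c': "tp\<^sup>2 \<le> 3025/10000" by (simp add: power2_eq_square)
    have "tp ^ 4 \<le> (11/20) ^ 4" using True tp(1) by (intro power_mono) auto
    then have "tp ^ 4 \<le> 9151/100000" by (simp add: power4_eq_xxxx)
    then have k: "111/250 \<le> kap" using b c' by (simp add: kap_def)
    have k2: "kap \<le> 4504/10000" using kap_le c by simp
    have "tp\<^sup>2 * (2 - 2 * (4504/10000)\<^sup>2 * tp\<^sup>2) * ((51/50 - 111/250 / 20) * tp + 21/200) + 2 * tp\<^sup>2 * (1 + 111/250 * tp)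
      \<le> (u tp)\<^sup>2 * ((51/50 - 111/250 / 20) * tp + 21/200)"
      using t k k2 by (intro b_tp_lower) auto
    also have "\<dots> \<le> (689/500 + 404326/1000000 * tp\<^sup>2 + 17723/100000 * tp ^ 4) * ((51/50 - 111/250 / 20) * tp + 21/200)"
      using b t by (intro mult_right_mono) auto
    finally have "tp\<^sup>2 * (2 - 2 * (4504/10000)\<^sup>2 * tp\<^sup>2) * ((51/50 - 111/250 / 20) * tp + 21/200) + 2 * tp\<^sup>2 * (1 + 111/250 * tp)
      - (689/500 + 404326/1000000 * tp\<^sup>2 + 17723/100000 * tp ^ 4) * ((51/50 - 111/250 / 20) * tp + 21/200) \<le> 0" by simp
    moreover have "tp\<^sup>2 * (2 - 2 * (4504/10000)\<^sup>2 * tp\<^sup>2) * ((51/50 - 111/250 / 20) * tp + 21/200) + 2 * tp\<^sup>2 * (1 + 111/250 * tp)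
      - (689/500 + 404326/1000000 * tp\<^sup>2 + 17723/100000 * tp ^ 4) * ((51/50 - 111/250 / 20) * tp + 21/200)
      = (797837/500000 * tp\<^sup>2 - 7287/12500 * tp ^ 4 - 689/500) * (4989/5000 * tp + 21/200) + 2 * tp\<^sup>2 + 111/125 * tp ^ 3
        + (7287/12500 - (2 * (4504/10000)\<^sup>2 + 17723/100000)) * tp ^ 4 * (4989/5000 * tp + 21/200)"
      by algebra
    moreover have "0 \<le> (7287/12500 - (2 * (4504/10000)\<^sup>2 + 17723/100000)) * tp ^ 4 * (4989/5000 * tp + 21/200)"
      using tp(1) by (intro mult_nonneg_nonneg) (auto simp: power2_eq_square)
    ultimately show False using exclusion_near[OF t True] by linarith
  next
    case False
    have "tp\<^sup>2 \<le> (47/50)\<^sup>2" using c by (simp add: power2_eq_square)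
    then have t2: "tp \<le> 47/50" by (rule power2_le_imp_le) simp
    have "tp\<^sup>2 * (2 - 2 * (461/1000)\<^sup>2 * tp\<^sup>2) * ((51/50 - 41/100 / 20) * tp + 21/200) + 2 * tp\<^sup>2 * (1 + 41/100 * tp)
      \<le> (u tp)\<^sup>2 * ((51/50 - 41/100 / 20) * tp + 21/200)"
      using t k1 kap_le' by (intro b_tp_lower) auto
    also have "\<dots> \<le> (689/500 + 404326/1000000 * tp\<^sup>2 + 17723/100000 * tp ^ 4) * ((51/50 - 41/100 / 20) * tp + 21/200)"
      using b t by (intro mult_right_mono) auto
    finally have "tp\<^sup>2 * (2 - 2 * (461/1000)\<^sup>2 * tp\<^sup>2) * ((51/50 - 41/100 / 20) * tp + 21/200) + 2 * tp\<^sup>2 * (1 + 41/100 * tp)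
      - (689/500 + 404326/1000000 * tp\<^sup>2 + 17723/100000 * tp ^ 4) * ((51/50 - 41/100 / 20) * tp + 21/200) \<le> 0" by simp
    moreover have "tp\<^sup>2 * (2 - 2 * (461/1000)\<^sup>2 * tp\<^sup>2) * ((51/50 - 41/100 / 20) * tp + 21/200) + 2 * tp\<^sup>2 * (1 + 41/100 * tp)
      - (689/500 + 404326/1000000 * tp\<^sup>2 + 17723/100000 * tp ^ 4) * ((51/50 - 41/100 / 20) * tp + 21/200)
      = (797837/500000 * tp\<^sup>2 - 60323/100000 * tp ^ 4 - 689/500) * (1999/2000 * tp + 21/200) + 2 * tp\<^sup>2 + 41/50 * tp ^ 3
        + (60323/100000 - (2 * (461/1000)\<^sup>2 + 17723/100000)) * tp ^ 4 * (1999/2000 * tp + 21/200)"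
      by algebra
    moreover have "0 \<le> (60323/100000 - (2 * (461/1000)\<^sup>2 + 17723/100000)) * tp ^ 4 * (1999/2000 * tp + 21/200)"
      using tp(1) by (intro mult_nonneg_nonneg) (auto simp: power2_eq_square)
    ultimately show False using exclusion_far[of tp] False t2 by linarith
  qed
qed

section \<open>Decay of z beyond tp\<close>

text \<open>At a contact x z = 1 the lower barrier for K makes x z decrease strictly. Starting at a
  fixed T >= tp keeps the path independent of the unknown tp.\<close>

lemma path_bound:
  fixes x dx :: "real \<Rightarrow> real"
  assumes T: "tp \<le> T" "41/100 \<le> T" and start: "x 0 * z T \<le> 1"
    and pos: "\<And>r. 0 \<le> r \<Longrightarrow> 0 < x r"
    and der: "\<And>r. (x has_real_derivative dx r) (at r)"
    and flow: "\<And>r. 0 \<le> r \<Longrightarrow> (dx r + 1 - 2 * x r) * ((51/50 * (T + r) + 31/200) * x r - 1/20) < 2 * (x r)\<^sup>2"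
    and t: "T \<le> t"
  shows "x (t - T) * z t \<le> 1"
proof -
  have "x (t - T) * z t - 1 \<le> 0"
  proof (rule no_cross[OF t, of "\<lambda>t. x (t - T) * z t - 1" "\<lambda>t. dx (t - T) * z t - x (t - T) * (z t * (2 - z t) + K t)"])
    fix s assume s: "T \<le> s" "s \<le> t"
    then have s0: "0 < s" "tp \<le> s" "41/100 \<le> s" using T by auto
    have "((\<lambda>t. x (t - T)) has_real_derivative dx (s - T)) (at s)"
    proof -
      have "((\<lambda>t. t - T) has_real_derivative 1) (at s)" by (auto intro!: derivative_eq_intros)
      from DERIV_chain'[OF this der[of "s - T"]] show ?thesis by simp
    qed
    then show "((\<lambda>t. x (t - T) * z t - 1) has_real_derivative
        dx (s - T) * z s - x (s - T) * (z s * (2 - z s) + K s)) (at s)"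
      using z_deriv[OF s0(1)] by (auto intro!: derivative_eq_intros simp: algebra_simps)
    assume "x (s - T) * z s - 1 = 0"
    then have xz: "x (s - T) * z s = 1" by simp
    define X where "X = x (s - T)"
    define S where "S = (51/50 * s + 31/200) * X - 1/20"
    have X: "0 < X" using pos[of "s - T"] s by (simp add: X_def)
    have zX: "z s = 1 / X" using xz X by (simp add: X_def field_simps)
    have sp: "0 < 51/50 * s + 31/200 - 1/20 * z s" using z_less_2[OF s0(2)] s0 by simp
    have SX: "S = X * (51/50 * s + 31/200 - 1/20 * z s)" unfolding S_def zX using X by (simp add: field_simps)
    then have S: "0 < S" using X sp by simp
    have "2 * z s / (51/50 * s + 31/200 - 1/20 * z s) = 2 / S"
    proof -
      have "2 * z s / (51/50 * s + 31/200 - 1/20 * z s) = 2 * (X * z s) / (X * (51/50 * s + 31/200 - 1/20 * z s))"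
        using X by simp
      then show ?thesis using xz SX by (simp add: X_def)
    qed
    then have "2 / S \<le> K s" using K_low[OF s0(2,3)] by simp
    then have "X * (2 / S) \<le> X * K s" using X by (intro mult_left_mono) auto
    then have "2 * X / S \<le> X * K s" by (simp add: mult.commute)
    moreover have "(dx (s - T) + 1 - 2 * X) * S < 2 * X\<^sup>2"
      using flow[of "s - T"] s by (simp add: X_def S_def)
    then have "dx (s - T) + 1 - 2 * X < 2 * X\<^sup>2 / S" using S by (simp add: pos_less_divide_eq)
    then have "(dx (s - T) + 1 - 2 * X) / X < 2 * X / S" using X S by (simp add: field_simps power2_eq_square)
    moreover have "(dx (s - T) + 1 - 2 * X) / X = dx (s - T) * z s - (2 - z s)"
      unfolding zX using X by (simp add: field_simps)
    moreover have "x (s - T) * (z s * (2 - z s) + K s) = (2 - z s) + X * K s"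
      using xz by (simp add: X_def algebra_simps)
    ultimately show "dx (s - T) * z s - x (s - T) * (z s * (2 - z s) + K s) < 0" by linarith
  qed (use start in auto)
  then show ?thesis by simp
qed

lemma zt2_window1:
  assumes "tp \<le> 49/100" "49/100 \<le> t" and path: "path1 (t - 49/100) * z t \<le> 1"
  shows "z t * t\<^sup>2 \<le> 59/200"
proof -
  define r where "r = t - 49/100"
  have r: "0 \<le> r" "t = 49/100 + r" using assms by (auto simp: r_def)
  have z: "0 < z t" using z_pos[of t] assms by simp
  have "t\<^sup>2 \<le> 59/200 * path1 r"
  proof -
    have "59/200 * path1 r - t\<^sup>2 = 121/100000 + 171/10000 * r + 1599/2000 * r\<^sup>2 + 2301/1000 * r ^ 3 + 649/500 * r ^ 4"
      unfolding path1_def r(2) by algebra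
    also have "\<dots> \<ge> 0" using r by (intro add_nonneg_nonneg mult_nonneg_nonneg) auto
    finally show ?thesis by simp
  qed
  then have "z t * t\<^sup>2 \<le> z t * (59/200 * path1 r)" using z by (intro mult_left_mono) auto
  also have "\<dots> = 59/200 * (path1 r * z t)" by simp
  also have "\<dots> \<le> 59/200 * 1" using path by (intro mult_left_mono) (auto simp: r_def)
  finally show ?thesis by simp
qed

lemma zt2_window2:
  assumes "251/500 \<le> t" and path: "path2 (t - 251/500) * z t \<le> 1"
  shows "z t * t\<^sup>2 \<le> 31/100"
proof -
  define r where "r = t - 251/500"
  have r: "0 \<le> r" "t = 251/500 + r" using assms by (auto simp: r_def)
  have z: "0 < z t" using z_pos[of t] assms by simp
  have "t\<^sup>2 \<le> 31/100 * path2 r"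
  proof -
    have "31/100 * path2 r - t\<^sup>2 = 646/1000000 + 19/1000 * r + 829/1000 * r\<^sup>2 + 93/40 * r ^ 3 + 1333/1000 * r ^ 4"
      unfolding path2_def r(2) by algebra
    also have "\<dots> \<ge> 0" using r by (intro add_nonneg_nonneg mult_nonneg_nonneg) auto
    finally show ?thesis by simp
  qed
  then have "z t * t\<^sup>2 \<le> z t * (31/100 * path2 r)" using z by (intro mult_left_mono) auto
  also have "\<dots> = 31/100 * (path2 r * z t)" by simp
  also have "\<dots> \<le> 31/100 * 1" using path by (intro mult_left_mono) (auto simp: r_def)
  finally show ?thesis by simp
qed

text \<open>What the comparison function \<^term>\<open>1 - q * S\<close> needs, for a quadratic q continued beyond 3/2 by its
  tangent line.\<close>

definition admissible :: "real \<Rightarrow> real \<Rightarrow> real \<Rightarrow> bool" where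
  "admissible A B C \<longleftrightarrow> 41/100 \<le> tp \<and> 0 \<le> A \<and> 0 \<le> B + 3 * C \<and> C \<le> 0 \<and>
    (A + B * tp + C * tp\<^sup>2) * (Q tp)\<^sup>2 < 1 \<and>
    (\<forall>t. tp \<le> t \<and> t \<le> 3/2 \<longrightarrow> 0 \<le> supersol A B C t (z t) \<and>
       B + 2 * C * t \<le> 2 * (A + B * t + C * t\<^sup>2) * (1 - z t + 1 / t)) \<and>
    (\<forall>t. 3/2 \<le> t \<longrightarrow> z t \<le> 1/21 \<and>
       0 \<le> (B + 3 * C) * (4 * t ^ 3 + 80/21 * t\<^sup>2 + 2 * t)
          + (A - 9/4 * C) * (4 * t\<^sup>2 + 160/21 * t + 6) - 3 * t\<^sup>2)"

section \<open>The comparison quadratics for the two ranges of tp\<close>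

text \<open>With \<open>tp_lt\<close>, tp lies in [49/100, 251/500), where the bound on u(tp)^2 from
  the origin alone gives the starting condition.\<close>

lemma window2:
  assumes t: "49/100 \<le> tp"
  shows "admissible (47/1000) (1/4) (- 17/500)"
proof -
  have "tp\<^sup>2 \<le> (251/500)\<^sup>2" "(49/100)\<^sup>2 \<le> tp\<^sup>2" using tp_lt tp(1) t by (auto intro!: power_mono)
  then have c: "tp\<^sup>2 \<le> 2521/10000" "24/100 \<le> tp\<^sup>2" by (auto simp: power2_eq_square)
  have k2: "kap \<le> 451/1000" using kap_le c by simp
  \<comment> \<open>First round of the bootstrap, with lower limit 0 for kap; it yields kap >=
    223/500 for the second round, in the proof of \<open>q\<close>.\<close>
  have b151: "(u tp)\<^sup>2 \<le> 151/100"
  proof -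
    have "(u tp)\<^sup>2 \<le> 689/500 + 21/50 * tp\<^sup>2 + 451/1000 * tp\<^sup>2 * (- 17/500 + (19/25 - 229/250 * 0) * tp\<^sup>2)"
      using kap_pos k2 c by (intro b_tp_le_window) auto
    moreover have "tp\<^sup>2 * tp\<^sup>2 \<le> 2521/10000 * tp\<^sup>2" using c by (intro mult_right_mono) auto
    moreover have "451/1000 * tp\<^sup>2 * (- 17/500 + (19/25 - 229/250 * 0) * tp\<^sup>2)
        = - 7667/500000 * tp\<^sup>2 + 8569/25000 * (tp\<^sup>2 * tp\<^sup>2)" by algebra
    ultimately show ?thesis using c by linarith
  qed
  then have k1: "223/500 \<le> kap" using c by (simp add: kap_def)
  have tpT: "tp \<le> 251/500" using tp_lt by simp
  have start: "path2 0 * z (251/500) \<le> 1"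
  proof -
    have "451/1000 * tp \<le> 451/1000 * (251/500)" using tpT by simp
    then have "z (251/500) \<le> 1 + 451/1000 * (251/500)" using z_le(1)[OF tpT k2] by linarith
    then show ?thesis by (simp add: path2_def)
  qed
  have path: "path2 (t - 251/500) * z t \<le> 1" if "251/500 \<le> t" for t
    by (rule path_bound[OF tpT _ start path2_pos path2_deriv path2_flow that]) auto
  have q: "(47/1000 + 1/4 * tp + (- 17/500) * tp\<^sup>2) * (Q tp)\<^sup>2 < 1"
  proof -
    have "(u tp)\<^sup>2 \<le> 689/500 + 21/50 * tp\<^sup>2 + 451/1000 * tp\<^sup>2 * (- 17/500 + (19/25 - 229/250 * (223/500)) * tp\<^sup>2)"
      using k1 k2 c by (intro b_tp_le_window) auto
    also have "451/1000 * tp\<^sup>2 * (- 17/500 + (19/25 - 229/250 * (223/500)) * tp\<^sup>2)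
        = - 7667/500000 * tp\<^sup>2 + 19813783/125000000 * tp ^ 4" by algebra
    finally have "(u tp)\<^sup>2 \<le> 689/500 + 202333/500000 * tp\<^sup>2 + 3963/25000 * tp ^ 4"
      using zero_le_power[of tp 4] tp(1) by linarith
    moreover have q0: "0 \<le> 47/1000 + 1/4 * tp - 17/500 * tp\<^sup>2" using c t by simp
    ultimately have "(47/1000 + 1/4 * tp - 17/500 * tp\<^sup>2) * (u tp)\<^sup>2
      \<le> (47/1000 + 1/4 * tp - 17/500 * tp\<^sup>2) * (689/500 + 202333/500000 * tp\<^sup>2 + 3963/25000 * tp ^ 4)"
      by (intro mult_left_mono)
    also have "\<dots> < tp\<^sup>2" using start_inner2[OF t tpT] by simp
    finally have "tp\<^sup>2 * ((47/1000 + 1/4 * tp - 17/500 * tp\<^sup>2) * (Q tp)\<^sup>2) < tp\<^sup>2 * 1"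
      by (simp add: u_def power_mult_distrib mult.left_commute)
    then show ?thesis using tp(1) by (simp only: mult_less_cancel_left_pos zero_less_power) simp
  qed
  have "0 \<le> supersol (47/1000) (1/4) (- 17/500) t (z t) \<and>
       1/4 + 2 * (- 17/500) * t \<le> 2 * (47/1000 + 1/4 * t + (- 17/500) * t\<^sup>2) * (1 - z t + 1 / t)"
    if tt: "tp \<le> t" "t \<le> 3/2" for t
  proof
    have t0: "0 < t" "49/100 \<le> t" using tt t by auto
    have zp: "0 < z t" using z_pos[OF t0(1)] .
    have z1: "z t \<le> 1 + 451/1000 * t" using z_le(2)[OF tt(1) k2] .
    show "0 \<le> supersol (47/1000) (1/4) (- 17/500) t (z t)"
    proof (cases "t \<le> 251/500")
      case True
      show ?thesis
        by (rule supersol_antimono[where Z = "1 + 451/1000 * t"])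
          (use supersol2_near[OF t0(2) True] zp z1 t0 True in auto)
    next
      case False
      define r where "r = t - 251/500"
      have r: "0 \<le> r" "r \<le> 499/500" "251/500 + r = t" using False tt by (auto simp: r_def)
      have "0 \<le> 33/10 * r + 59/10 * r ^ 2 + 15/2 * r ^ 3 + 43/10 * r ^ 4"
        using r(1) by (intro add_nonneg_nonneg mult_nonneg_nonneg) auto
      then have p: "0 < path2 r" "4/5 \<le> path2 r" unfolding path2_def by linarith+
      have "z t \<le> 1 / path2 r" using path[of t] False p by (simp add: r_def field_simps)
      moreover have "1 / path2 r \<le> 1 / (4/5)" using p by (intro divide_left_mono) auto
      moreover have "0 \<le> supersol (47/1000) (1/4) (- 17/500) t (1 / path2 r)"
        using supersol2_path[OF r(1,2)] unfolding r(3) .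
      ultimately show ?thesis using zp t0 p
        by - (rule supersol_antimono[where Z = "1 / path2 r"], auto)
    qed
    have q0: "0 \<le> 47/1000 + 1/4 * t + (- 17/500) * t\<^sup>2" "1/4 + 2 * (- 17/500) * t \<le> 2 * (47/1000 + 1/4 * t + (- 17/500) * t\<^sup>2)"
    proof -
      have t2: "t\<^sup>2 \<le> 3/2 * t" unfolding power2_eq_square using tt t0 by (intro mult_right_mono) auto
      then show "0 \<le> 47/1000 + 1/4 * t + (- 17/500) * t\<^sup>2" using t0 by linarith
      show "1/4 + 2 * (- 17/500) * t \<le> 2 * (47/1000 + 1/4 * t + (- 17/500) * t\<^sup>2)" using t2 t0 by (simp add: field_simps)
    qed
    \<comment> \<open>Equivalent to z t * t <= 1; it reduces the slope condition to r' <= 2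
      r.\<close>
    have "1 \<le> 1 - z t + 1 / t"
    proof (cases "t \<le> 251/500")
      case True
      have "z t * t \<le> (1 + 451/1000 * t) * t" using z1 t0 by (intro mult_right_mono) auto
      also have "\<dots> \<le> (1 + 451/1000 * (251/500)) * (251/500)" using True t0 by (intro mult_mono) auto
      also have "\<dots> \<le> 1" by simp
      finally show ?thesis using t0 by (simp add: field_simps)
    next
      case False
      have "z t * t\<^sup>2 \<le> 31/100" using zt2_window2[of t] path[of t] False by simp
      then have "z t * t\<^sup>2 \<le> 1 * t" using t0 by simp
      then have "z t * t \<le> 1" using t0 by (simp add: power2_eq_square)
      then show ?thesis using t0 by (simp add: field_simps)
    qed
    then have "2 * (47/1000 + 1/4 * t + (- 17/500) * t\<^sup>2) * 1 \<le> 2 * (47/1000 + 1/4 * t + (- 17/500) * t\<^sup>2) * (1 - z t + 1 / t)"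
      using q0 by (intro mult_left_mono) auto
    then show "1/4 + 2 * (- 17/500) * t \<le> 2 * (47/1000 + 1/4 * t + (- 17/500) * t\<^sup>2) * (1 - z t + 1 / t)"
      using q0 by simp
  qed
  moreover have "z t \<le> 1/21" if "3/2 \<le> t" for t
  proof -
    have "z (3/2) * 21 \<le> z (3/2) * path2 (499/500)"
      using z_pos[of "3/2"] by (intro mult_left_mono) (auto simp: path2_def power2_eq_square power3_eq_cube power4_eq_xxxx)
    also have "\<dots> \<le> 1" using path[of "3/2"] by (simp add: mult.commute)
    finally show ?thesis using z_mono[of "3/2" t] tpT that by simp
  qed
  ultimately show ?thesis unfolding admissible_def using q t tail2 by auto
qed

lemma window1:
  assumes tpT: "tp \<le> 49/100"
  shows "admissible (21/500) (129/500) (- 19/500)"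
proof -
  have "tp\<^sup>2 \<le> (49/100)\<^sup>2" using tpT tp(1) by (intro power_mono) auto
  then have c: "tp\<^sup>2 \<le> 2401/10000" by (simp add: power2_eq_square)
  have kt: "kap \<le> 227/500" if "41/100 \<le> tp"
  proof -
    have "(41/100)\<^sup>2 \<le> tp\<^sup>2" using that by (intro power_mono) auto
    then show ?thesis using kap_le by (simp add: power2_eq_square)
  qed
  \<comment> \<open>The bound tp >= 41/100 is derived below from \<open>path\<close>, which depends
    on this estimate, so smaller tp must be treated here with the coarser limit for kap.\<close>
  have "kap * tp \<le> 227/500 * (49/100)"
  proof (cases "41/100 \<le> tp")
    case True
    then show ?thesis using kt tpT kap_pos tp(1) by (intro mult_mono) auto
  next
    case False
    then have "kap * tp \<le> 461/1000 * (41/100)" using kap_le' kap_pos tp(1) by (intro mult_mono) auto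
    then show ?thesis by simp
  qed
  then have "z (49/100) \<le> 1 + 227/500 * (49/100)" using z_le(1)[OF tpT order_refl] by linarith
  then have start: "path1 0 * z (49/100) \<le> 1" by (simp add: path1_def)
  have path: "path1 (t - 49/100) * z t \<le> 1" if "49/100 \<le> t" for t
    by (rule path_bound[OF tpT _ start path1_pos path1_deriv path1_flow that]) auto
  have zt2: "z t * t\<^sup>2 \<le> 59/200" if "49/100 \<le> t" for t
    using zt2_window1[OF tpT that path[OF that]] .
  have t: "41/100 \<le> tp"
  proof (rule ccontr)
    assume "\<not> 41/100 \<le> tp"
    then have lt: "tp < 41/100" by simp
    \<comment> \<open>The coarse barrier gives u(tp)^2 <= 3 tp^2 + 2 tp, too small for the lower
      bound 13/10 + 3/10 tp^2 from the origin when tp < 41/100.\<close>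
    have "K tp \<le> 2 * z tp / (1 * tp + 0 - 0 * z tp)"
    proof (rule K_upper_barrier)
      fix s assume s: "tp \<le> s"
      then have s0: "0 < s" using tp(1) by simp
      then show "0 < 1 * s + 0 - 0 * z s" by simp
      have "z s * s \<le> 1"
      proof (cases "49/100 \<le> s")
        case True
        have "z s * s\<^sup>2 \<le> 1 * s" using zt2[OF True] True by simp
        then show ?thesis using s0 by (simp add: power2_eq_square)
      next
        case False
        have "z s * s \<le> (1 + 461/1000 * s) * s" using z_le(2)[OF s kap_le'] s0 by (intro mult_right_mono) auto
        also have "\<dots> \<le> (1 + 461/1000 * (49/100)) * (49/100)" using False s0 by (intro mult_mono) auto
        finally show ?thesis by simp
      qed
      then show "gam 1 0 0 s (z s) \<le> 0" unfolding gam_crude by (simp add: mult_nonneg_nonpos)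
    qed auto
    then have "tp * K tp \<le> 2 * z tp" using tp(1) by (simp add: field_simps)
    then have "tp * (tp * K tp) \<le> tp * (2 * z tp)" using tp(1) by (intro mult_left_mono) auto
    moreover have "tp * (2 * z tp) = 2 * tp + 2 * (kap * tp\<^sup>2)" unfolding z_tp_kap by algebra
    moreover have "(u tp)\<^sup>2 = 2 * tp\<^sup>2 - 2 * (kap * tp\<^sup>2)\<^sup>2 + tp * (tp * K tp)" unfolding b_tp_eq by algebra
    moreover have "0 \<le> (kap * tp\<^sup>2)\<^sup>2" by simp
    moreover have "tp\<^sup>2 \<le> (41/100)\<^sup>2" using lt tp(1) by (intro power_mono) auto
    then have "tp\<^sup>2 \<le> 1681/10000" by (simp add: power2_eq_square)
    ultimately show False using b_tp_ge kap_c(3) lt by linarith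
  qed
  have "(41/100)\<^sup>2 \<le> tp\<^sup>2" using t by (intro power_mono) auto
  then have c': "168/1000 \<le> tp\<^sup>2" by (simp add: power2_eq_square)
  note k2 = kt[OF t]
  have "(u tp)\<^sup>2 \<le> 149504/100000"
  proof -
    have "(u tp)\<^sup>2 \<le> 689/500 + 21/50 * tp\<^sup>2 + 227/500 * tp\<^sup>2 * (- 17/500 + (19/25 - 229/250 * 0) * tp\<^sup>2)"
      using kap_pos k2 c' by (intro b_tp_le_window) auto
    moreover have "tp\<^sup>2 * tp\<^sup>2 \<le> 2401/10000 * tp\<^sup>2" using c by (intro mult_right_mono) auto
    moreover have "227/500 * tp\<^sup>2 * (- 17/500 + (19/25 - 229/250 * 0) * tp\<^sup>2)
        = - 3859/250000 * tp\<^sup>2 + 4313/12500 * (tp\<^sup>2 * tp\<^sup>2)" by algebra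
    ultimately show ?thesis using c by linarith
  qed
  then have k1: "447/1000 \<le> kap" using c by (simp add: kap_def)
  have q0: "0 \<le> 21/500 + 129/500 * tp - 19/500 * tp\<^sup>2" using c t by simp
  \<comment> \<open>For tp <= 97/200 the value of S at tp is bounded from infinity, for larger tp
    from the origin.\<close>
  have q: "(21/500 + 129/500 * tp + (- 19/500) * tp\<^sup>2) * (Q tp)\<^sup>2 < 1"
  proof (cases "tp \<le> 97/200")
    case True
    define s where "s = 99092/100000 * tp + 37/500"
    have s: "0 < s" using tp(1) by (simp add: s_def)
    have "K tp \<le> 2 * z tp / (1 * tp + 47/500 - 1/50 * z tp)"
    proof (rule K_upper_barrier)
      fix r assume r: "tp \<le> r"
      then have r0: "0 < r" "41/100 \<le> r" using tp(1) t by auto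
      then show "0 < 1 * r + 47/500 - 1/50 * z r" using z_less_2[OF r] by simp
      show "gam 1 (47/500) (1/50) r (z r) \<le> 0"
        using gam_up_nonpos[OF r0(2), of "z r"] z_pos[OF r0(1)] z_le(2)[OF r kap_le'] zt2[of r]
        by (cases "r \<le> 49/100") auto
    qed auto
    also have "\<dots> \<le> 2 * (1 + 227/500 * tp) / s"
    proof (rule frac_le)
      have "kap * tp \<le> 227/500 * tp" using k2 tp(1) by (intro mult_right_mono) auto
      then show "2 * z tp \<le> 2 * (1 + 227/500 * tp)" "s \<le> 1 * tp + 47/500 - 1/50 * z tp"
        unfolding z_tp_kap s_def by (simp_all add: field_simps)
    qed (use s tp(1) in auto)
    finally have K: "K tp * s \<le> 2 * (1 + 227/500 * tp)" using s by (simp add: pos_le_divide_eq)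
    have "(447/1000)\<^sup>2 \<le> kap\<^sup>2" using k1 by (intro power_mono) auto
    then have "999/5000 \<le> kap\<^sup>2" by (simp add: power2_eq_square)
    then have "999/5000 * tp\<^sup>2 \<le> kap\<^sup>2 * tp\<^sup>2" by (intro mult_right_mono) auto
    then have "(2 - 2 * kap\<^sup>2 * tp\<^sup>2) * s \<le> (2 - 999/2500 * tp\<^sup>2) * s" using s by (intro mult_right_mono) auto
    from add_mono[OF this K]
    have "(2 - 2 * kap\<^sup>2 * tp\<^sup>2) * s + K tp * s \<le> (2 - 999/2500 * tp\<^sup>2) * s + 2 + 227/250 * tp" by simp
    moreover have "(Q tp)\<^sup>2 * s = (2 - 2 * kap\<^sup>2 * tp\<^sup>2) * s + K tp * s"
      unfolding K_def z_tp_kap by algebra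
    ultimately have "(Q tp)\<^sup>2 * s \<le> (2 - 999/2500 * tp\<^sup>2) * s + 2 + 227/250 * tp" by (simp only:)
    then have "(21/500 + 129/500 * tp - 19/500 * tp\<^sup>2) * ((Q tp)\<^sup>2 * s)
      \<le> (21/500 + 129/500 * tp - 19/500 * tp\<^sup>2) * ((2 - 999/2500 * tp\<^sup>2) * s + 2 + 227/250 * tp)"
      using q0 by (intro mult_left_mono)
    also have "\<dots> < s" using start_outer[OF t True] by (simp add: s_def)
    finally have "s * ((21/500 + 129/500 * tp - 19/500 * tp\<^sup>2) * (Q tp)\<^sup>2) < s * 1" by (simp add: mult_ac)
    then show ?thesis using s by (simp only: mult_less_cancel_left_pos) simp
  next
    case False
    then have t': "97/200 \<le> tp" by simp
    have "(u tp)\<^sup>2 \<le> 689/500 + 21/50 * tp\<^sup>2 + 227/500 * tp\<^sup>2 * (- 17/500 + (19/25 - 229/250 * (447/1000)) * tp\<^sup>2)"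
      using k1 k2 c' by (intro b_tp_le_window) auto
    also have "227/500 * tp\<^sup>2 * (- 17/500 + (19/25 - 229/250 * (447/1000)) * tp\<^sup>2)
        = - 3859/250000 * tp\<^sup>2 + 19893599/125000000 * tp ^ 4" by algebra
    finally have "(u tp)\<^sup>2 \<le> 689/500 + 101141/250000 * tp\<^sup>2 + 159149/1000000 * tp ^ 4"
      using zero_le_power[of tp 4] tp(1) by linarith
    then have "(21/500 + 129/500 * tp - 19/500 * tp\<^sup>2) * (u tp)\<^sup>2
      \<le> (21/500 + 129/500 * tp - 19/500 * tp\<^sup>2) * (689/500 + 101141/250000 * tp\<^sup>2 + 159149/1000000 * tp ^ 4)"
      using q0 by (intro mult_left_mono)
    also have "\<dots> < tp\<^sup>2" using start_inner1[OF t' tpT] by simp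
    finally have "tp\<^sup>2 * ((21/500 + 129/500 * tp - 19/500 * tp\<^sup>2) * (Q tp)\<^sup>2) < tp\<^sup>2 * 1"
      by (simp add: u_def power_mult_distrib mult.left_commute)
    then show ?thesis using tp(1) by (simp only: mult_less_cancel_left_pos zero_less_power) simp
  qed
  have "0 \<le> supersol (21/500) (129/500) (- 19/500) t (z t) \<and>
       129/500 + 2 * (- 19/500) * t \<le> 2 * (21/500 + 129/500 * t + (- 19/500) * t\<^sup>2) * (1 - z t + 1 / t)"
    if tt: "tp \<le> t" "t \<le> 3/2" for t
  proof
    have t0: "0 < t" "41/100 \<le> t" using tt t by auto
    have zp: "0 < z t" using z_pos[OF t0(1)] .
    have z1: "z t \<le> 1 + 227/500 * t" using z_le(2)[OF tt(1) k2] .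
    show "0 \<le> supersol (21/500) (129/500) (- 19/500) t (z t)"
    proof (cases "t \<le> 49/100")
      case True
      show ?thesis
        by (rule supersol_antimono[where Z = "1 + 227/500 * t"])
          (use supersol1_near[OF t0(2) True] zp z1 t0 True in auto)
    next
      case False
      define r where "r = t - 49/100"
      have r: "0 \<le> r" "r \<le> 101/100" "49/100 + r = t" using False tt by (auto simp: r_def)
      have "0 \<le> 169/50 * r + 61/10 * r ^ 2 + 39/5 * r ^ 3 + 22/5 * r ^ 4"
        using r(1) by (intro add_nonneg_nonneg mult_nonneg_nonneg) auto
      then have p: "0 < path1 r" "4/5 \<le> path1 r" unfolding path1_def by linarith+
      have "z t \<le> 1 / path1 r" using path[of t] False p by (simp add: r_def field_simps)
      moreover have "1 / path1 r \<le> 1 / (4/5)" using p by (intro divide_left_mono) auto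
      moreover have "0 \<le> supersol (21/500) (129/500) (- 19/500) t (1 / path1 r)"
        using supersol1_path[OF r(1,2)] unfolding r(3) .
      ultimately show ?thesis using zp t0 p
        by - (rule supersol_antimono[where Z = "1 / path1 r"], auto)
    qed
    have q0: "0 \<le> 21/500 + 129/500 * t + (- 19/500) * t\<^sup>2" "129/500 + 2 * (- 19/500) * t \<le> 2 * (21/500 + 129/500 * t + (- 19/500) * t\<^sup>2)"
    proof -
      have t2: "t\<^sup>2 \<le> 3/2 * t" unfolding power2_eq_square using tt t0 by (intro mult_right_mono) auto
      then show "0 \<le> 21/500 + 129/500 * t + (- 19/500) * t\<^sup>2" using t0 by linarith
      show "129/500 + 2 * (- 19/500) * t \<le> 2 * (21/500 + 129/500 * t + (- 19/500) * t\<^sup>2)" using t2 t0 by (simp add: field_simps)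
    qed
    have "1 \<le> 1 - z t + 1 / t"
    proof (cases "t \<le> 49/100")
      case True
      have "z t * t \<le> (1 + 227/500 * t) * t" using z1 t0 by (intro mult_right_mono) auto
      also have "\<dots> \<le> (1 + 227/500 * (49/100)) * (49/100)" using True t0 by (intro mult_mono) auto
      also have "\<dots> \<le> 1" by simp
      finally show ?thesis using t0 by (simp add: field_simps)
    next
      case False
      have "z t * t\<^sup>2 \<le> 59/200" using zt2_window1[OF tpT _ path[of t]] False by simp
      then have "z t * t\<^sup>2 \<le> 1 * t" using t0 by simp
      then have "z t * t \<le> 1" using t0 by (simp add: power2_eq_square)
      then show ?thesis using t0 by (simp add: field_simps)
    qed
    then have "2 * (21/500 + 129/500 * t + (- 19/500) * t\<^sup>2) * 1 \<le> 2 * (21/500 + 129/500 * t + (- 19/500) * t\<^sup>2) * (1 - z t + 1 / t)"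
      using q0 by (intro mult_left_mono) auto
    then show "129/500 + 2 * (- 19/500) * t \<le> 2 * (21/500 + 129/500 * t + (- 19/500) * t\<^sup>2) * (1 - z t + 1 / t)"
      using q0 by simp
  qed
  moreover have "z t \<le> 1/21" if "3/2 \<le> t" for t
  proof -
    have "z (3/2) * 21 \<le> z (3/2) * path1 (101/100)"
      using z_pos[of "3/2"] by (intro mult_left_mono) (auto simp: path1_def power2_eq_square power3_eq_cube power4_eq_xxxx)
    also have "\<dots> \<le> 1" using path[of "3/2"] by (simp add: mult.commute)
    finally show ?thesis using z_mono[of "3/2" t] tpT that by simp
  qed
  ultimately show ?thesis unfolding admissible_def using q t tail1 by auto
qed

end

section \<open>A supersolution on the outer half-line\<close>

text \<open>The exceptional point is the junction 3/2, where the comparison function is only C^1 and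
  the Wronskian may fail to be differentiable.\<close>

lemma increasing_except_one_point:
  fixes f :: "real \<Rightarrow> real"
  assumes "a \<le> b" and cont: "continuous_on {a..b} f"
    and der: "\<And>x. a < x \<Longrightarrow> x < b \<Longrightarrow> x \<noteq> c \<Longrightarrow> \<exists>y. (f has_real_derivative y) (at x) \<and> 0 \<le> y"
  shows "f a \<le> f b"
proof (cases "a < c \<and> c < b")
  case True
  have "f a \<le> f c"
  proof (rule DERIV_nonneg_imp_increasing_open[of a c f])
    show "continuous_on {a..c} f" by (rule continuous_on_subset[OF cont]) (use True in auto)
  qed (use True der in auto)
  also have "f c \<le> f b"
  proof (rule DERIV_nonneg_imp_increasing_open[of c b f])
    show "continuous_on {c..b} f" by (rule continuous_on_subset[OF cont]) (use True in auto)
  qed (use True der in auto)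
  finally show ?thesis .
next
  case False
  show ?thesis by (rule DERIV_nonneg_imp_increasing_open[OF assms(1) _ cont]) (use False der in force)
qed

text \<open>The Wronskian f' w - f w' starts at w 0 >= m and does not decrease while f > 0. Hence
  (f/w)' >= m / w^2 >= m by w <= 1, and f >= m t w >= m^2 t. The bound for f/w at a first zero of f
  also excludes such a zero.\<close>

lemma sturm_growth:
  fixes f df w dw ddw V :: "real \<Rightarrow> real"
  assumes fc: "continuous_on {0..} f" "continuous_on {0..} df"
    and wc: "continuous_on {0..} w" "continuous_on {0..} dw"
    and fd: "\<And>t. 0 < t \<Longrightarrow> (f has_real_derivative df t) (at t)"
      "\<And>t. 0 < t \<Longrightarrow> (df has_real_derivative - (V t * f t)) (at t)"
    and wd: "\<And>t. 0 < t \<Longrightarrow> t \<noteq> c \<Longrightarrow> (w has_real_derivative dw t) (at t)"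
      "\<And>t. 0 < t \<Longrightarrow> t \<noteq> c \<Longrightarrow> (dw has_real_derivative ddw t) (at t)"
    and super: "\<And>t. 0 < t \<Longrightarrow> t \<noteq> c \<Longrightarrow> ddw t + V t * w t \<le> 0"
    and init: "f 0 = 0" "df 0 = 1"
    and bds: "0 < m" "\<And>t. 0 \<le> t \<Longrightarrow> m \<le> w t" "\<And>t. 0 \<le> t \<Longrightarrow> w t \<le> 1"
    and t: "0 < t"
  shows "m\<^sup>2 * t \<le> f t"
proof -
  let ?W = "\<lambda>t. df t * w t - f t * dw t"
  have wpos: "0 < w t" if "0 \<le> t" for t using bds(1) bds(2)[OF that] by simp
  have W: "m \<le> ?W s" if s: "0 \<le> s" and pos: "\<And>x. 0 < x \<Longrightarrow> x < s \<Longrightarrow> 0 < f x" for s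
  proof -
    have "?W 0 \<le> ?W s"
    proof (rule increasing_except_one_point[OF s, of ?W c])
      show "continuous_on {0..s} ?W"
        by (intro continuous_intros continuous_on_subset[OF fc(1)] continuous_on_subset[OF fc(2)]
            continuous_on_subset[OF wc(1)] continuous_on_subset[OF wc(2)]) auto
      fix x assume x: "0 < x" "x < s" "x \<noteq> c"
      have "(?W has_real_derivative - (f x * (ddw x + V x * w x))) (at x)"
        by (rule DERIV_cong, (rule derivative_intros fd[OF x(1)] wd[OF x(1,3)])+) (simp add: algebra_simps)
      moreover have "f x * (ddw x + V x * w x) \<le> 0"
        using pos[OF x(1,2)] super[OF x(1,3)] by (intro mult_nonneg_nonpos) auto
      ultimately show "\<exists>y. (?W has_real_derivative y) (at x) \<and> 0 \<le> y"
        by (intro exI[of _ "- (f x * (ddw x + V x * w x))"]) simp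
    qed
    then show ?thesis using init bds(2)[of 0] by simp
  qed
  have ratio: "m * s \<le> f s / w s" if s: "0 \<le> s" and pos: "\<And>x. 0 < x \<Longrightarrow> x < s \<Longrightarrow> 0 < f x" for s
  proof -
    have "f 0 / w 0 - m * 0 \<le> f s / w s - m * s"
    proof (rule increasing_except_one_point[OF s, of "\<lambda>x. f x / w x - m * x" c])
      show "continuous_on {0..s} (\<lambda>x. f x / w x - m * x)"
        by (intro continuous_intros continuous_on_subset[OF fc(1)] continuous_on_subset[OF wc(1)])
          (use wpos in force)+
      fix x assume x: "0 < x" "x < s" "x \<noteq> c"
      have w0: "0 < w x" "w x \<le> 1" using wpos[of x] bds(3)[of x] x by auto
      have "((\<lambda>x. f x / w x - m * x) has_real_derivative ?W x / (w x * w x) - m) (at x)"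
        using w0 fd(1)[OF x(1)] wd(1)[OF x(1,3)]
        by (auto intro!: derivative_eq_intros)
      moreover have "m \<le> ?W x" using W[of x] pos x by auto
      moreover have "w x * w x \<le> 1" using w0 by (simp add: mult_le_one)
      then have "m * (w x * w x) \<le> m * 1" using bds(1) by (intro mult_left_mono) auto
      ultimately have "m \<le> ?W x / (w x * w x)" using w0 by (simp add: pos_le_divide_eq)
      then show "\<exists>y. ((\<lambda>x. f x / w x - m * x) has_real_derivative y) (at x) \<and> 0 \<le> y"
        using \<open>((\<lambda>x. f x / w x - m * x) has_real_derivative ?W x / (w x * w x) - m) (at x)\<close>
        by (intro exI[of _ "?W x / (w x * w x) - m"]) simp
    qed
    then show ?thesis using init by simp
  qed
  have "(df \<longlongrightarrow> df 0) (at 0 within {0..})" using fc(2) by (auto simp: continuous_on_def)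
  then have "eventually (\<lambda>x. 0 < df x) (at 0 within {0..})" using init(2) by (intro order_tendstoD(1)) auto
  then obtain d where d: "0 < d" "\<And>x. 0 \<le> x \<Longrightarrow> x \<noteq> 0 \<Longrightarrow> dist x 0 < d \<Longrightarrow> 0 < df x"
    by (auto simp: eventually_at)
  have near: "0 < f x" if x: "0 < x" "x < d" for x
  proof -
    have "f 0 < f x"
    proof (rule DERIV_pos_imp_increasing_open[OF x(1)])
      show "\<exists>y. (f has_real_derivative y) (at r) \<and> 0 < y" if "0 < r" "r < x" for r
        using fd(1)[of r] d(2)[of r] that x by auto
      show "continuous_on {0..x} f" by (rule continuous_on_subset[OF fc(1)]) auto
    qed
    then show ?thesis using init by simp
  qed
  have pos: "0 < f x" if x: "0 < x" for x
  proof (rule ccontr)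
    assume neg: "\<not> 0 < f x"
    define e where "e = min (d / 2) x"
    have e: "0 < e" "e \<le> x" "e < d" using d(1) x by (auto simp: e_def min_def)
    have "continuous_on {e..x} f" by (rule continuous_on_subset[OF fc(1)]) (use e in auto)
    then obtain s where s: "e < s" "s \<le> x" "f s = 0" "\<And>r. e \<le> r \<Longrightarrow> r < s \<Longrightarrow> 0 < f r"
      using first_zero[of e x f] near[of e] e neg by (metis not_less)
    have "m * s \<le> f s / w s"
    proof (rule ratio)
      fix r assume "0 < r" "r < s"
      then show "0 < f r" using near[of r] s(4)[of r] e by (cases "e \<le> r") auto
    qed (use s e in simp)
    then show False using s e bds(1) by (simp add: mult_le_0_iff)
  qed
  have "m * t \<le> f t / w t" using ratio[of t] pos t by simp
  then have "m * t * w t \<le> f t" using wpos[of t] t by (simp add: pos_le_divide_eq)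
  moreover have "m * t * m \<le> m * t * w t" using bds(1) bds(2)[of t] t by (intro mult_left_mono) auto
  ultimately show ?thesis by (simp add: power2_eq_square mult_ac)
qed

context ground_state begin

lemma admissible_exists: obtains A B C where "admissible A B C"
  using window1 window2 by (metis linear)

context
  fixes A B C assumes adm: "admissible A B C"
begin

text \<open>The last term cancels the curvature beyond 3/2 and leaves the tangent line, in one C^1
  formula.\<close>

definition qq where "qq t = A + B * t + C * t\<^sup>2 - C * (max 0 (t - 3/2))\<^sup>2"
definition dqq where "dqq t = B + 2 * C * t - 2 * C * max 0 (t - 3/2)"
definition w where "w t = 1 - qq t * (Q t)\<^sup>2"
definition dw where "dw t = (Q t)\<^sup>2 * (2 * qq t * (1 - z t + 1 / t) - dqq t)"
definition ddq where "ddq t = (if t \<le> 3/2 then 2 * C else 0)"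
text \<open>Away from 3/2, w'' + 3 S w = - S \<open>defect\<close>: dividing by S leaves an
  expression in t, z and K, and w is a supersolution where it is nonnegative.\<close>

definition defect where
  "defect t = ddq t - 4 * (1 - z t + 1 / t) * dqq t + qq t * (4 + K t + 8 * (1 - z t) / t + 6 / t\<^sup>2) - 3"

lemma qq_low: "t \<le> 3/2 \<Longrightarrow> qq t = A + B * t + C * t\<^sup>2 \<and> dqq t = B + 2 * C * t"
  by (simp add: qq_def dqq_def max_def)

lemma qq_high: assumes "3/2 \<le> t" shows "qq t = (A - 9/4 * C) + (B + 3 * C) * t \<and> dqq t = B + 3 * C"
proof -
  have "max 0 (t - 3/2) = t - 3/2" using assms by simp
  then show ?thesis unfolding qq_def dqq_def by (simp add: power2_eq_square algebra_simps)
qed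

lemma qq_deriv:
  assumes "t \<noteq> 3/2"
  shows "(qq has_real_derivative dqq t) (at t)" "(dqq has_real_derivative ddq t) (at t)"
proof -
  have "(qq has_real_derivative dqq t) (at t) \<and> (dqq has_real_derivative ddq t) (at t)"
  proof (cases "t < 3/2")
    case True
    have "((\<lambda>t. A + B * t + C * t\<^sup>2) has_real_derivative dqq t) (at t)"
      using qq_low[of t] True by (auto intro!: derivative_eq_intros)
    moreover have "((\<lambda>t. B + 2 * C * t) has_real_derivative ddq t) (at t)"
      using True by (auto intro!: derivative_eq_intros simp: ddq_def)
    ultimately show ?thesis using True qq_low
      by (auto intro: has_field_derivative_transform_within_open[of _ _ _ "{..<3/2}"])
  next
    case False
    then have t: "3/2 < t" using assms by simp
    have "((\<lambda>t. (A - 9/4 * C) + (B + 3 * C) * t) has_real_derivative dqq t) (at t)"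
      using qq_high[of t] t by (auto intro!: derivative_eq_intros)
    moreover have "((\<lambda>t. B + 3 * C) has_real_derivative ddq t) (at t)"
      using t by (auto intro!: derivative_eq_intros simp: ddq_def)
    ultimately show ?thesis using t qq_high
      by (auto intro: has_field_derivative_transform_within_open[of _ _ _ "{3/2<..}"])
  qed
  then show "(qq has_real_derivative dqq t) (at t)" "(dqq has_real_derivative ddq t) (at t)" by auto
qed

lemma w_deriv: assumes "0 < t" "t \<noteq> 3/2" shows "(w has_real_derivative dw t) (at t)"
  unfolding w_def[abs_def] dw_def
  by (rule DERIV_cong, (rule derivative_intros qq_deriv(1)[OF assms(2)] S_deriv[OF assms(1)])+)
    (simp add: algebra_simps)

lemma dw_deriv:
  assumes "0 < t" "t \<noteq> 3/2"
  shows "(dw has_real_derivative - ((Q t)\<^sup>2 * (defect t + 3 * w t))) (at t)"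
proof -
  define y where "y = 1 / t"
  have y: "((\<lambda>t. 1 / t) has_real_derivative - y\<^sup>2) (at t)"
    using assms(1) by (auto intro!: derivative_eq_intros simp: y_def power2_eq_square)
  have S: "(Q t)\<^sup>2 = 2 * z t * (2 - z t) + K t" by (simp add: K_def)
  have "(dw has_real_derivative 2 * (Q t)\<^sup>2 * (z t - 1 - y) * (2 * qq t * (1 - z t + y) - dqq t)
     + (Q t)\<^sup>2 * (2 * dqq t * (1 - z t + y) + 2 * qq t * (z t * (2 - z t) + K t - y\<^sup>2) - ddq t)) (at t)"
    unfolding dw_def[abs_def]
    by (rule DERIV_cong, (rule derivative_intros S_deriv[OF assms(1)] qq_deriv[OF assms(2)] z_deriv[OF assms(1)] y)+)
      (simp add: y_def algebra_simps)
  moreover have "2 * s * (zz - 1 - y) * (2 * q * (1 - zz + y) - dq)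
     + s * (2 * dq * (1 - zz + y) + 2 * q * (zz * (2 - zz) + k - y\<^sup>2) - dd)
    = - (s * (dd - 4 * (1 - zz + y) * dq + q * (4 + k + 8 * (1 - zz) * y + 6 * y\<^sup>2) - 3 + 3 * (1 - q * s)))"
    if "s = 2 * zz * (2 - zz) + k" for s zz q dq dd k
    using that by algebra
  from this[OF S, of "qq t" "dqq t" "ddq t"]
  have "2 * (Q t)\<^sup>2 * (z t - 1 - y) * (2 * qq t * (1 - z t + y) - dqq t)
     + (Q t)\<^sup>2 * (2 * dqq t * (1 - z t + y) + 2 * qq t * (z t * (2 - z t) + K t - y\<^sup>2) - ddq t)
    = - ((Q t)\<^sup>2 * (defect t + 3 * w t))"
    unfolding defect_def w_def y_def by (simp add: power_one_over)
  ultimately show ?thesis by simp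
qed

lemma qq_nonneg: assumes "0 \<le> t" shows "0 \<le> qq t"
proof (cases "t \<le> 3/2")
  case True
  have "0 \<le> t * (B + C * t)"
  proof -
    have "C * (3/2) \<le> C * t" using adm True by (intro mult_left_mono_neg) (auto simp: admissible_def)
    then show ?thesis using assms adm by (intro mult_nonneg_nonneg) (auto simp: admissible_def)
  qed
  then show ?thesis using qq_low[OF True] adm by (simp add: admissible_def power2_eq_square algebra_simps)
next
  case False
  then show ?thesis using qq_high[of t] adm by (auto simp: admissible_def)
qed

text \<open>Up to 3/2 the lower barrier for K reduces the claim to \<open>supersol\<close>. Beyond
  3/2 positivity of K and z <= 1/21 suffice.\<close>

lemma defect_nonneg: assumes t: "tp \<le> t" shows "0 \<le> defect t"
proof -
  have t0: "0 < t" "41/100 \<le> t" using t tp(1) adm by (auto simp: admissible_def)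
  have "0 \<le> t\<^sup>2 * defect t"
  proof (cases "t \<le> 3/2")
    case True
    define s where "s = 51/50 * t + 31/200 - 1/20 * z t"
    have s: "0 < s" using z_less_2[OF t] t0 by (simp add: s_def)
    have "2 * z t \<le> K t * s" using K_low[OF t t0(2)] s by (simp add: s_def pos_divide_le_eq)
    then have "t\<^sup>2 * qq t * (2 * z t) \<le> t\<^sup>2 * qq t * (K t * s)"
      using qq_nonneg[of t] t0 by (intro mult_left_mono) auto
    moreover have "s * (t\<^sup>2 * defect t) = supersol A B C t (z t) + t\<^sup>2 * qq t * (K t * s) - t\<^sup>2 * qq t * (2 * z t)"
    proof -
      have "t\<^sup>2 * defect t = t\<^sup>2 * ddq t - 4 * (t\<^sup>2 * (1 - z t) + t) * dqq t
          + qq t * (4 * t\<^sup>2 + t\<^sup>2 * K t + 8 * (1 - z t) * t + 6) - 3 * t\<^sup>2"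
        unfolding defect_def using t0 by (simp add: field_simps power2_eq_square)
      moreover have "ddq t = 2 * C" "dqq t = B + 2 * C * t" "qq t = A + B * t + C * t\<^sup>2"
        using True qq_low[OF True] by (auto simp: ddq_def)
      ultimately show ?thesis unfolding supersol_def s_def by algebra
    qed
    moreover have "0 \<le> supersol A B C t (z t)" using adm t True by (simp add: admissible_def)
    ultimately have "0 \<le> s * (t\<^sup>2 * defect t)" by linarith
    then show ?thesis using s by (simp add: zero_le_mult_iff)
  next
    case False
    then have h: "3/2 \<le> t" "\<not> t \<le> 3/2" by auto
    define A' where "A' = A - 9/4 * C"
    define B' where "B' = B + 3 * C"
    have AB: "0 \<le> A'" "0 \<le> B'" using adm by (auto simp: A'_def B'_def admissible_def)
    have "t\<^sup>2 * defect t = B' * (4 * t ^ 3 + 4 * (1 - z t) * t\<^sup>2 + 2 * t)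
        + A' * (4 * t\<^sup>2 + 8 * (1 - z t) * t + 6) - 3 * t\<^sup>2 + t\<^sup>2 * qq t * K t"
    proof -
      have "t\<^sup>2 * defect t = t\<^sup>2 * ddq t - 4 * (t\<^sup>2 * (1 - z t) + t) * dqq t
          + qq t * (4 * t\<^sup>2 + t\<^sup>2 * K t + 8 * (1 - z t) * t + 6) - 3 * t\<^sup>2"
        unfolding defect_def using t0 by (simp add: field_simps power2_eq_square)
      moreover have "ddq t = 0" "dqq t = B'" "qq t = A' + B' * t"
        using h qq_high[OF h(1)] by (auto simp: ddq_def A'_def B'_def)
      ultimately show ?thesis by algebra
    qed
    moreover have "0 \<le> t\<^sup>2 * qq t * K t" using qq_nonneg[of t] K_pos[OF t0(1)] t0 by simp
    moreover have z: "20/21 \<le> 1 - z t" and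
      tail: "0 \<le> B' * (4 * t ^ 3 + 80/21 * t\<^sup>2 + 2 * t) + A' * (4 * t\<^sup>2 + 160/21 * t + 6) - 3 * t\<^sup>2"
      using adm h by (auto simp: admissible_def A'_def B'_def)
    moreover have "B' * (4 * t ^ 3 + 80/21 * t\<^sup>2 + 2 * t) \<le> B' * (4 * t ^ 3 + 4 * (1 - z t) * t\<^sup>2 + 2 * t)"
    proof -
      have "80/21 * t\<^sup>2 \<le> 4 * (1 - z t) * t\<^sup>2" by (rule mult_right_mono) (use z in auto)
      then show ?thesis using AB(2) by (intro mult_left_mono add_mono order_refl)
    qed
    moreover have "A' * (4 * t\<^sup>2 + 160/21 * t + 6) \<le> A' * (4 * t\<^sup>2 + 8 * (1 - z t) * t + 6)"
    proof -
      have "160/21 * t \<le> 8 * (1 - z t) * t" by (rule mult_right_mono) (use z t0 in auto)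
      then show ?thesis using AB(1) by (intro mult_left_mono add_mono order_refl)
    qed
    ultimately show ?thesis by linarith
  qed
  then show ?thesis using t0 by (simp add: zero_le_mult_iff)
qed

text \<open>Makes w tp the minimum of w on [tp, inf), so that one inequality at tp provides the
  constant m of \<open>sturm_growth\<close>.\<close>

lemma dw_nonneg: assumes t: "tp \<le> t" shows "0 \<le> dw t"
proof -
  have t0: "0 < t" using t tp(1) by simp
  have "dqq t \<le> 2 * qq t * (1 - z t + 1 / t)"
  proof (cases "t \<le> 3/2")
    case True
    then show ?thesis using adm t qq_low[OF True] by (simp add: admissible_def)
  next
    case False
    define B' where "B' = B + 3 * C"
    have B': "0 \<le> B'" using adm by (auto simp: B'_def admissible_def)
    have "z t \<le> 1/21" using adm False by (auto simp: admissible_def)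
    then have "1/2 \<le> 1 - z t + 1 / t" using t0 by (simp add: add_increasing2)
    moreover have "B' * 1 \<le> B' * t" using B' False by (intro mult_left_mono) auto
    then have "B' \<le> qq t" using qq_high[of t] False adm by (auto simp: admissible_def B'_def)
    ultimately have "2 * B' * (1/2) \<le> 2 * qq t * (1 - z t + 1 / t)" using B' by (intro mult_mono) auto
    then show ?thesis using qq_high[of t] False by (simp add: B'_def)
  qed
  then show ?thesis by (simp add: dw_def)
qed

lemma w_cont: "continuous_on {tp..} w" and dw_cont: "continuous_on {tp..} dw"
proof -
  have Qc: "continuous_on {tp..} Q" by (rule continuous_on_subset[OF Q_cont]) (use tp in auto)
  have zc: "continuous_on {tp..} z"
  proof (rule continuous_at_imp_continuous_on, rule ballI)
    fix x assume "x \<in> {tp..}"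
    then show "isCont z x" using DERIV_isCont[OF z_deriv[of x]] tp(1) by simp
  qed
  show "continuous_on {tp..} w" unfolding w_def[abs_def] qq_def[abs_def]
    by (intro continuous_intros Qc)
  show "continuous_on {tp..} dw" unfolding dw_def[abs_def] qq_def[abs_def] dqq_def[abs_def]
    by (intro continuous_intros Qc zc) (use tp(1) in auto)
qed

lemma w_mono: assumes "tp \<le> t" shows "w tp \<le> w t"
proof (rule increasing_except_one_point[OF assms, of w "3/2"])
  show "continuous_on {tp..t} w" by (rule continuous_on_subset[OF w_cont]) auto
  show "\<exists>y. (w has_real_derivative y) (at x) \<and> 0 \<le> y" if "tp < x" "x < t" "x \<noteq> 3/2" for x
    using w_deriv[of x] dw_nonneg[of x] that tp(1) by auto
qed

lemma w_tp_pos: "0 < w tp"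
  using adm qq_low[of tp] tp_bounds(2) by (simp add: admissible_def w_def)

lemma w_le_1: "0 \<le> t \<Longrightarrow> w t \<le> 1"
  using qq_nonneg[of t] by (simp add: w_def)

lemma shifted_solution_growth:
  assumes ode: "solves_lin_ode (\<lambda>t. Q (t + s)) f df" and f0: "f 0 = 0" "df 0 = 1" and s: "tp \<le> s" and t: "0 < t"
  shows "(w tp)\<^sup>2 * t \<le> f t"
proof (rule sturm_growth[where w = "\<lambda>t. w (t + s)" and dw = "\<lambda>t. dw (t + s)" and df = df
      and ddw = "\<lambda>t. - ((Q (t + s))\<^sup>2 * (defect (t + s) + 3 * w (t + s)))" and V = "\<lambda>t. 3 * (Q (t + s))\<^sup>2" and c = "3/2 - s"])
  show "continuous_on {0..} (\<lambda>t. w (t + s))" "continuous_on {0..} (\<lambda>t. dw (t + s))"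
    using s by (auto intro!: continuous_on_compose2[OF w_cont] continuous_on_compose2[OF dw_cont] continuous_intros)
  show "continuous_on {0..} f" "continuous_on {0..} df"
    "\<And>t. 0 < t \<Longrightarrow> (f has_real_derivative df t) (at t)"
    "\<And>t. 0 < t \<Longrightarrow> (df has_real_derivative - (3 * (Q (t + s))\<^sup>2 * f t)) (at t)"
    using ode by (auto simp: solves_lin_ode_def)
  fix x :: real assume x: "0 < x" "x \<noteq> 3/2 - s"
  then have xs: "0 < x + s" "x + s \<noteq> 3/2" "tp \<le> x + s" using s tp(1) by auto
  show "((\<lambda>t. w (t + s)) has_real_derivative dw (x + s)) (at x)"
    using w_deriv[OF xs(1,2)] by (simp add: DERIV_shift)
  show "((\<lambda>t. dw (t + s)) has_real_derivative - ((Q (x + s))\<^sup>2 * (defect (x + s) + 3 * w (x + s)))) (at x)"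
    using dw_deriv[OF xs(1,2)] by (simp add: DERIV_shift)
  have "0 \<le> (Q (x + s))\<^sup>2 * defect (x + s)" using defect_nonneg[OF xs(3)] by simp
  then show "- ((Q (x + s))\<^sup>2 * (defect (x + s) + 3 * w (x + s))) + 3 * (Q (x + s))\<^sup>2 * w (x + s) \<le> 0"
    by (simp add: algebra_simps)
next
  fix x :: real assume x: "0 \<le> x"
  show "w tp \<le> w (x + s)" using w_mono[of "x + s"] x s by simp
  show "w (x + s) \<le> 1" using w_le_1[of "x + s"] x s tp(1) by simp
qed (use f0 t w_tp_pos in auto)

end

end

theorem theorem6p1:
  fixes Q dQ F0 dF0 q dq :: "real \<Rightarrow> real" and t0 :: real
  assumes "ground_state_profile Q dQ"
    and "solves_lin_ode Q F0 dF0" and "F0 0 = 0" and "dF0 0 = -1"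
    and "t0 > 0" and "F0 t0 = 0" and "\<forall>t. 0 < t \<and> t < t0 \<longrightarrow> F0 t \<noteq> 0"
    and "solves_lin_ode (\<lambda>t. Q (t + t0)) q dq" and "q 0 = 0" and "dq 0 = 1"
  shows "(\<forall>t>0. q t > 0) \<and> (\<exists>c0>0. \<forall>t\<ge>1. q t / t \<ge> c0)"
proof -
  interpret ground_state Q dQ by unfold_locales (rule assms(1))
  obtain A B C where adm: "admissible A B C" using admissible_exists .
  define m where "m = (w A B C tp)\<^sup>2"
  have m: "0 < m" using w_tp_pos[OF adm] by (simp add: m_def)
  have "tp \<le> t0" using assms(7) by (intro tp_le_first_zero[OF assms(2-6)]) auto
  then have growth: "m * t \<le> q t" if "0 < t" for t
    using shifted_solution_growth[OF adm assms(8-10) _ that] by (simp add: m_def)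
  have "0 < q t" if "0 < t" for t
    using growth[OF that] mult_pos_pos[OF m that] by linarith
  moreover have "m \<le> q t / t" if "1 \<le> t" for t
    using growth[of t] that by (simp add: pos_le_divide_eq)
  ultimately show ?thesis using m by blast
qed

end
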